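(* Let $(H\to\mathbb{C}\times M,\nabla)$ and $(\widetilde H\to\mathbb{C}\times M,\widetilde\nabla)$ be two holomorphic $(TE)$-structures over the same manifold $M$. Let $t^0\in M$. Suppose that the restriction of at least one of the two $(TE)$-structures to $t^0$ (i.e. to $\mathbb{C}\times\{t^0\}$) is regular singular at $z=0$. Then any formal isomorphism between the $(TE)$-structures over the germ $(M,t^0)$ is holomorphic.
   Context: $M$ is a complex manifold, $z$ the coordinate on $\mathbb{C}$. A $(TE)$-structure $(H\to\mathbb{C}\times M,\nabla)$ is a holomorphic vector bundle $H\to\mathbb{C}\times M$ with a flat connection $\nabla$ on $H|_{\mathbb{C}^*\times M}$ such that $\nabla:\mathcal{O}(H)\to\big(\frac1z\mathcal{O}_{\mathbb{C}\times M}\cdot\Omega^1_M+\frac1{z^2}\mathcal{O}_{\mathbb{C}\times M}\cdot dz\big)\otimes\mathcal{O}(H)$. Let $\underline{v}$, $\underline{\widetilde v}$ be bases of $\mathcal{O}(H)_{(0,t^0)}$, $\mathcal{O}(\widetilde H)_{(0,t^0)}$, let $t=(t_1,\dots,t_n)$ be local coordinates on $M$ near $t^0$, $\partial_i=\partial/\partial t_i$, and write $\nabla\underline{v}=\underline{v}\cdot(\sum_iz^{-1}A_i\,dt_i+z^{-2}B\,dz)$, $\widetilde\nabla\underline{\widetilde v}=\underline{\widetilde v}\cdot(\sum_iz^{-1}\widetilde A_i\,dt_i+z^{-2}\widetilde B\,dz)$ with holomorphic matrices $A_i,B,\widetilde A_i,\widetilde B$. A formal isomorphism over the germ $(M,t^0)$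 is given by an invertible matrix $T=\sum_{k\ge0}T^{(k)}z^k$, whose coefficients $T^{(k)}$ are matrices of holomorphic functions on a common neighborhood of $t^0$ and with $T^{(0)}$ invertible, such that $0=z\partial_iT+A_iT-T\widetilde A_i$ for all $i$ and $0=z^2\partial_zT+BT-T\widetilde B$; it maps $\underline{v}\cdot T$ to $\underline{\widetilde v}$. It is holomorphic if $T$ converges to a holomorphic matrix near $(0,t^0)\in\mathbb{C}\times M$. *)

theory Defs
  imports "HOL-Complex_Analysis.Complex_Analysis"
begin

section \<open>Holomorphic functions of several variables\<close>

text \<open>
  The model space of an \<open>n\<close>-dimensional complex manifold is \<open>coord_space I\<close>, a copy of
  \<open>\<complex>\<^sup>n\<close> with coordinates indexed by a set \<open>I\<close> of \<open>n\<close> indices of a finite type.  With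
  \<open>I = UNIV\<close> this is the full space \<open>complex ^ 'n\<close>; the subset \<open>I\<close> is there because index types are
  nonempty, so that \<open>I = {}\<close> is needed for manifolds of dimension \<open>0\<close> (points).
\<close>

definition coord_space :: "'n::finite set \<Rightarrow> (complex ^ 'n) set" where
  "coord_space I = {x. \<forall>i. i \<notin> I \<longrightarrow> x $ i = 0}"

text \<open>
  Holomorphic means: complex differentiable, i.e. real differentiable with complex linear derivative.
  Both notions are used only for sets \<open>S\<close> that are relatively open in \<open>coord_space I\<close>,
  respectively in \<open>UNIV \<times> coord_space I\<close>; the derivative is then unique.
\<close>

definition holo_on :: "'n::finite set \<Rightarrow> (complex ^ 'n) set \<Rightarrow> (complex ^ 'n \<Rightarrow> complex) \<Rightarrow> bool" where
  "holo_on I S f \<longleftrightarrow>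
     (\<forall>x\<in>S. \<exists>b. (f has_derivative (\<lambda>h. \<Sum>i\<in>I. b i * h $ i)) (at x within S))"

definition holo_z_on ::
  "'n::finite set \<Rightarrow> (complex \<times> (complex ^ 'n)) set \<Rightarrow> (complex \<times> (complex ^ 'n) \<Rightarrow> complex) \<Rightarrow> bool" where
  "holo_z_on I S f \<longleftrightarrow>
     (\<forall>p\<in>S. \<exists>a b. (f has_derivative (\<lambda>(w, h). a * w + (\<Sum>i\<in>I. b i * h $ i))) (at p within S))"

definition coord_deriv :: "'n::finite \<Rightarrow> (complex ^ 'n \<Rightarrow> complex) \<Rightarrow> complex ^ 'n \<Rightarrow> complex" where
  "coord_deriv i f x = deriv (\<lambda>w. f (x + axis i w)) 0"


section \<open>Complex manifolds\<close>

text \<open>A chart is a pair \<open>(U, \<phi>)\<close>; the values of \<open>\<phi>\<close> outside \<open>U\<close> are irrelevant.\<close>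

type_synonym ('m, 'n) chart = "'m set \<times> ('m \<Rightarrow> complex ^ 'n)"

abbreviation chart_inv :: "('m, 'n) chart \<Rightarrow> complex ^ 'n \<Rightarrow> 'm" where
  "chart_inv c \<equiv> inv_into (fst c) (snd c)"

definition is_chart :: "'n::finite set \<Rightarrow> ('m::topological_space, 'n) chart \<Rightarrow> bool" where
  "is_chart I c \<longleftrightarrow> open (fst c) \<and> openin (top_of_set (coord_space I)) (snd c ` fst c) \<and>
     homeomorphism (fst c) (snd c ` fst c) (snd c) (chart_inv c)"

definition holo_transition :: "'n::finite set \<Rightarrow> ('m, 'n) chart \<Rightarrow> ('m, 'n) chart \<Rightarrow> bool" where
  "holo_transition I c d \<longleftrightarrow>
     (\<forall>j. holo_on I (snd c ` (fst c \<inter> fst d)) (\<lambda>x. snd d (chart_inv c x) $ j))"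

definition complex_manifold ::
  "'n::finite set \<Rightarrow> ('m::{second_countable_topology, t2_space}, 'n) chart set \<Rightarrow> bool" where
  "complex_manifold I \<A> \<longleftrightarrow>
     (\<Union>c\<in>\<A>. fst c) = UNIV \<and> (\<forall>c\<in>\<A>. is_chart I c) \<and> (\<forall>c\<in>\<A>. \<forall>d\<in>\<A>. holo_transition I c d)"

definition local_coordinates ::
  "'n::finite set \<Rightarrow> ('m::topological_space, 'n) chart set \<Rightarrow> ('m, 'n) chart \<Rightarrow> bool" where
  "local_coordinates I \<A> c \<longleftrightarrow>
     is_chart I c \<and> (\<forall>d\<in>\<A>. holo_transition I c d \<and> holo_transition I d c)"

definition in_coords ::
  "('m, 'n) chart \<Rightarrow> (complex \<times> 'm) set \<Rightarrow> (complex \<times> (complex ^ 'n)) set" where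
  "in_coords c W = (\<lambda>(z, m). (z, snd c m)) ` (W \<inter> UNIV \<times> fst c)"

definition holo_fun ::
  "'n::finite set \<Rightarrow> ('m, 'n) chart set \<Rightarrow> (complex \<times> 'm) set \<Rightarrow> (complex \<times> 'm \<Rightarrow> complex) \<Rightarrow> bool" where
  "holo_fun I \<A> W f \<longleftrightarrow>
     (\<forall>c\<in>\<A>. holo_z_on I (in_coords c W) (\<lambda>(z, x). f (z, chart_inv c x)))"

text \<open>
  Coordinate vector fields on \<open>\<complex> \<times> M\<close> for a chart of \<open>M\<close>: \<open>None\<close> stands for
  \<open>\<partial>\<^sub>z\<close> and \<open>Some i\<close> for \<open>\<partial>\<^sub>i\<close>.
\<close>

definition directions :: "'n set \<Rightarrow> 'n option set" where
  "directions I = insert None (Some ` I)"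

definition partial ::
  "('m, 'n::finite) chart \<Rightarrow> 'n option \<Rightarrow> (complex \<times> 'm \<Rightarrow> complex) \<Rightarrow> complex \<times> 'm \<Rightarrow> complex" where
  "partial c d f = (\<lambda>(z, m). case d of
       None \<Rightarrow> deriv (\<lambda>w. f (w, m)) z
     | Some i \<Rightarrow> coord_deriv i (\<lambda>x. f (z, chart_inv c x)) (snd c m))"


section \<open>Holomorphic vector bundles on \<open>\<complex> \<times> M\<close>\<close>

text \<open>
  A bundle of rank \<open>CARD('r)\<close> with total space \<open>'h\<close>: the second field is a set of pairs \<open>(W, \<psi>)\<close>
  where \<open>\<psi>\<close> is the fibre component of a trivialisation
  \<open>\<pi>\<^sup>-\<^sup>1(W) \<rightarrow> W \<times> \<complex>\<^sup>r\<close>.  The topology and complex structure of the total space and the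
  vector space structure of the fibres are the ones transported by the trivialisations.
\<close>

record ('m, 'h, 'r::finite) vbundle =
  proj :: "'h \<Rightarrow> complex \<times> 'm"
  trivs :: "((complex \<times> 'm) set \<times> ('h \<Rightarrow> complex ^ 'r)) set"

definition holomorphic_bundle ::
  "'n::finite set \<Rightarrow> ('m::topological_space, 'n) chart set \<Rightarrow> ('m, 'h, 'r::finite) vbundle \<Rightarrow> bool" where
  "holomorphic_bundle I \<A> H \<longleftrightarrow>
     (\<Union>\<tau>\<in>trivs H. fst \<tau>) = UNIV \<and>
     (\<forall>(W, \<psi>)\<in>trivs H. open W \<and>
        bij_betw (\<lambda>h. (proj H h, \<psi> h)) (proj H -` W) (W \<times> UNIV)) \<and>
     (\<forall>(W, \<psi>)\<in>trivs H. \<forall>(W', \<psi>')\<in>trivs H. \<exists>g :: complex \<times> 'm \<Rightarrow> complex ^ 'r ^ 'r.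
        (\<forall>a b. holo_fun I \<A> (W \<inter> W') (\<lambda>p. g p $ a $ b)) \<and>
        (\<forall>p\<in>W \<inter> W'. invertible (g p)) \<and>
        (\<forall>h\<in>proj H -` (W \<inter> W'). \<psi>' h = g (proj H h) *v \<psi> h))"

text \<open>Linear combination \<open>\<Sum>j\<in>J. a j \<cdot> v j\<close> in the fibre over \<open>p\<close>.\<close>

definition lincomb ::
  "('m, 'h, 'r::finite) vbundle \<Rightarrow> complex \<times> 'm \<Rightarrow> 'j set \<Rightarrow> ('j \<Rightarrow> complex) \<Rightarrow> ('j \<Rightarrow> 'h) \<Rightarrow> 'h" where
  "lincomb H p J a v = (THE h. proj H h = p \<and>
     (\<forall>(W, \<psi>)\<in>trivs H. p \<in> W \<longrightarrow> \<psi> h = (\<Sum>j\<in>J. a j *s \<psi> (v j))))"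

definition fibre_add :: "('m, 'h, 'r::finite) vbundle \<Rightarrow> 'h \<Rightarrow> 'h \<Rightarrow> 'h" where
  "fibre_add H h k = lincomb H (proj H h) UNIV (\<lambda>_. 1) (\<lambda>j. if j then h else k)"

definition fibre_scale :: "('m, 'h, 'r::finite) vbundle \<Rightarrow> complex \<Rightarrow> 'h \<Rightarrow> 'h" where
  "fibre_scale H a h = lincomb H (proj H h) {()} (\<lambda>_. a) (\<lambda>_. h)"

definition holo_section ::
  "'n::finite set \<Rightarrow> ('m, 'n) chart set \<Rightarrow> ('m, 'h, 'r::finite) vbundle \<Rightarrow>
   (complex \<times> 'm) set \<Rightarrow> (complex \<times> 'm \<Rightarrow> 'h) \<Rightarrow> bool" where
  "holo_section I \<A> H W s \<longleftrightarrow> (\<forall>p\<in>W. proj H (s p) = p) \<and>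
     (\<forall>(W', \<psi>)\<in>trivs H. \<forall>a. holo_fun I \<A> (W \<inter> W') (\<lambda>p. \<psi> (s p) $ a))"

text \<open>A local frame on \<open>W\<close>, i.e. a basis of the module of sections over \<open>W\<close>.\<close>

definition local_frame ::
  "'n::finite set \<Rightarrow> ('m::topological_space, 'n) chart set \<Rightarrow> ('m, 'h, 'r::finite) vbundle \<Rightarrow>
   (complex \<times> 'm) set \<Rightarrow> ('r \<Rightarrow> complex \<times> 'm \<Rightarrow> 'h) \<Rightarrow> bool" where
  "local_frame I \<A> H W v \<longleftrightarrow> open W \<and> (\<forall>j. holo_section I \<A> H W (v j)) \<and>
     (\<forall>(W', \<psi>)\<in>trivs H. \<forall>p\<in>W \<inter> W'. invertible (\<chi> a j. \<psi> (v j p) $ a))"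


section \<open>(TE)-structures\<close>

text \<open>
  A connection \<open>\<nabla>\<close> is given by its covariant derivatives: \<open>D c d s\<close> is the derivative
  \<open>\<nabla>\<^sub>d s\<close> of the local section \<open>s\<close> along the coordinate vector field \<open>d\<close> of the chart \<open>c\<close>.  Sections
  are total functions; by \<open>locality\<close> only their values on the open set under consideration matter.
\<close>

type_synonym ('m, 'n, 'h) covariant =
  "('m, 'n) chart \<Rightarrow> 'n option \<Rightarrow> (complex \<times> 'm \<Rightarrow> 'h) \<Rightarrow> complex \<times> 'm \<Rightarrow> 'h"

locale TE_structure =
  fixes I :: "'n::finite set"
    and \<A> :: "('m::{second_countable_topology, t2_space}, 'n) chart set"
    and H :: "('m, 'h, 'r::finite) vbundle"
    and D :: "('m, 'n, 'h) covariant"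
  assumes manifold: "complex_manifold I \<A>"
    and vector_bundle: "holomorphic_bundle I \<A> H"
    \<comment> \<open>\<open>D\<close> is a holomorphic connection on the restriction of \<open>H\<close> to \<open>(- {0}) \<times> M\<close>\<close>
    and holomorphic:
      "\<lbrakk>local_coordinates I \<A> c; d \<in> directions I; open W; W \<subseteq> (- {0}) \<times> fst c;
        holo_section I \<A> H W s\<rbrakk> \<Longrightarrow> holo_section I \<A> H W (D c d s)"
    and locality:
      "\<lbrakk>local_coordinates I \<A> c; d \<in> directions I; open W; W \<subseteq> (- {0}) \<times> fst c;
        holo_section I \<A> H W s; holo_section I \<A> H W s'; \<forall>q\<in>W. s q = s' q; p \<in> W\<rbrakk>
       \<Longrightarrow> D c d s p = D c d s' p"
    and additive:
      "\<lbrakk>local_coordinates I \<A> c; d \<in> directions I; open W; W \<subseteq> (- {0}) \<times> fst c;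
        holo_section I \<A> H W s; holo_section I \<A> H W s'; p \<in> W\<rbrakk>
       \<Longrightarrow> D c d (\<lambda>q. fibre_add H (s q) (s' q)) p = fibre_add H (D c d s p) (D c d s' p)"
    and leibniz:
      "\<lbrakk>local_coordinates I \<A> c; d \<in> directions I; open W; W \<subseteq> (- {0}) \<times> fst c;
        holo_section I \<A> H W s; holo_fun I \<A> W f; p \<in> W\<rbrakk>
       \<Longrightarrow> D c d (\<lambda>q. fibre_scale H (f q) (s q)) p =
            fibre_add H (fibre_scale H (partial c d f p) (s p)) (fibre_scale H (f p) (D c d s p))"
    \<comment> \<open>\<open>D\<close> is tensorial in the vector field: transformation under a change of coordinates on \<open>M\<close>\<close>
    and change_z:
      "\<lbrakk>local_coordinates I \<A> c; local_coordinates I \<A> c'; open W;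
        W \<subseteq> (- {0}) \<times> (fst c \<inter> fst c'); holo_section I \<A> H W s; p \<in> W\<rbrakk>
       \<Longrightarrow> D c' None s p = D c None s p"
    and change_t:
      "\<lbrakk>local_coordinates I \<A> c; local_coordinates I \<A> c'; i \<in> I; open W;
        W \<subseteq> (- {0}) \<times> (fst c \<inter> fst c'); holo_section I \<A> H W s; p \<in> W\<rbrakk>
       \<Longrightarrow> D c' (Some i) s p =
            lincomb H p I (\<lambda>j. partial c' (Some i) (\<lambda>(z, m). snd c m $ j) p) (\<lambda>j. D c (Some j) s p)"
    \<comment> \<open>coordinate vector fields commute, so their covariant derivatives do if \<open>\<nabla>\<close> is flat\<close>
    and flat:
      "\<lbrakk>local_coordinates I \<A> c; d \<in> directions I; d' \<in> directions I; open W;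
        W \<subseteq> (- {0}) \<times> fst c; holo_section I \<A> H W s; p \<in> W\<rbrakk>
       \<Longrightarrow> D c d (D c d' s) p = D c d' (D c d s) p"
    \<comment> \<open>pole orders at most 1 in the \<open>dt\<close> and 2 in the \<open>dz\<close> direction along \<open>z = 0\<close>\<close>
    and pole_t:
      "\<lbrakk>local_coordinates I \<A> c; i \<in> I; open W; W \<subseteq> UNIV \<times> fst c; holo_section I \<A> H W s\<rbrakk>
       \<Longrightarrow> \<exists>s'. holo_section I \<A> H W s' \<and>
            (\<forall>(z, m)\<in>W. z \<noteq> 0 \<longrightarrow> s' (z, m) = fibre_scale H z (D c (Some i) s (z, m)))"
    and pole_z:
      "\<lbrakk>local_coordinates I \<A> c; open W; W \<subseteq> UNIV \<times> fst c; holo_section I \<A> H W s\<rbrakk>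
       \<Longrightarrow> \<exists>s'. holo_section I \<A> H W s' \<and>
            (\<forall>(z, m)\<in>W. z \<noteq> 0 \<longrightarrow> s' (z, m) = fibre_scale H (z\<^sup>2) (D c None s (z, m)))"

text \<open>
  \<open>TE_basis\<close>: \<open>v\<close> is a frame on the neighbourhood \<open>W\<close> of \<open>(0, t\<^sub>0)\<close>, \<open>c\<close> are local coordinates \<open>t\<close> on \<open>M\<close>
  near \<open>t\<^sub>0\<close>, and \<open>\<nabla>v = v \<cdot> (\<Sum>i\<in>I. z\<^sup>-\<^sup>1 A\<^sub>i dt\<^sub>i + z\<^sup>-\<^sup>2 B dz)\<close>, where the matrices
  \<open>A i\<close> and \<open>B\<close> are holomorphic in \<open>(z, t)\<close>.
\<close>

definition TE_basis ::
  "'n::finite set \<Rightarrow> ('m::topological_space, 'n) chart set \<Rightarrow> ('m, 'h, 'r::finite) vbundle \<Rightarrow>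
   ('m, 'n, 'h) covariant \<Rightarrow> 'm \<Rightarrow> ('m, 'n) chart \<Rightarrow> (complex \<times> 'm) set \<Rightarrow>
   ('r \<Rightarrow> complex \<times> 'm \<Rightarrow> 'h) \<Rightarrow> ('n \<Rightarrow> complex \<times> (complex ^ 'n) \<Rightarrow> complex ^ 'r ^ 'r) \<Rightarrow>
   (complex \<times> (complex ^ 'n) \<Rightarrow> complex ^ 'r ^ 'r) \<Rightarrow> bool" where
  "TE_basis I \<A> H D t\<^sub>0 c W v A B \<longleftrightarrow>
     local_coordinates I \<A> c \<and> (0, t\<^sub>0) \<in> W \<and> W \<subseteq> UNIV \<times> fst c \<and> local_frame I \<A> H W v \<and>
     (\<forall>i\<in>I. \<forall>a b. holo_z_on I (in_coords c W) (\<lambda>p. A i p $ a $ b)) \<and>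
     (\<forall>a b. holo_z_on I (in_coords c W) (\<lambda>p. B p $ a $ b)) \<and>
     (\<forall>(z, m)\<in>W. z \<noteq> 0 \<longrightarrow> (\<forall>j.
        (\<forall>i\<in>I. D c (Some i) (v j) (z, m) =
           lincomb H (z, m) UNIV (\<lambda>k. A i (z, snd c m) $ k $ j / z) (\<lambda>k. v k (z, m))) \<and>
        D c None (v j) (z, m) =
           lincomb H (z, m) UNIV (\<lambda>k. B (z, snd c m) $ k $ j / z\<^sup>2) (\<lambda>k. v k (z, m))))"

text \<open>
  A system with connection matrix \<open>z\<^sup>-\<^sup>2 B(z) dz\<close> is regular singular at \<open>0\<close> iff a meromorphic
  change of basis \<open>P\<close> turns it into one with at most a simple pole:
  \<open>P\<^sup>-\<^sup>1 (z\<^sup>-\<^sup>2 B) P + P\<^sup>-\<^sup>1 P' = z\<^sup>-\<^sup>1 C\<close> with \<open>C\<close> holomorphic at \<open>0\<close>.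
\<close>

definition regular_singular_system :: "(complex \<Rightarrow> complex ^ 'r ^ 'r::finite) \<Rightarrow> bool" where
  "regular_singular_system B \<longleftrightarrow> (\<exists>P C :: complex \<Rightarrow> complex ^ 'r ^ 'r.
     (\<forall>a b. (\<lambda>z. P z $ a $ b) meromorphic_on {0}) \<and>
     (\<forall>\<^sub>F z in at 0. invertible (P z)) \<and>
     (\<forall>a b. (\<lambda>z. C z $ a $ b) analytic_on {0}) \<and>
     (\<forall>\<^sub>F z in at 0. \<forall>a b.
        (B z ** P z) $ a $ b / z\<^sup>2 + deriv (\<lambda>w. P w $ a $ b) z = (P z ** C z) $ a $ b / z))"

text \<open>
  The restriction to \<open>\<complex> \<times> {t\<^sub>0}\<close> is regular singular at \<open>z = 0\<close>.  Restricted to \<open>t\<^sub>0\<close>, the connection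
  has the matrix \<open>z\<^sup>-\<^sup>2 B(z, t\<^sub>0) dz\<close>; the choice of basis does not matter.
\<close>

definition regular_singular_at ::
  "'n::finite set \<Rightarrow> ('m::topological_space, 'n) chart set \<Rightarrow> ('m, 'h, 'r::finite) vbundle \<Rightarrow>
   ('m, 'n, 'h) covariant \<Rightarrow> 'm \<Rightarrow> bool" where
  "regular_singular_at I \<A> H D t\<^sub>0 \<longleftrightarrow>
     (\<exists>c W v A B. TE_basis I \<A> H D t\<^sub>0 c W v A B \<and>
        regular_singular_system (\<lambda>z. B (z, snd c t\<^sub>0)))"


section \<open>Formal isomorphisms\<close>

text \<open>
  Matrices over \<open>complex fps\<close> are matrices of formal power series in \<open>z\<close>, for fixed \<open>t\<close>.
  \<open>taylor_z F\<close> is the Taylor expansion at \<open>z = 0\<close> of a holomorphic matrix.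
\<close>

definition fps_matrix :: "(nat \<Rightarrow> complex ^ 's ^ 'r) \<Rightarrow> complex fps ^ 's ^ 'r" where
  "fps_matrix X = (\<chi> a b. Abs_fps (\<lambda>k. X k $ a $ b))"

definition taylor_z :: "(complex \<Rightarrow> complex ^ 's ^ 'r) \<Rightarrow> complex fps ^ 's ^ 'r" where
  "taylor_z F = (\<chi> a b. fps_expansion (\<lambda>z. F z $ a $ b) 0)"

text \<open>
  \<open>T = (\<Sum>k. T k z\<^sup>k)\<close> with \<open>T k\<close> holomorphic in \<open>t \<in> S\<close>, where \<open>S\<close> is a neighbourhood of the base
  point in coordinates, satisfies
  \<open>0 = z \<partial>\<^sub>i T + A\<^sub>i T - T A'\<^sub>i\<close> and \<open>0 = z\<^sup>2 \<partial>\<^sub>z T + B T - T B'\<close>.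
  The ranks \<open>CARD('r)\<close>, \<open>CARD('s)\<close> are not assumed equal beforehand; \<open>invertible\<close> asks for a
  two-sided inverse.
\<close>

definition formal_isomorphism ::
  "'n::finite set \<Rightarrow> (complex ^ 'n) set \<Rightarrow>
   ('n \<Rightarrow> complex \<times> (complex ^ 'n) \<Rightarrow> complex ^ 'r ^ 'r::finite) \<Rightarrow>
   (complex \<times> (complex ^ 'n) \<Rightarrow> complex ^ 'r ^ 'r) \<Rightarrow>
   ('n \<Rightarrow> complex \<times> (complex ^ 'n) \<Rightarrow> complex ^ 's ^ 's::finite) \<Rightarrow>
   (complex \<times> (complex ^ 'n) \<Rightarrow> complex ^ 's ^ 's) \<Rightarrow>
   (nat \<Rightarrow> complex ^ 'n \<Rightarrow> complex ^ 's ^ 'r) \<Rightarrow> bool" where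
  "formal_isomorphism I S A B A' B' T \<longleftrightarrow>
     (\<forall>k a b. holo_on I S (\<lambda>x. T k x $ a $ b)) \<and>
     (\<forall>x\<in>S. invertible (T 0 x)) \<and>
     (\<forall>x\<in>S. \<forall>i\<in>I.
        0 = (\<chi> a b. fps_X * Abs_fps (\<lambda>k. coord_deriv i (\<lambda>y. T k y $ a $ b) x))
            + taylor_z (\<lambda>z. A i (z, x)) ** fps_matrix (\<lambda>k. T k x)
            - fps_matrix (\<lambda>k. T k x) ** taylor_z (\<lambda>z. A' i (z, x))) \<and>
     (\<forall>x\<in>S.
        0 = (\<chi> a b. fps_X\<^sup>2 * fps_deriv (fps_matrix (\<lambda>k. T k x) $ a $ b))
            + taylor_z (\<lambda>z. B (z, x)) ** fps_matrix (\<lambda>k. T k x)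
            - fps_matrix (\<lambda>k. T k x) ** taylor_z (\<lambda>z. B' (z, x)))"

definition converges_holomorphically ::
  "'n::finite set \<Rightarrow> ('m::topological_space, 'n) chart \<Rightarrow> 'm \<Rightarrow>
   (nat \<Rightarrow> complex ^ 'n \<Rightarrow> complex ^ 's ^ 'r) \<Rightarrow> bool" where
  "converges_holomorphically I c t\<^sub>0 T \<longleftrightarrow>
     (\<exists>\<epsilon>>0. \<exists>V. open V \<and> t\<^sub>0 \<in> V \<and> V \<subseteq> fst c \<and>
        (\<exists>F :: complex \<times> (complex ^ 'n) \<Rightarrow> complex ^ 's ^ 'r.
          (\<forall>a b. holo_z_on I (ball 0 \<epsilon> \<times> snd c ` V) (\<lambda>p. F p $ a $ b)) \<and>
          (\<forall>z\<in>ball 0 \<epsilon>. \<forall>x\<in>snd c ` V. \<forall>a b.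
             (\<lambda>k. T k x $ a $ b * z ^ k) sums (F (z, x) $ a $ b))))"

end

theory Submission
  imports Defs
begin

text \<open>
  At \<open>t\<^sub>0\<close>, a formal isomorphism \<open>T\<close> composed with the meromorphic gauge transformation that makes one
  of the systems Fuchsian gives a formal \<open>Y\<close>.  A sufficiently long truncation of \<open>Y\<close> is a convergent
  gauge transformation making the other system Fuchsian too, and formal isomorphisms between
  Fuchsian systems converge because in \<open>z Z' = Z C' - C Z\<close> the factor \<open>k\<close> in front of the \<open>k\<close>-th
  coefficient dominates the right hand side.  Hence \<open>T(z, t\<^sub>0)\<close> converges.

  To leave \<open>t\<^sub>0\<close>, restrict \<open>T\<close> to a complex line \<open>t = t\<^sub>0 + s h\<close> and expand in \<open>s\<close>.  The equations
  \<open>z \<partial>\<^sub>i T = T A'\<^sub>i - A\<^sub>i T\<close> give the coefficient of \<open>s\<^sup>n\<^sup>+\<^sup>1\<close> as \<open>z\<^sup>-\<^sup>1\<close> times a combination of the earlier ones.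
  As no negative powers of \<open>z\<close> occur, the division by \<open>z\<close> costs only a constant factor in a
  weighted coefficient norm, so the coefficients grow at most geometrically in \<open>n\<close>, uniformly in \<open>h\<close>.
\<close>

text \<open>The gauge matrices that occur are invertible only over Laurent series. They are kept as
  power series matrices with nonzero determinant, and an inverse is replaced by a matrix
  \<open>Q\<close> with \<open>P ** Q = fps_X ^ d *k mat 1\<close>; cancelling a power of
  \<open>fps_X\<close> does not affect convergence. A truncation has to go past the order of the
  determinant, since otherwise it could become singular. Regularity is assumed only at
  \<open>t\<^sub>0\<close>, so off \<open>t\<^sub>0\<close> the bound must be carried by the
  equations in the \<open>t\<close> directions. Their pole makes the derivative of the coefficient
  of \<open>z\<^sup>k\<close> depend on that of \<open>z\<^sup>k\<^sup>+\<^sup>1\<close>; with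
  weights \<open>b\<^sup>k\<close> each differentiation costs one factor \<open>b\<close>, the same
  for all \<open>k\<close>. Three mismatches shape the rest. The two ranks are different types, so
  \<open>T\<close> becomes square only after multiplication by a constant inverse of
  \<open>T 0\<close>. If only the second structure is regular, the dual systems exchange the roles.
  Regularity is witnessed in some frame and chart, not in the given ones, and the connection
  relating the two frames is not defined at \<open>z = 0\<close>.\<close>

no_notation fps_nth (infixl \<open>$\<close> 75)

section \<open>Matrices over a commutative ring and over convergent power series\<close>

text \<open>Cramer's rule: the adjugate is polynomial in the entries, so it exists over rings of
  power series and preserves convergence.\<close>

definition adj_matrix :: "'a::comm_ring_1 ^ 'n ^ 'n \<Rightarrow> 'a ^ 'n ^ 'n" where
  "adj_matrix A = (\<chi> k l. det (\<chi> i. if i = l then axis k 1 else A $ i))"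

definition scalar_matrix_mult :: "'a::times \<Rightarrow> 'a ^ 'n ^ 'm \<Rightarrow> 'a ^ 'n ^ 'm"  (infixr \<open>*k\<close> 72) where
  "c *k M = (\<chi> a b. c * M $ a $ b)"

lemma scalar_matrix_nth [simp]: "(c *k M) $ a $ b = c * M $ a $ b"
  by (simp add: scalar_matrix_mult_def)

lemma scalar_matrix_0 [simp]: "c *k 0 = (0 :: 'a::mult_zero ^ 'n ^ 'm)"
  by (simp add: vec_eq_iff)

lemma matrix_mult_nth: "(A ** B) $ a $ b = (\<Sum>k\<in>UNIV. A $ a $ k * B $ k $ b)"
  by (simp add: matrix_matrix_mult_def)

lemma matrix_mult_scalar_left:
  fixes A :: "'a::comm_semiring_1 ^ 'n ^ 'm"
  shows "(c *k A) ** B = c *k (A ** B)"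
  by (simp add: vec_eq_iff matrix_mult_nth sum_distrib_left mult.assoc)

lemma matrix_mult_scalar_right:
  fixes A :: "'a::comm_semiring_1 ^ 'n ^ 'm"
  shows "A ** (c *k B) = c *k (A ** B)"
  by (simp add: vec_eq_iff matrix_mult_nth sum_distrib_left mult.left_commute)

lemma scalar_scalar_matrix:
  fixes A :: "'a::comm_semiring_1 ^ 'n ^ 'm"
  shows "c *k (d *k A) = (c * d) *k A"
  by (simp add: vec_eq_iff mult.assoc)

lemma scalar_matrix_add_right:
  fixes A B :: "'a::comm_semiring_1 ^ 'n ^ 'm"
  shows "c *k (A + B) = c *k A + c *k B"
  by (simp add: vec_eq_iff distrib_left)

lemma scalar_matrix_diff_right:
  fixes A B :: "'a::comm_ring_1 ^ 'n ^ 'm"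
  shows "c *k (A - B) = c *k A - c *k B"
  by (simp add: vec_eq_iff right_diff_distrib)

lemma matrix_mult_add_right:
  fixes A :: "'a::comm_semiring_1 ^ 'n ^ 'm"
  shows "A ** (B + C) = A ** B + A ** C"
  by (simp add: vec_eq_iff matrix_mult_nth distrib_left sum.distrib)

lemma matrix_mult_add_left:
  fixes A :: "'a::comm_semiring_1 ^ 'n ^ 'm"
  shows "(A + B) ** C = A ** C + B ** C"
  by (simp add: vec_eq_iff matrix_mult_nth distrib_right sum.distrib)

lemma matrix_mult_diff_right:
  fixes A :: "'a::comm_ring_1 ^ 'n ^ 'm"
  shows "A ** (B - C) = A ** B - A ** C"
  by (simp add: vec_eq_iff matrix_mult_nth right_diff_distrib sum_subtractf)

lemma matrix_mult_diff_left:
  fixes A :: "'a::comm_ring_1 ^ 'n ^ 'm"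
  shows "(A - B) ** C = A ** C - B ** C"
  by (simp add: vec_eq_iff matrix_mult_nth left_diff_distrib sum_subtractf)

lemmas matrix_algebra =
  matrix_mult_scalar_left matrix_mult_scalar_right scalar_scalar_matrix scalar_matrix_add_right
  scalar_matrix_diff_right matrix_mult_add_right matrix_mult_add_left
  matrix_mult_diff_right matrix_mult_diff_left

lemma scalar_matrix_cancel:
  fixes A B :: "'a::idom ^ 'n ^ 'm"
  assumes "c *k A = c *k B" "c \<noteq> 0"
  shows "A = B"
  using assms by (simp add: vec_eq_iff)

text \<open>Expanding row \<open>m\<close> of \<open>A\<close> in unit vectors, linearity in row
  \<open>l\<close> turns the entry at \<open>m\<close>, \<open>l\<close> into the determinant of
  \<open>A\<close> with row \<open>l\<close> replaced by row \<open>m\<close>. For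
  \<open>m \<noteq> l\<close> two rows coincide.\<close>

lemma matrix_mult_adj_matrix:
  fixes A :: "'a::comm_ring_1 ^ 'n ^ 'n"
  shows "A ** adj_matrix A = det A *k mat 1"
proof -
  have "(A ** adj_matrix A) $ m $ l = (det A *k mat 1) $ m $ l" for m l
  proof -
    have "(A ** adj_matrix A) $ m $ l =
        (\<Sum>k\<in>UNIV. det (\<chi> i. if i = l then A $ m $ k *s axis k 1 else A $ i))"
      by (simp add: matrix_mult_nth adj_matrix_def det_row_mul)
    also have "\<dots> = det (\<chi> i. if i = l then (\<Sum>k\<in>UNIV. A $ m $ k *s axis k 1) else A $ i)"
      using det_linear_row_sum[of UNIV l "\<lambda>_ k. A $ m $ k *s axis k 1" "\<lambda>i. A $ i"] by simp
    also have "(\<Sum>k\<in>UNIV. A $ m $ k *s axis k 1) = A $ m"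
      by (rule basis_expansion)
    also have "det (\<chi> i. if i = l then A $ m else A $ i) = (if m = l then det A else 0)"
    proof (cases "m = l")
      case True
      then have "(\<chi> i. if i = l then A $ m else A $ i) = A" by (simp add: vec_eq_iff)
      with True show ?thesis by simp
    next
      case False
      then show ?thesis
        by (simp add: det_identical_rows[OF False] row_def)
    qed
    finally show ?thesis by (simp add: mat_def)
  qed
  then show ?thesis by (simp add: vec_eq_iff)
qed

text \<open>Transposition yields some left adjugate \<open>L\<close>; evaluating
  \<open>L ** A ** adj_matrix A\<close> in two ways identifies it with the right one, because
  \<open>det A\<close> can be cancelled in a domain.\<close>

lemma adj_matrix_mult:
  fixes A :: "'a::idom ^ 'n ^ 'n"
  assumes "det A \<noteq> 0"
  shows "adj_matrix A ** A = det A *k mat 1"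
proof -
  define L where "L = transpose (adj_matrix (transpose A))"
  have L: "L ** A = det A *k mat 1"
    using arg_cong[OF matrix_mult_adj_matrix[of "transpose A"], of transpose]
    by (simp add: matrix_transpose_mul L_def) (simp add: transpose_def vec_eq_iff mat_def)
  have "det A *k adj_matrix A = L ** A ** adj_matrix A"
    by (simp add: L matrix_mult_scalar_left)
  also have "\<dots> = det A *k L"
    by (simp add: matrix_mult_adj_matrix matrix_mult_scalar_right flip: matrix_mul_assoc)
  finally have "adj_matrix A = L"
    using assms by (rule scalar_matrix_cancel)
  with L show ?thesis by simp
qed

section \<open>Power series with positive radius of convergence, and matrices over them\<close>

definition conv_fps :: "complex fps \<Rightarrow> bool" where
  "conv_fps f \<longleftrightarrow> 0 < fps_conv_radius f"

named_theorems conv_intros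

lemma conv_fps_const [conv_intros]: "conv_fps (fps_const c)"
  and conv_fps_0 [conv_intros]: "conv_fps 0"
  and conv_fps_1 [conv_intros]: "conv_fps 1"
  and conv_fps_X [conv_intros]: "conv_fps fps_X"
  and conv_fps_shift [conv_intros]: "conv_fps f \<Longrightarrow> conv_fps (fps_shift n f)"
  and conv_fps_uminus [conv_intros]: "conv_fps f \<Longrightarrow> conv_fps (- f)"
  by (auto simp: conv_fps_def)

lemma conv_fps_add [conv_intros]: "conv_fps f \<Longrightarrow> conv_fps g \<Longrightarrow> conv_fps (f + g)"
  using fps_conv_radius_add[of f g] by (auto simp: conv_fps_def min_def split: if_splits)

lemma conv_fps_diff [conv_intros]: "conv_fps f \<Longrightarrow> conv_fps g \<Longrightarrow> conv_fps (f - g)"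
  using fps_conv_radius_diff[of f g] by (auto simp: conv_fps_def min_def split: if_splits)

lemma conv_fps_mult [conv_intros]: "conv_fps f \<Longrightarrow> conv_fps g \<Longrightarrow> conv_fps (f * g)"
  using fps_conv_radius_mult[of f g] by (auto simp: conv_fps_def min_def split: if_splits)

lemma conv_fps_power [conv_intros]: "conv_fps f \<Longrightarrow> conv_fps (f ^ n)"
  by (induction n) (auto intro: conv_intros)

lemma conv_fps_deriv [conv_intros]: "conv_fps f \<Longrightarrow> conv_fps (fps_deriv f)"
  using fps_conv_radius_deriv[of f] by (auto simp: conv_fps_def)

lemma conv_fps_sum [conv_intros]: "(\<And>x. x \<in> A \<Longrightarrow> conv_fps (f x)) \<Longrightarrow> conv_fps (sum f A)"
  by (induction A rule: infinite_finite_induct) (auto intro: conv_intros)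

lemma conv_fps_prod [conv_intros]: "(\<And>x. x \<in> A \<Longrightarrow> conv_fps (f x)) \<Longrightarrow> conv_fps (prod f A)"
  by (induction A rule: infinite_finite_induct) (auto intro: conv_intros)

lemma conv_fps_of_int [conv_intros]: "conv_fps (of_int n)"
  using conv_fps_const[of "of_int n"] by (simp add: fps_of_int)

lemma conv_fps_of_nat [conv_intros]: "conv_fps (of_nat n)"
  using conv_fps_const[of "of_nat n"] by (simp add: fps_of_nat)

lemma conv_fps_inverse [conv_intros]: "conv_fps f \<Longrightarrow> fps_nth f 0 \<noteq> 0 \<Longrightarrow> conv_fps (inverse f)"
  using fps_conv_radius_inverse_pos[of f] by (auto simp: conv_fps_def)

definition conv_mat :: "complex fps ^ 'n ^ 'm \<Rightarrow> bool" where
  "conv_mat M \<longleftrightarrow> (\<forall>a b. conv_fps (M $ a $ b))"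

lemma conv_matD: "conv_mat M \<Longrightarrow> conv_fps (M $ a $ b)"
  by (simp add: conv_mat_def)

lemma conv_fps_det [conv_intros]: "conv_mat M \<Longrightarrow> conv_fps (det M)"
  unfolding det_def by (intro conv_intros conv_matD)

lemma conv_mat_add [conv_intros]: "conv_mat A \<Longrightarrow> conv_mat B \<Longrightarrow> conv_mat (A + B)"
  and conv_mat_diff [conv_intros]: "conv_mat A \<Longrightarrow> conv_mat B \<Longrightarrow> conv_mat (A - B)"
  and conv_mat_uminus [conv_intros]: "conv_mat A \<Longrightarrow> conv_mat (- A)"
  and conv_mat_scale [conv_intros]: "conv_fps c \<Longrightarrow> conv_mat A \<Longrightarrow> conv_mat (c *k A)"
  and conv_mat_transpose [conv_intros]: "conv_mat A \<Longrightarrow> conv_mat (transpose A)"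
  by (auto simp: conv_mat_def transpose_def intro!: conv_intros)

lemma conv_mat_mat [conv_intros]: "conv_fps c \<Longrightarrow> conv_mat (mat c)"
  by (auto simp: conv_mat_def mat_def intro!: conv_intros)

lemma conv_mat_mult [conv_intros]:
  fixes A :: "complex fps ^ 'n ^ 'm" and B :: "complex fps ^ 'k ^ 'n"
  shows "conv_mat A \<Longrightarrow> conv_mat B \<Longrightarrow> conv_mat (A ** B)"
  by (auto simp: conv_mat_def matrix_mult_nth intro!: conv_intros)

lemma conv_mat_adj [conv_intros]: "conv_mat A \<Longrightarrow> conv_mat (adj_matrix A)"
  unfolding conv_mat_def adj_matrix_def
  by (auto intro!: conv_intros simp: conv_mat_def axis_def)

section \<open>Differentiation and inversion of power series matrices\<close>

definition mderiv :: "complex fps ^ 'n ^ 'm \<Rightarrow> complex fps ^ 'n ^ 'm" where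
  "mderiv M = (\<chi> a b. fps_deriv (M $ a $ b))"

lemma mderiv_nth [simp]: "mderiv M $ a $ b = fps_deriv (M $ a $ b)"
  by (simp add: mderiv_def)

lemma mderiv_add: "mderiv (A + B) = mderiv A + mderiv B"
  and mderiv_transpose: "mderiv (transpose A) = transpose (mderiv A)"
  by (simp_all add: vec_eq_iff transpose_def)

lemma mderiv_scale: "mderiv (c *k A) = fps_deriv c *k A + c *k mderiv A"
  by (simp add: vec_eq_iff)

lemma mderiv_mult:
  fixes A :: "complex fps ^ 'n ^ 'm" and B :: "complex fps ^ 'k ^ 'n"
  shows "mderiv (A ** B) = mderiv A ** B + A ** mderiv B"
  by (simp add: vec_eq_iff matrix_mult_nth fps_deriv_sum sum.distrib)

lemma mderiv_mat_const [simp]: "mderiv (mat (fps_const c)) = 0" "mderiv (mat 1) = 0"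
  by (simp_all add: vec_eq_iff mat_def)

lemma conv_mat_mderiv [conv_intros]: "conv_mat A \<Longrightarrow> conv_mat (mderiv A)"
  by (auto simp: conv_mat_def intro!: conv_intros)

lemma conv_fps_X_power_mult_iff: "conv_fps (fps_X ^ n * f) \<longleftrightarrow> conv_fps f"
proof
  assume "conv_fps (fps_X ^ n * f)"
  then have "conv_fps (fps_shift n (fps_X ^ n * f))"
    by (rule conv_fps_shift)
  then show "conv_fps f" by (simp add: mult.commute[of _ f])
qed (intro conv_intros)

lemma conv_mat_X_power_scale_iff: "conv_mat (fps_X ^ n *k A) \<longleftrightarrow> conv_mat A"
  by (simp add: conv_mat_def conv_fps_X_power_mult_iff)

text \<open>The determinant is a power of \<open>fps_X\<close> times a unit. Dividing the adjugate
  by the unit leaves only the power, so one stays within power series.\<close>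

lemma quasi_inverse:
  fixes P :: "complex fps ^ 'n ^ 'n"
  assumes "det P \<noteq> 0"
  obtains Q where "P ** Q = fps_X ^ subdegree (det P) *k mat 1"
    "Q ** P = fps_X ^ subdegree (det P) *k mat 1" "conv_mat P \<Longrightarrow> conv_mat Q"
proof
  define u where "u = unit_factor (det P)"
  have u: "det P = fps_X ^ subdegree (det P) * u"
    unfolding u_def using subdegree_decompose[of "det P"]
    by (simp add: mult.commute)
  have u0: "fps_nth u 0 \<noteq> 0"
    using assms by (simp add: u_def)
  then have uu: "inverse u * u = 1" "u * inverse u = 1"
    by (simp_all add: inverse_mult_eq_1 inverse_mult_eq_1')
  have uX: "inverse u * det P = fps_X ^ subdegree (det P)"
    by (metis (no_types, lifting) mult.commute mult.right_neutral mult.assoc u uu(1))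
  let ?Q = "inverse u *k adj_matrix P"
  show "P ** ?Q = fps_X ^ subdegree (det P) *k mat 1"
    by (simp add: matrix_mult_scalar_right matrix_mult_adj_matrix scalar_scalar_matrix uX)
  show "?Q ** P = fps_X ^ subdegree (det P) *k mat 1"
    by (simp add: matrix_mult_scalar_left adj_matrix_mult[OF assms] scalar_scalar_matrix uX)
  assume P: "conv_mat P"
  then have "conv_fps u"
    using conv_fps_det[OF P] by (subst (asm) u) (simp only: conv_fps_X_power_mult_iff)
  with P u0 show "conv_mat ?Q"
    by (intro conv_intros)
qed

lemma dvd_prod_diff:
  fixes f g :: "'i \<Rightarrow> 'a::comm_ring_1"
  assumes "\<And>i. i \<in> A \<Longrightarrow> d dvd f i - g i"
  shows "d dvd prod f A - prod g A"
  using assms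
proof (induction A rule: infinite_finite_induct)
  case (insert x A)
  have "prod f (insert x A) - prod g (insert x A) =
      (f x - g x) * prod f A + g x * (prod f A - prod g A)"
    using insert.hyps by (simp add: algebra_simps)
  then show ?case using insert by simp
qed auto

text \<open>The determinant is polynomial in the entries and so respects congruences. With
  \<open>d\<close> a power of \<open>fps_X\<close>, truncating the entries keeps the low
  coefficients of the determinant.\<close>

lemma dvd_det_diff:
  fixes A B :: "'a::comm_ring_1 ^ 'n ^ 'n"
  assumes "\<And>i j. d dvd A $ i $ j - B $ i $ j"
  shows "d dvd det A - det B"
  unfolding det_def sum_subtractf[symmetric] right_diff_distrib[symmetric]
  by (intro dvd_sum dvd_mult dvd_prod_diff assms)

section \<open>Formal gauge transformations of Fuchsian systems\<close>

text \<open>Convergence is handled through geometric growth of the coefficients, the form in which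
  the recursions deliver it. At radius \<open>1 / (2 * R)\<close> the terms are dominated by powers
  of one half.\<close>

lemma conv_fps_iff_bound: "conv_fps f \<longleftrightarrow> (\<exists>C R. R > 0 \<and> (\<forall>k. norm (fps_nth f k) \<le> C * R ^ k))"
proof
  assume "conv_fps f"
  then have "0 < conv_radius (fps_nth f)"
    by (simp add: conv_fps_def fps_conv_radius_def)
  from ereal_dense2[OF this] obtain r where r: "r > 0" "ereal r < conv_radius (fps_nth f)"
    by auto
  then have "summable (\<lambda>k. norm (fps_nth f k * of_real r ^ k))"
    by (intro abs_summable_in_conv_radius) auto
  then have "bounded (range (\<lambda>k. norm (fps_nth f k * of_real r ^ k)))"
    using convergent_imp_bounded summable_LIMSEQ_zero by blast
  then obtain C where C: "norm (fps_nth f k * of_real r ^ k) \<le> C" for k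
    unfolding bounded_iff by auto
  have "norm (fps_nth f k) \<le> C * (inverse r) ^ k" for k
    using C[of k] r(1) by (simp add: norm_mult norm_power field_simps)
  then show "\<exists>C R. R > 0 \<and> (\<forall>k. norm (fps_nth f k) \<le> C * R ^ k)"
    using r(1) by (intro exI[of _ C] exI[of _ "inverse r"]) auto
next
  assume "\<exists>C R. R > 0 \<and> (\<forall>k. norm (fps_nth f k) \<le> C * R ^ k)"
  then obtain C R where R: "R > 0" "\<And>k. norm (fps_nth f k) \<le> C * R ^ k" by auto
  define r where "r = inverse (2 * R)"
  have r: "r > 0" "R * r = 1 / 2" using R(1) by (simp_all add: r_def)
  have "summable (\<lambda>k. fps_nth f k * of_real r ^ k)"
  proof (rule summable_comparison_test)
    show "summable (\<lambda>k. C * (1/2) ^ k :: real)"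
      by (intro summable_mult summable_geometric) auto
    have "norm (fps_nth f k * of_real r ^ k) \<le> C * (1/2) ^ k" for k
    proof -
      have "norm (fps_nth f k * of_real r ^ k) \<le> (C * R ^ k) * r ^ k"
        using R(2)[of k] r(1) by (simp add: norm_mult norm_power mult_right_mono)
      also have "\<dots> = C * (1/2) ^ k"
        by (simp only: mult.assoc power_mult_distrib[symmetric] r(2))
      finally show ?thesis .
    qed
    then show "\<exists>N. \<forall>n\<ge>N. norm (fps_nth f n * of_real r ^ n) \<le> C * (1/2) ^ n" by auto
  qed
  then have "ereal r \<le> conv_radius (fps_nth f)"
    using conv_radius_geI[of "fps_nth f" "of_real r"] r(1) by simp
  moreover have "0 < ereal r" using r(1) by simp
  ultimately show "conv_fps f"
    unfolding conv_fps_def fps_conv_radius_def by (rule less_le_trans[rotated])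
qed

lemma conv_fps_uniform_bound:
  fixes f :: "'i \<Rightarrow> complex fps"
  assumes "finite A" "\<And>x. x \<in> A \<Longrightarrow> conv_fps (f x)"
  obtains C R where "C > 0" "R > 0" "\<And>x k. x \<in> A \<Longrightarrow> norm (fps_nth (f x) k) \<le> C * R ^ k"
proof -
  have "\<forall>x\<in>A. \<exists>C R. R > 0 \<and> (\<forall>k. norm (fps_nth (f x) k) \<le> C * R ^ k)"
    using assms(2) conv_fps_iff_bound by blast
  then obtain C R where CR: "\<And>x. x \<in> A \<Longrightarrow> R x > 0"
      "\<And>x k. x \<in> A \<Longrightarrow> norm (fps_nth (f x) k) \<le> C x * R x ^ k"
    by metis
  \<comment> \<open>Sums dominate all individual constants; the summand 1 keeps them positive even
    for an empty family.\<close>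
  define C' R' where "C' = 1 + (\<Sum>x\<in>A. \<bar>C x\<bar>)" and "R' = 1 + (\<Sum>x\<in>A. R x)"
  show thesis
  proof
    show "C' > 0" unfolding C'_def by (intro add_pos_nonneg sum_nonneg) auto
    show "R' > 0" unfolding R'_def using CR(1) by (intro add_pos_nonneg sum_nonneg) (auto intro: less_imp_le)
    fix x k assume x: "x \<in> A"
    have C: "C x \<le> C'" "0 \<le> C'"
      using member_le_sum[OF x _ assms(1), of "\<lambda>x. \<bar>C x\<bar>"] \<open>C' > 0\<close> unfolding C'_def by auto
    have R: "R x \<le> R'"
      using member_le_sum[OF x _ assms(1), of R] CR(1) unfolding R'_def by (auto simp: less_imp_le)
    have "C x * R x ^ k \<le> C' * R' ^ k"
      using C R CR(1)[OF x] by (intro mult_mono power_mono) auto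
    with CR(2)[OF x, of k] show "norm (fps_nth (f x) k) \<le> C' * R' ^ k" by linarith
  qed
qed

lemma conv_fps_cutoff: "conv_fps (fps_cutoff n f)"
proof (induction n)
  case (Suc n)
  have "fps_cutoff (Suc n) f = fps_cutoff n f + fps_const (fps_nth f n) * fps_X ^ n"
    by (rule fps_ext) (auto simp: fps_X_power_nth less_Suc_eq)
  with Suc show ?case by (auto intro: conv_intros)
qed (auto intro: conv_intros)

lemma geometric_sum_le:
  fixes q :: real
  assumes "0 \<le> q" "q \<le> 1 / 2"
  shows "(\<Sum>j\<le>k. q ^ j) \<le> 2"
proof -
  have "(\<Sum>j\<le>k. q ^ j) \<le> (\<Sum>j. q ^ j)"
    using assms by (intro sum_le_suminf summable_geometric) auto
  also have "\<dots> = 1 / (1 - q)"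
    using assms by (intro suminf_geometric) auto
  also have "\<dots> \<le> 2" using assms by (simp add: field_simps)
  finally show ?thesis .
qed

text \<open>For \<open>k \<ge> 2 * K\<close> the term \<open>j = 0\<close> on the right,
  \<open>K * u k\<close>, is absorbed by at most half of the left side. The rate
  \<open>2 * r\<close> makes the remaining convolution a geometric sum of ratio one half, and the
  finitely many smaller indices are paid for by \<open>C\<close>.\<close>

lemma fuchsian_majorant:
  fixes u :: "nat \<Rightarrow> real"
  assumes u: "\<And>k. u k \<ge> 0" and K: "K \<ge> 0" and r: "r > 0"
    and rec: "\<And>k. real k * u k \<le> (\<Sum>j\<le>k. K * r ^ j * u (k - j))"
  shows "\<exists>C. \<forall>k. u k \<le> C * (2 * r) ^ k"
proof -
  \<comment> \<open>From \<open>n\<close> on, \<open>real k - K\<close> is at least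
    \<open>K\<close>; the \<open>+ 1\<close> ensures \<open>k \<ge> 1\<close>, so that
    \<open>real k - K\<close> is positive also for \<open>K = 0\<close>.\<close>
  define n where "n = nat \<lceil>2 * K\<rceil> + 1"
  define C where "C = (\<Sum>k<n. u k / (2 * r) ^ k)"
  have C: "C \<ge> 0" unfolding C_def using u r by (intro sum_nonneg) auto
  have "u k \<le> C * (2 * r) ^ k" for k
  proof (induction k rule: less_induct)
    case (less k)
    show ?case
    proof (cases "k < n")
      case True
      have "u k / (2 * r) ^ k \<le> C"
        unfolding C_def using True u r by (intro member_le_sum) auto
      then show ?thesis using r by (simp add: field_simps)
    next
      case False
      then have k: "real k \<ge> 2 * K" "k \<ge> 1"
        unfolding n_def by (simp_all add: of_nat_ceiling) linarith+
      have eq: "{..k} = insert 0 {1..k}" by auto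
      have "(\<Sum>j\<le>k. K * r ^ j * u (k - j)) = K * u k + (\<Sum>j\<in>{1..k}. K * r ^ j * u (k - j))"
        unfolding eq by (subst sum.insert) auto
      also have "(\<Sum>j\<in>{1..k}. K * r ^ j * u (k - j)) \<le> (\<Sum>j\<in>{1..k}. K * r ^ j * (C * (2 * r) ^ (k - j)))"
        using K r k less.IH by (intro sum_mono mult_left_mono) auto
      also have "\<dots> = (\<Sum>j\<in>{1..k}. K * C * (2 * r) ^ k * (1 / 2) ^ j)"
      proof (rule sum.cong)
        fix j assume "j \<in> {1..k}"
        then have "(2 * r) ^ k = (2 * r) ^ j * (2 * r) ^ (k - j)"
          by (metis atLeastAtMost_iff le_add_diff_inverse power_add)
        then show "K * r ^ j * (C * (2 * r) ^ (k - j)) = K * C * (2 * r) ^ k * (1 / 2) ^ j"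
          by (simp add: power_mult_distrib power_one_over)
      qed simp
      also have "\<dots> = K * C * (2 * r) ^ k * (\<Sum>j\<in>{1..k}. (1 / 2) ^ j)"
        by (simp add: sum_distrib_left)
      also have "(\<Sum>j\<in>{1..k}. (1 / 2 :: real) ^ j) \<le> 1"
      proof -
        have "(\<Sum>j\<le>k. (1 / 2 :: real) ^ j) = 1 + (\<Sum>j\<in>{1..k}. (1 / 2) ^ j)"
          unfolding eq by (subst sum.insert) auto
        with geometric_sum_le[of "1/2" k] show ?thesis by simp
      qed
      finally have "real k * u k \<le> K * u k + K * C * (2 * r) ^ k"
        using rec[of k] K C r by (auto simp: mult_left_mono intro: order_trans)
      then have "(real k - K) * u k \<le> K * C * (2 * r) ^ k" by (simp add: algebra_simps)
      also have "\<dots> \<le> (real k - K) * (C * (2 * r) ^ k)"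
        using mult_right_mono[OF k(1), of "C * (2 * r) ^ k"] C r by (simp add: algebra_simps)
      finally show ?thesis
        using k K by (cases "K = 0") (auto simp: mult_le_cancel_left_pos)
    qed
  qed
  then show ?thesis by blast
qed

text \<open>The operator \<open>fps_X * fps_deriv\<close> multiplies the \<open>k\<close>-th
  coefficient by \<open>k\<close>. Summing norms over all components gives the scalar recursion of
  the majorant, with the number of components as extra factor.\<close>

lemma fuchsian_system_conv:
  fixes Z :: "'i::finite \<Rightarrow> complex fps"
  assumes M: "\<And>i j. conv_fps (M i j)"
    and eq: "\<And>i. fps_X * fps_deriv (Z i) = (\<Sum>j\<in>UNIV. M i j * Z j)"
  shows "conv_fps (Z i)"
proof -
  obtain K r where K: "K > 0" "r > 0" "\<And>i j k. norm (fps_nth (M i j) k) \<le> K * r ^ k"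
    using conv_fps_uniform_bound[of UNIV "\<lambda>(i, j). M i j"] M by auto
  define u where "u k = (\<Sum>i\<in>UNIV. norm (fps_nth (Z i) k))" for k
  define n where "n = real (card (UNIV :: 'i set))"
  have le: "real k * norm (fps_nth (Z i) k) \<le> (\<Sum>l\<le>k. K * r ^ l * u (k - l))" for i k
  proof -
    have "of_nat k * fps_nth (Z i) k = fps_nth (fps_X * fps_deriv (Z i)) k"
      by (cases k) auto
    also have "\<dots> = (\<Sum>j\<in>UNIV. \<Sum>l\<le>k. fps_nth (M i j) l * fps_nth (Z j) (k - l))"
      by (simp add: eq fps_sum_nth fps_mult_nth atLeast0AtMost)
    finally have "real k * norm (fps_nth (Z i) k) =
        norm (\<Sum>j\<in>UNIV. \<Sum>l\<le>k. fps_nth (M i j) l * fps_nth (Z j) (k - l))"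
      by (metis norm_mult norm_of_nat)
    also have "\<dots> \<le> (\<Sum>j\<in>UNIV. \<Sum>l\<le>k. K * r ^ l * norm (fps_nth (Z j) (k - l)))"
      by (intro sum_norm_le) (auto simp: norm_mult intro!: mult_right_mono K)
    also have "\<dots> = (\<Sum>l\<le>k. K * r ^ l * u (k - l))"
      unfolding u_def sum_distrib_left by (rule sum.swap)
    finally show ?thesis .
  qed
  have "real k * u k \<le> (\<Sum>l\<le>k. (n * K) * r ^ l * u (k - l))" for k
  proof -
    have "real k * u k = (\<Sum>i\<in>UNIV. real k * norm (fps_nth (Z i) k))"
      by (simp add: u_def sum_distrib_left)
    also have "\<dots> \<le> (\<Sum>i\<in>(UNIV :: 'i set). \<Sum>l\<le>k. K * r ^ l * u (k - l))"
      by (intro sum_mono le)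
    also have "\<dots> = (\<Sum>l\<le>k. (n * K) * r ^ l * u (k - l))"
      by (simp add: n_def sum_distrib_left mult_ac)
    finally show ?thesis .
  qed
  moreover have "u k \<ge> 0" for k unfolding u_def by (intro sum_nonneg) auto
  moreover have "n * K \<ge> 0" using K by (simp add: n_def)
  ultimately obtain C where C: "\<And>k. u k \<le> C * (2 * r) ^ k"
    using fuchsian_majorant[of u "n * K" r] K by auto
  have "norm (fps_nth (Z i) k) \<le> C * (2 * r) ^ k" for k
  proof -
    have "norm (fps_nth (Z i) k) \<le> u k"
      unfolding u_def by (rule member_le_sum) auto
    with C[of k] show ?thesis by linarith
  qed
  with K(2) show ?thesis
    unfolding conv_fps_iff_bound by (intro exI[of _ C] exI[of _ "2 * r"]) auto
qed

text \<open>The map \<open>Z \<mapsto> Z ** Y - X ** Z\<close> as a single matrix acting on the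
  vector of entries of \<open>Z\<close>, indexed by pairs. It makes results on vector systems
  available for gauge equations.\<close>

lemma commutator_sum:
  fixes X :: "'m::finite \<Rightarrow> 'm \<Rightarrow> 'a::comm_ring_1" and Y :: "'n::finite \<Rightarrow> 'n \<Rightarrow> 'a"
  shows "(\<Sum>p\<in>UNIV. ((if fst p = a then Y (snd p) b else 0) - (if snd p = b then X a (fst p) else 0)) * Z (fst p) (snd p)) =
    (\<Sum>d\<in>UNIV. Y d b * Z a d) - (\<Sum>c\<in>UNIV. X a c * Z c b)"
proof -
  have pairs: "(\<Sum>p\<in>UNIV. g (fst p) (snd p)) = (\<Sum>c\<in>UNIV. \<Sum>d\<in>UNIV. g c d)" for g :: "'m \<Rightarrow> 'n \<Rightarrow> 'a"
    by (simp add: sum.cartesian_product case_prod_unfold)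
  have "(\<Sum>p\<in>UNIV. ((if fst p = a then Y (snd p) b else 0) - (if snd p = b then X a (fst p) else 0)) * Z (fst p) (snd p)) =
      (\<Sum>c\<in>UNIV. \<Sum>d\<in>UNIV. (if c = a then Y d b else 0) * Z c d) -
      (\<Sum>c\<in>UNIV. \<Sum>d\<in>UNIV. (if d = b then X a c else 0) * Z c d)"
    unfolding pairs[of "\<lambda>c d. ((if c = a then Y d b else 0) - (if d = b then X a c else 0)) * Z c d"]
    by (simp add: left_diff_distrib sum_subtractf)
  also have "(\<Sum>c\<in>UNIV. \<Sum>d\<in>UNIV. (if c = a then Y d b else 0) * Z c d) =
      (\<Sum>c\<in>UNIV. if c = a then \<Sum>d\<in>UNIV. Y d b * Z c d else 0)"
    by (intro sum.cong) auto
  also have "(\<Sum>c\<in>UNIV. \<Sum>d\<in>UNIV. (if d = b then X a c else 0) * Z c d) =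
      (\<Sum>c\<in>UNIV. \<Sum>d\<in>UNIV. if d = b then X a c * Z c d else 0)"
    by (intro sum.cong) auto
  finally show ?thesis by simp
qed

lemma fuchsian_gauge_conv:
  fixes Z :: "complex fps ^ 'n ^ 'm"
  assumes "conv_mat C" "conv_mat C'"
    and eq: "fps_X *k mderiv Z + C ** Z = Z ** C'"
  shows "conv_mat Z"
proof -
  have "conv_fps (Z $ fst p $ snd p)" for p
  proof (rule fuchsian_system_conv[where M = "\<lambda>p q. (if fst q = fst p then C' $ snd q $ snd p else 0) -
      (if snd q = snd p then C $ fst p $ fst q else 0)"])
    show "conv_fps ((if fst q = fst p then C' $ snd q $ snd p else 0) - (if snd q = snd p then C $ fst p $ fst q else 0))"
      for p q
      using assms(1,2) by (auto simp: conv_mat_def intro!: conv_intros)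
    fix p :: "'m \<times> 'n"
    have "fps_X * fps_deriv (Z $ fst p $ snd p) = (Z ** C') $ fst p $ snd p - (C ** Z) $ fst p $ snd p"
      using arg_cong[OF eq, of "\<lambda>M. M $ fst p $ snd p"] by (simp add: algebra_simps)
    also have "\<dots> = (\<Sum>d\<in>UNIV. C' $ d $ snd p * Z $ fst p $ d) - (\<Sum>c\<in>UNIV. C $ fst p $ c * Z $ c $ snd p)"
      by (simp add: matrix_mult_nth mult.commute)
    finally show "fps_X * fps_deriv (Z $ fst p $ snd p) = (\<Sum>q\<in>UNIV.
        ((if fst q = fst p then C' $ snd q $ snd p else 0) - (if snd q = snd p then C $ fst p $ fst q else 0)) *
        Z $ fst q $ snd q)"
      unfolding commutator_sum[of "fst p" "\<lambda>d e. C' $ d $ e" "snd p" "\<lambda>a c. C $ a $ c" "\<lambda>c d. Z $ c $ d"] .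
  qed
  from this[of "(a, b)" for a b] show ?thesis by (simp add: conv_mat_def)
qed

text \<open>Regular singularity in terms of power series: the equation is multiplied by
  \<open>z\<^sup>2\<close>, \<open>P\<close> is the meromorphic gauge with its poles cleared, and
  the nonzero determinant expresses invertibility for small \<open>z \<noteq> 0\<close>.\<close>

definition fuchsian_equivalent :: "complex fps ^ 'n ^ 'n \<Rightarrow> bool" where
  "fuchsian_equivalent B \<longleftrightarrow> (\<exists>P C. conv_mat P \<and> conv_mat C \<and> det P \<noteq> 0 \<and>
     B ** P + fps_X\<^sup>2 *k mderiv P = fps_X *k (P ** C))"

lemma det_scalar_mat_nonzero:
  fixes c :: "'a::idom"
  assumes "c \<noteq> 0"
  shows "det (c *k mat 1 :: 'a ^ 'n ^ 'n) \<noteq> 0"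
proof -
  have "c *k mat 1 = (mat c :: 'a ^ 'n ^ 'n)" by (simp add: vec_eq_iff mat_def)
  moreover have "det (mat c :: 'a ^ 'n ^ 'n) = (\<Prod>i\<in>(UNIV :: 'n set). c)"
    by (subst det_diagonal) (auto simp: mat_def)
  ultimately show ?thesis using assms by simp
qed

lemma fps_X_deriv_X_power: "fps_X * fps_deriv (fps_X ^ d) = (of_nat d * fps_X ^ d :: complex fps)"
  by (induction d) (simp_all add: algebra_simps)

text \<open>Here \<open>Q\<close> is \<open>z\<^sup>d\<close> times the inverse of \<open>P\<close>.
  The inverse satisfies the reversed intertwining relation with \<open>C\<close> itself; the scalar
  gauge \<open>z\<^sup>d\<close> shifts \<open>C\<close> by \<open>d\<close>, whence
  \<open>?C\<close>.\<close>

lemma fuchsian_equivalentE: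
  fixes B :: "complex fps ^ 'n ^ 'n"
  assumes "fuchsian_equivalent B"
  obtains P Q C d where "conv_mat P" "conv_mat Q" "conv_mat C" "det Q \<noteq> 0"
    "P ** Q = fps_X ^ d *k mat 1" "Q ** P = fps_X ^ d *k mat 1"
    "Q ** B = fps_X *k (C ** Q) + fps_X\<^sup>2 *k mderiv Q"
proof -
  obtain P C where P: "conv_mat P" "conv_mat C" "det P \<noteq> 0"
    "B ** P + fps_X\<^sup>2 *k mderiv P = fps_X *k (P ** C)"
    using assms unfolding fuchsian_equivalent_def by blast
  define d where "d = subdegree (det P)"
  obtain Q where Q: "P ** Q = fps_X ^ d *k mat 1" "Q ** P = fps_X ^ d *k mat 1" "conv_mat Q"
    using quasi_inverse[OF P(3)] P(1) unfolding d_def by metis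
  let ?C = "C - of_nat d *k mat 1"
  have dQ: "det Q \<noteq> 0"
  proof
    assume "det Q = 0"
    then have "det (P ** Q) = 0" by (simp add: det_mul)
    then show False unfolding Q(1) by (simp add: det_scalar_mat_nonzero)
  qed
  have "fps_X *k mderiv (P ** Q) = (of_nat d * fps_X ^ d) *k mat 1"
    unfolding Q(1) mderiv_scale by (simp add: matrix_algebra fps_X_deriv_X_power)
  then have PQ': "fps_X *k (mderiv P ** Q) = (of_nat d * fps_X ^ d) *k mat 1 - fps_X *k (P ** mderiv Q)"
    by (simp add: mderiv_mult matrix_algebra algebra_simps)
  have "fps_X ^ d *k (Q ** B) = (Q ** B) ** (P ** Q)"
    by (simp add: Q(1) matrix_algebra)
  also have "\<dots> = Q ** (B ** P) ** Q"
    by (simp add: matrix_mul_assoc)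
  also have "B ** P = fps_X *k (P ** C) - fps_X\<^sup>2 *k mderiv P"
    using P(4) by (simp add: algebra_simps)
  also have "Q ** (fps_X *k (P ** C) - fps_X\<^sup>2 *k mderiv P) ** Q =
      fps_X *k ((Q ** P) ** (C ** Q)) - fps_X *k (Q ** (fps_X *k (mderiv P ** Q)))"
    by (simp add: matrix_algebra power2_eq_square matrix_mul_assoc)
  also have "\<dots> = fps_X ^ d *k (fps_X *k (C ** Q)) - fps_X *k ((of_nat d * fps_X ^ d) *k Q - fps_X *k ((Q ** P) ** mderiv Q))"
    unfolding PQ' by (simp add: Q(2) matrix_algebra matrix_mul_assoc mult_ac)
  also have "\<dots> = fps_X ^ d *k (fps_X *k (?C ** Q) + fps_X\<^sup>2 *k mderiv Q)"
    by (simp add: Q(2) matrix_algebra power2_eq_square mult_ac algebra_simps)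
  finally have "Q ** B = fps_X *k (?C ** Q) + fps_X\<^sup>2 *k mderiv Q"
    by (rule scalar_matrix_cancel) simp
  moreover have "conv_mat ?C"
    using P(2) by (intro conv_intros)
  ultimately show thesis using that P(1) Q dQ by blast
qed

text \<open>
  Truncating \<open>Y\<close> beyond the order of its determinant gives a
  convergent gauge transformation \<open>Y'\<close> after which \<open>B\<close> has a simple pole as well, so that
  \<open>Z = Y Y'\<^sup>-\<^sup>1\<close> is a formal gauge transformation between two systems with simple poles.
\<close>

lemma formal_fuchsian_gauge_conv:
  fixes B Y :: "complex fps ^ 'n ^ 'n"
  assumes B: "conv_mat B" and C: "conv_mat C" and dY: "det Y \<noteq> 0"
    and eq: "fps_X\<^sup>2 *k mderiv Y + fps_X *k (C ** Y) = Y ** B"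
  shows "conv_mat Y"
proof -
  define N where "N = subdegree (det Y)"
  \<comment> \<open>Cutting at \<open>Suc N\<close> rather than \<open>N\<close> keeps the
    coefficient of order \<open>N\<close> of the determinant, and leaves one spare factor
    \<open>fps_X\<close> after dividing the remainder by \<open>fps_X ^ N\<close>.\<close>
  define Y' where "Y' = (\<chi> a b. fps_cutoff (Suc N) (Y $ a $ b))"
  define E where "E = (\<chi> a b. fps_shift (Suc N) (Y $ a $ b))"
  have Y: "Y = Y' + fps_X ^ Suc N *k E"
    unfolding Y'_def E_def
    by (simp add: vec_eq_iff fps_eq_iff fps_X_power_mult_nth del: power_Suc)
  have Y': "conv_mat Y'" by (simp add: conv_mat_def Y'_def conv_fps_cutoff)
  have nth: "fps_nth (det Y) k = fps_nth (det Y') k" if "k \<le> N" for k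
  proof -
    have "fps_X ^ Suc N dvd det Y - det Y'"
      by (rule dvd_det_diff) (simp add: Y del: power_Suc)
    then obtain g where "det Y - det Y' = fps_X ^ Suc N * g" by (auto simp: dvd_def)
    then have "fps_nth (det Y - det Y') k = 0"
      using that by (simp only: fps_X_power_mult_nth) simp
    then show ?thesis by simp
  qed
  have N: "fps_nth (det Y') N \<noteq> 0"
    using nth_subdegree_nonzero[OF dY, folded N_def] nth[OF order_refl] by simp
  moreover have "fps_nth (det Y') k = 0" if "k < N" for k
    using nth[of k] nth_less_subdegree_zero[of k "det Y", folded N_def] that by simp
  ultimately have sub: "subdegree (det Y') = N" by (intro subdegreeI) auto
  have dY': "det Y' \<noteq> 0" using N by auto
  obtain K where K: "Y' ** K = fps_X ^ N *k mat 1" "K ** Y' = fps_X ^ N *k mat 1" "conv_mat K"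
    using quasi_inverse[OF dY'] Y' unfolding sub by metis
  define x where "x = (fps_X ^ Suc N :: complex fps)"
  \<comment> \<open>\<open>x *k F\<close> is the defect of \<open>Y'\<close> in the equation
    satisfied by \<open>Y\<close>; differentiating \<open>x\<close> produces the term with
    \<open>Suc N\<close>.\<close>
  define F where "F = E ** B - ((of_nat (Suc N) * fps_X) *k E + fps_X\<^sup>2 *k mderiv E + fps_X *k (C ** E))"
  have x: "fps_X\<^sup>2 * fps_deriv x = x * (of_nat (Suc N) * fps_X)"
  proof -
    have "fps_X\<^sup>2 * fps_deriv x = fps_X * (fps_X * fps_deriv x)"
      by (simp only: power2_eq_square mult.assoc)
    then show ?thesis unfolding x_def by (simp only: fps_X_deriv_X_power mult_ac)
  qed
  have Yx: "Y = Y' + x *k E" using Y unfolding x_def .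
  have "fps_X\<^sup>2 *k mderiv Y' + fps_X *k (C ** Y') - Y' ** B +
      (fps_X\<^sup>2 *k mderiv (x *k E) + fps_X *k (C ** (x *k E)) - (x *k E) ** B) = 0"
    using eq unfolding Yx
    by (simp only: mderiv_add matrix_mult_add_right matrix_mult_add_left scalar_matrix_add_right) (simp add: algebra_simps)
  moreover have "fps_X\<^sup>2 *k mderiv (x *k E) + fps_X *k (C ** (x *k E)) - (x *k E) ** B = - (x *k F)"
    unfolding mderiv_scale scalar_matrix_add_right scalar_scalar_matrix x F_def
    by (simp add: matrix_algebra mult.commute[of _ x] mult.assoc del: of_nat_Suc)
  ultimately have F: "fps_X\<^sup>2 *k mderiv Y' + fps_X *k (C ** Y') - Y' ** B = x *k F"
    by simp
  \<comment> \<open>\<open>F\<close> is built from the merely formal \<open>E\<close>, but its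
    multiple \<open>x *k F\<close> equals an expression in \<open>Y'\<close>, \<open>B\<close> and
    \<open>C\<close> only.\<close>
  have "conv_mat (x *k F)"
    unfolding F[symmetric] using B C Y' by (intro conv_intros)
  then have cF: "conv_mat F" by (simp only: x_def conv_mat_X_power_scale_iff)
  \<comment> \<open>As \<open>K\<close> inverts \<open>Y'\<close> up to \<open>fps_X ^ N\<close>,
    the defect equals \<open>fps_X *k ((F ** K) ** Y')\<close>. It has the shape of the simple pole
    term and can be absorbed into it.\<close>
  define C' where "C' = C - F ** K"
  have cC': "conv_mat C'" unfolding C'_def using C cF K(3) by (intro conv_intros)
  have "(F ** K) ** Y' = fps_X ^ N *k F"
    by (simp add: K(2) matrix_algebra flip: matrix_mul_assoc)
  then have Y'B: "Y' ** B = fps_X\<^sup>2 *k mderiv Y' + fps_X *k (C' ** Y')"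
    using F by (simp add: C'_def x_def matrix_algebra algebra_simps)
  \<comment> \<open>The quotient of \<open>Y\<close> by \<open>Y'\<close>, written without a
    negative power: \<open>fps_X ^ Suc N\<close> from the remainder meets \<open>fps_X ^ N\<close>
    from \<open>K\<close>.\<close>
  define Z where "Z = mat 1 + fps_X *k (E ** K)"
  have "(E ** K) ** Y' = fps_X ^ N *k E"
    by (simp add: K(2) matrix_algebra flip: matrix_mul_assoc)
  then have ZY': "Z ** Y' = Y"
    unfolding Z_def Y by (simp add: matrix_algebra)
  have "fps_X\<^sup>2 *k (mderiv Z ** Y') + fps_X\<^sup>2 *k (Z ** mderiv Y') + fps_X *k (C ** (Z ** Y')) = Z ** (Y' ** B)"
    using eq unfolding ZY'[symmetric] mderiv_mult by (simp add: matrix_algebra matrix_mul_assoc)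
  also have "\<dots> = fps_X\<^sup>2 *k (Z ** mderiv Y') + fps_X *k (Z ** (C' ** Y'))"
    unfolding Y'B by (simp add: matrix_algebra)
  finally have "fps_X\<^sup>2 *k (mderiv Z ** Y') + fps_X *k (C ** (Z ** Y')) = fps_X *k (Z ** (C' ** Y'))"
    by (simp add: algebra_simps)
  then have "fps_X *k ((fps_X *k mderiv Z + C ** Z) ** Y') = fps_X *k ((Z ** C') ** Y')"
    by (simp add: matrix_algebra power2_eq_square matrix_mul_assoc)
  then have "(fps_X *k mderiv Z + C ** Z) ** Y' = (Z ** C') ** Y'"
    by (rule scalar_matrix_cancel) simp
  then have "((fps_X *k mderiv Z + C ** Z) ** Y') ** K = ((Z ** C') ** Y') ** K" by simp
  then have "fps_X ^ N *k (fps_X *k mderiv Z + C ** Z) = fps_X ^ N *k (Z ** C')"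
    by (simp add: K(1) matrix_algebra mult.commute flip: matrix_mul_assoc)
  then have "fps_X *k mderiv Z + C ** Z = Z ** C'"
    by (rule scalar_matrix_cancel) simp
  then have "conv_mat Z" by (rule fuchsian_gauge_conv[OF C cC'])
  then show ?thesis unfolding ZY'[symmetric] using Y' by (intro conv_intros)
qed

text \<open>Multiplication by \<open>Q\<close> gives the left system a simple pole, so
  \<open>Q ** U\<close> falls under the truncation argument. \<open>P\<close> undoes
  \<open>Q\<close> up to a power of \<open>fps_X\<close>.\<close>

lemma square_formal_isomorphism_conv:
  fixes B B' U :: "complex fps ^ 'n ^ 'n"
  assumes "fuchsian_equivalent B" "conv_mat B'" "det U \<noteq> 0"
    and eq: "B ** U + fps_X\<^sup>2 *k mderiv U = U ** B'"
  shows "conv_mat U"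
proof -
  obtain P Q C d where P: "conv_mat P" "conv_mat C" "det Q \<noteq> 0" "P ** Q = fps_X ^ d *k mat 1"
    and QB: "Q ** B = fps_X *k (C ** Q) + fps_X\<^sup>2 *k mderiv Q"
    using assms(1) by (rule fuchsian_equivalentE) blast
  have "(Q ** U) ** B' = Q ** (B ** U + fps_X\<^sup>2 *k mderiv U)"
    by (simp only: eq matrix_mul_assoc)
  also have "\<dots> = (Q ** B) ** U + fps_X\<^sup>2 *k (Q ** mderiv U)"
    by (simp add: matrix_algebra matrix_mul_assoc)
  also have "\<dots> = fps_X\<^sup>2 *k mderiv (Q ** U) + fps_X *k (C ** (Q ** U))"
    unfolding QB mderiv_mult by (simp add: matrix_algebra matrix_mul_assoc)
  finally have "fps_X\<^sup>2 *k mderiv (Q ** U) + fps_X *k (C ** (Q ** U)) = (Q ** U) ** B'"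
    by (rule sym)
  moreover have "det (Q ** U) \<noteq> 0" using assms(3) P(3) by (simp add: det_mul)
  ultimately have "conv_mat (Q ** U)"
    using formal_fuchsian_gauge_conv[OF assms(2) P(2)] by blast
  then have "conv_mat (P ** (Q ** U))" by (rule conv_mat_mult[OF P(1)])
  also have "P ** (Q ** U) = fps_X ^ d *k U"
    by (simp add: matrix_mul_assoc P(4) matrix_algebra)
  finally show ?thesis by (simp only: conv_mat_X_power_scale_iff)
qed

section \<open>Dual systems and formal isomorphisms between different index types\<close>

lemma transpose_simps:
  "transpose (A + B) = transpose A + transpose B" "transpose (c *k A) = c *k transpose A"
  by (simp_all add: transpose_def vec_eq_iff)

lemma scalar_matrix_uminus: "c *k (- A) = - (c *k A)"
  for A :: "'a::comm_ring_1 ^ 'n ^ 'm"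
  by (simp add: vec_eq_iff)

lemma matrix_mult_uminus:
  fixes A :: "'a::comm_ring_1 ^ 'n ^ 'm"
  shows "A ** (- B) = - (A ** B)" "(- A) ** B = - (A ** B)"
  by (simp_all add: vec_eq_iff matrix_mult_nth sum_negf)

text \<open>The dual connection has matrix \<open>- transpose B\<close>, and the transposed inverse
  gauge reduces it. Duality reverses the direction of a formal isomorphism without inverting
  it.\<close>

lemma fuchsian_equivalent_dual:
  assumes "fuchsian_equivalent B"
  shows "fuchsian_equivalent (- transpose B)"
proof -
  obtain P Q C d where P: "conv_mat Q" "conv_mat C" "det Q \<noteq> 0"
    and QB: "Q ** B = fps_X *k (C ** Q) + fps_X\<^sup>2 *k mderiv Q"
    using assms by (rule fuchsian_equivalentE) blast
  have "transpose B ** transpose Q = fps_X *k (transpose Q ** transpose C) + fps_X\<^sup>2 *k mderiv (transpose Q)"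
    using arg_cong[OF QB, of transpose]
    by (simp add: matrix_transpose_mul mderiv_transpose transpose_simps)
  then have "- transpose B ** transpose Q + fps_X\<^sup>2 *k mderiv (transpose Q) = fps_X *k (transpose Q ** (- transpose C))"
    by (simp add: matrix_mult_uminus scalar_matrix_uminus)
  then show ?thesis
    unfolding fuchsian_equivalent_def using P
    by (intro exI[of _ "transpose Q"] exI[of _ "- transpose C"]) (auto intro: conv_intros)
qed

definition const_mat :: "complex ^ 'n ^ 'm \<Rightarrow> complex fps ^ 'n ^ 'm" where
  "const_mat M = (\<chi> a b. fps_const (M $ a $ b))"

lemma const_mat_simps [simp]:
  "const_mat (A ** B) = const_mat A ** const_mat B" "const_mat (mat 1) = mat 1"
  "mderiv (const_mat A) = 0" "conv_mat (const_mat A)"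
  by (simp_all add: const_mat_def vec_eq_iff matrix_mult_nth mat_def conv_mat_def conv_fps_const fps_eq_iff fps_sum_nth)

text \<open>Taking the constant term is a ring homomorphism, hence commutes with the
  determinant.\<close>

lemma fps_nth_det_0: "fps_nth (det M) 0 = det (\<chi> a b. fps_nth (M $ a $ b) 0)"
  for M :: "complex fps ^ 'n ^ 'n"
proof -
  have "fps_nth (prod f A) 0 = (\<Prod>i\<in>A. fps_nth (f i) 0)" for f :: "'n \<Rightarrow> complex fps" and A
    by (induction A rule: infinite_finite_induct) simp_all
  moreover have "fps_nth (of_int n :: complex fps) 0 = of_int n" for n
    by (simp flip: fps_of_int)
  ultimately show ?thesis by (simp add: det_def fps_sum_nth)
qed

text \<open>Right multiplication by the inverse \<open>S\<close> of the constant term makes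
  \<open>T\<close> square with constant term the identity. As \<open>S\<close> is constant, no
  derivative term appears and \<open>B'\<close> is merely conjugated.\<close>

lemma formal_isomorphism_conv_left:
  fixes B :: "complex fps ^ 'r ^ 'r" and B' :: "complex fps ^ 's ^ 's" and T :: "complex fps ^ 's ^ 'r"
  assumes "fuchsian_equivalent B" "conv_mat B'" "invertible (\<chi> a b. fps_nth (T $ a $ b) 0)"
    and eq: "B ** T + fps_X\<^sup>2 *k mderiv T = T ** B'"
  shows "conv_mat T"
proof -
  define T0 where "T0 = (\<chi> a b. fps_nth (T $ a $ b) 0)"
  obtain S where S: "T0 ** S = mat 1" "S ** T0 = mat 1"
    using assms(3) unfolding invertible_def T0_def by blast
  have S': "const_mat S ** const_mat T0 = mat 1"
    using arg_cong[OF S(2), of const_mat] by simp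
  let ?U = "T ** const_mat S"
  have "conv_mat ?U"
  proof (rule square_formal_isomorphism_conv[OF assms(1)])
    show "conv_mat (const_mat T0 ** B' ** const_mat S)"
      using assms(2) by (intro conv_intros) simp_all
    have "(\<chi> a b. fps_nth (?U $ a $ b) 0) = T0 ** S"
      by (simp add: vec_eq_iff matrix_mult_nth fps_sum_nth T0_def const_mat_def)
    then have "fps_nth (det ?U) 0 = 1" by (simp only: fps_nth_det_0 S(1) det_I)
    then show "det ?U \<noteq> 0" by auto
    have "B ** ?U + fps_X\<^sup>2 *k mderiv ?U = (B ** T + fps_X\<^sup>2 *k mderiv T) ** const_mat S"
      by (simp add: mderiv_mult matrix_algebra matrix_mul_assoc)
    also have "\<dots> = T ** (const_mat S ** const_mat T0) ** B' ** const_mat S"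
      by (simp add: eq S')
    finally show "B ** ?U + fps_X\<^sup>2 *k mderiv ?U = ?U ** (const_mat T0 ** B' ** const_mat S)"
      by (simp add: matrix_mul_assoc)
  qed
  then have "conv_mat (?U ** const_mat T0)" by (rule conv_mat_mult) simp
  then show ?thesis by (simp add: S' flip: matrix_mul_assoc)
qed

lemma invertible_transpose_iff:
  fixes A :: "complex ^ 'n ^ 'm"
  shows "invertible (transpose A) \<longleftrightarrow> invertible A"
  by (metis invertible_def matrix_transpose_mul transpose_mat transpose_transpose)

proposition formal_isomorphism_conv:
  fixes B :: "complex fps ^ 'r ^ 'r" and B' :: "complex fps ^ 's ^ 's" and T :: "complex fps ^ 's ^ 'r"
  assumes reg: "fuchsian_equivalent B \<or> fuchsian_equivalent B'"
    and B: "conv_mat B" "conv_mat B'" and T: "invertible (\<chi> a b. fps_nth (T $ a $ b) 0)"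
    and eq: "B ** T + fps_X\<^sup>2 *k mderiv T = T ** B'"
  shows "conv_mat T"
  using reg
proof
  assume "fuchsian_equivalent B"
  then show ?thesis using B(2) T eq by (rule formal_isomorphism_conv_left)
next
  assume "fuchsian_equivalent B'"
  \<comment> \<open>\<open>transpose T\<close> relates the dual systems in the opposite order, so
    the regular one is now on the left.\<close>
  then have "fuchsian_equivalent (- transpose B')" by (rule fuchsian_equivalent_dual)
  moreover have "conv_mat (- transpose B)" using B(1) by (intro conv_intros)
  moreover have "invertible (\<chi> a b. fps_nth (transpose T $ a $ b) 0)"
  proof -
    have "(\<chi> a b. fps_nth (transpose T $ a $ b) 0) = transpose (\<chi> a b. fps_nth (T $ a $ b) 0)"
      by (simp add: vec_eq_iff transpose_def)
    then show ?thesis using T by (simp add: invertible_transpose_iff)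
  qed
  moreover have "- transpose B' ** transpose T + fps_X\<^sup>2 *k mderiv (transpose T) = transpose T ** (- transpose B)"
    using arg_cong[OF eq, of transpose]
    by (simp add: matrix_transpose_mul mderiv_transpose transpose_simps matrix_mult_uminus algebra_simps)
  ultimately have "conv_mat (transpose T)" by (rule formal_isomorphism_conv_left)
  then show ?thesis using conv_mat_transpose by fastforce
qed

section \<open>Regular singular systems\<close>

lemma fps_to_fls_sum: "fps_to_fls (sum f A) = (\<Sum>x\<in>A. fps_to_fls (f x))"
  by (induction A rule: infinite_finite_induct) auto

lemma fps_to_fls_prod: "fps_to_fls (prod f A) = (\<Prod>x\<in>A. fps_to_fls (f x))"
  for f :: "'i \<Rightarrow> complex fps"
  by (induction A rule: infinite_finite_induct) (auto simp: fls_times_fps_to_fls)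

text \<open>A Laurent expansion ignores the value at 0. This suits identities known only for small
  \<open>z \<noteq> 0\<close>, and functions such as \<open>z ^ n *k P z\<close> whose value at the
  former pole is arbitrary.\<close>

definition mat_expansion :: "(complex \<Rightarrow> complex ^ 'n ^ 'm) \<Rightarrow> complex fps ^ 'n ^ 'm \<Rightarrow> bool" where
  "mat_expansion f F \<longleftrightarrow> (\<forall>a b. (\<lambda>z. f z $ a $ b) has_laurent_expansion fps_to_fls (F $ a $ b))"

lemma mat_expansionD: "mat_expansion f F \<Longrightarrow> (\<lambda>z. f z $ a $ b) has_laurent_expansion fps_to_fls (F $ a $ b)"
  by (simp add: mat_expansion_def)

lemma mat_expansion_conv: "mat_expansion f F \<Longrightarrow> conv_mat F"
  unfolding mat_expansion_def conv_mat_def conv_fps_def has_laurent_expansion_def by simp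

lemma mat_expansion_unique:
  assumes "mat_expansion f F" "mat_expansion g G" "\<forall>\<^sub>F z in at 0. f z = g z"
  shows "F = G"
proof -
  have "fps_to_fls (F $ a $ b) = fps_to_fls (G $ a $ b)" for a b
  proof -
    have "\<forall>\<^sub>F z in at 0. f z $ a $ b = g z $ a $ b"
      using assms(3) by eventually_elim simp
    then have "(\<lambda>z. g z $ a $ b) has_laurent_expansion fps_to_fls (F $ a $ b)"
      using mat_expansionD[OF assms(1)] has_laurent_expansion_cong by fast
    then show ?thesis
      using mat_expansionD[OF assms(2)] by (rule has_laurent_expansion_unique)
  qed
  then show ?thesis by (simp add: vec_eq_iff)
qed

lemma mat_expansion_taylor:
  fixes f :: "complex \<Rightarrow> complex ^ 'n ^ 'm"
  assumes "\<And>a b. (\<lambda>z. f z $ a $ b) analytic_on {0}"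
  shows "mat_expansion f (taylor_z f)"
  unfolding mat_expansion_def taylor_z_def
  by (simp add: has_laurent_expansion_fps analytic_at_imp_has_fps_expansion_0 assms)

lemma mat_expansion_diff:
  "mat_expansion f F \<Longrightarrow> mat_expansion g G \<Longrightarrow> mat_expansion (\<lambda>z. f z - g z) (F - G)"
  unfolding mat_expansion_def by (auto intro: has_laurent_expansion_diff)

lemma mat_expansion_mult:
  assumes "mat_expansion f F" "mat_expansion g G"
  shows "mat_expansion (\<lambda>z. f z ** g z) (F ** G)"
  using assms unfolding mat_expansion_def matrix_mult_nth fps_to_fls_sum fls_times_fps_to_fls
  by (intro allI has_laurent_expansion_sum has_laurent_expansion_mult) auto

lemma mat_expansion_scale:
  assumes "c has_laurent_expansion fps_to_fls C" "mat_expansion f F"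
  shows "mat_expansion (\<lambda>z. c z *k f z) (C *k F)"
  using assms unfolding mat_expansion_def scalar_matrix_nth fls_times_fps_to_fls
  by (auto intro: has_laurent_expansion_mult)

lemma mat_expansion_mderiv:
  assumes "mat_expansion f F"
  shows "mat_expansion (\<lambda>z. \<chi> a b. deriv (\<lambda>w. f w $ a $ b) z) (mderiv F)"
  using assms unfolding mat_expansion_def
  by (auto simp flip: fls_deriv_fps_to_fls intro: has_laurent_expansion_deriv)

lemma has_laurent_expansion_power_fps:
  "(\<lambda>z. z ^ n) has_laurent_expansion fps_to_fls (fps_X ^ n)"
  by (intro has_laurent_expansion_fps has_fps_expansion_fps_X_power)

lemma has_laurent_expansion_of_int_fls: "(\<lambda>_. of_int n) has_laurent_expansion of_int n"
  using has_laurent_expansion_const[of "of_int n"] by (simp add: fls_of_int)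

lemma det_expansion:
  assumes "mat_expansion f F"
  shows "(\<lambda>z. det (f z)) has_laurent_expansion fps_to_fls (det F)"
  using assms unfolding mat_expansion_def det_def fps_to_fls_sum fps_to_fls_prod fls_times_fps_to_fls fps_to_fls_of_int
  by (intro has_laurent_expansion_sum has_laurent_expansion_mult has_laurent_expansion_prod
      has_laurent_expansion_of_int_fls) auto

lemma mat_expansion_adj:
  assumes "mat_expansion f F"
  shows "mat_expansion (\<lambda>z. adj_matrix (f z)) (adj_matrix F)"
  unfolding mat_expansion_def[of "\<lambda>z. adj_matrix (f z)"]
  unfolding adj_matrix_def vec_lambda_beta
proof (intro allI det_expansion)
  fix k l
  have "(\<lambda>z. (\<chi> i. if i = l then axis k 1 else f z $ i) $ a $ b) has_laurent_expansion
      fps_to_fls ((\<chi> i. if i = l then axis k 1 else F $ i) $ a $ b)" for a b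
    using mat_expansionD[OF assms, of a b] by (cases "a = l"; cases "b = k") (simp_all add: axis_def)
  then show "mat_expansion (\<lambda>z. \<chi> i. if i = l then axis k 1 else f z $ i) (\<chi> i. if i = l then axis k 1 else F $ i)"
    by (simp only: mat_expansion_def simp_thms)
qed

lemma expansion_nonzero:
  assumes "f has_laurent_expansion fps_to_fls F" "\<forall>\<^sub>F z in at 0. f z \<noteq> 0"
  shows "F \<noteq> 0"
proof
  assume "F = 0"
  with assms(1) have "\<forall>\<^sub>F z in at 0. f z = 0"
    by (auto simp: has_laurent_expansion_def elim: eventually_mono)
  with assms(2) have "\<forall>\<^sub>F z in at (0::complex). False" by eventually_elim simp
  then show False by simp
qed

lemma fls_clear_pole:
  fixes F :: "complex fls"
  assumes "- fls_subdegree F \<le> int n"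
  obtains G where "fps_to_fls G = fls_X ^ n * F"
proof -
  have "fls_subdegree (fls_X ^ n * F) \<ge> 0"
    using assms by (cases "F = 0") (auto simp: fls_subdegree_mult_fls_X_power)
  then have "fps_to_fls (fls_regpart (fls_X ^ n * F)) = fls_X ^ n * F"
    by simp
  then show thesis by (rule that)
qed

text \<open>The gauge \<open>P\<close> is multiplied by \<open>z\<^sup>n\<close> to clear its poles.
  By the product rule this scalar factor only adds \<open>n\<close> times the identity to
  \<open>C\<close>.\<close>

lemma regular_singular_system_imp_fuchsian_equivalent:
  fixes B :: "complex \<Rightarrow> complex ^ 'n ^ 'n"
  assumes B: "\<And>a b. (\<lambda>z. B z $ a $ b) analytic_on {0}" and reg: "regular_singular_system B"
  shows "fuchsian_equivalent (taylor_z B)"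
proof -
  obtain P C :: "complex \<Rightarrow> complex ^ 'n ^ 'n" where
    P: "\<And>a b. (\<lambda>z. P z $ a $ b) meromorphic_on {0}" and inv: "\<forall>\<^sub>F z in at 0. invertible (P z)"
    and C: "\<And>a b. (\<lambda>z. C z $ a $ b) analytic_on {0}"
    and eq: "\<forall>\<^sub>F z in at 0. \<forall>a b.
        (B z ** P z) $ a $ b / z\<^sup>2 + deriv (\<lambda>w. P w $ a $ b) z = (P z ** C z) $ a $ b / z"
    using reg unfolding regular_singular_system_def by blast
  have "\<forall>a b. \<exists>F. (\<lambda>z. P z $ a $ b) has_laurent_expansion F"
    using P by (force simp: meromorphic_on_def)
  then obtain F where F: "\<And>a b. (\<lambda>z. P z $ a $ b) has_laurent_expansion F a b"
    by metis
  \<comment> \<open>The sum of all pole orders, a common bound for the entries; \<open>nat\<close>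
    turns the contribution of a pole-free entry into 0.\<close>
  define n where "n = (\<Sum>a\<in>UNIV. \<Sum>b\<in>UNIV. nat (- fls_subdegree (F a b)))"
  have n: "- fls_subdegree (F a b) \<le> int n" for a b
  proof -
    have "nat (- fls_subdegree (F a b)) \<le> (\<Sum>b\<in>UNIV. nat (- fls_subdegree (F a b)))"
      by (rule member_le_sum) auto
    also have "\<dots> \<le> n" unfolding n_def
      by (rule member_le_sum[where f = "\<lambda>a. \<Sum>b\<in>UNIV. nat (- fls_subdegree (F a b))"]) auto
    finally show ?thesis by linarith
  qed
  then have "\<forall>a b. \<exists>G. fps_to_fls G = fls_X ^ n * F a b"
    using fls_clear_pole by metis
  then obtain G0 where G0: "\<And>a b. fps_to_fls (G0 a b) = fls_X ^ n * F a b" by metis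
  define G where "G = (\<chi> a b. G0 a b)"
  have G: "fps_to_fls (G $ a $ b) = fls_X ^ n * F a b" for a b
    by (simp add: G_def G0)
  have Xn: "(\<lambda>z. z ^ k) has_laurent_expansion fls_X ^ k" for k
    using has_laurent_expansion_power_fps[of k] by (simp add: fps_to_fls_power)
  have mexp: "mat_expansion (\<lambda>z. z ^ n *k P z) G"
    unfolding mat_expansion_def G scalar_matrix_nth
    by (intro allI has_laurent_expansion_mult Xn F)
  let ?B = "taylor_z B" and ?C = "taylor_z C"
  note expB = mat_expansionD[OF mat_expansion_taylor[OF B]]
    and expC = mat_expansionD[OF mat_expansion_taylor[OF C]]
  have flsrel: "(\<Sum>k\<in>UNIV. fps_to_fls (?B $ a $ k) * F k b) + fls_X ^ 2 * fls_deriv (F a b) =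
      fls_X * (\<Sum>k\<in>UNIV. F a k * fps_to_fls (?C $ k $ b))" for a b
  proof (rule has_laurent_expansion_unique)
    have "(\<lambda>z. (\<Sum>k\<in>UNIV. B z $ a $ k * P z $ k $ b) + z ^ 2 * deriv (\<lambda>w. P w $ a $ b) z)
        has_laurent_expansion (\<Sum>k\<in>UNIV. fps_to_fls (?B $ a $ k) * F k b) + fls_X ^ 2 * fls_deriv (F a b)"
      by (intro has_laurent_expansion_add has_laurent_expansion_sum has_laurent_expansion_mult Xn
          expB F has_laurent_expansion_deriv)
    moreover have "\<forall>\<^sub>F z in at 0. (\<Sum>k\<in>UNIV. B z $ a $ k * P z $ k $ b) + z ^ 2 * deriv (\<lambda>w. P w $ a $ b) z =
        z ^ 1 * (\<Sum>k\<in>UNIV. P z $ a $ k * C z $ k $ b)"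
    proof -
      have "\<forall>\<^sub>F z in at (0::complex). z \<noteq> 0" by (simp add: eventually_at_filter)
      with eq show ?thesis
      proof eventually_elim
        case (elim z)
        from elim(1) have "z\<^sup>2 * ((B z ** P z) $ a $ b / z\<^sup>2 + deriv (\<lambda>w. P w $ a $ b) z) = z\<^sup>2 * ((P z ** C z) $ a $ b / z)"
          by simp
        with elim(2) show ?case
          by (simp add: matrix_mult_nth distrib_left power2_eq_square)
      qed
    qed
    ultimately show "(\<lambda>z. z ^ 1 * (\<Sum>k\<in>UNIV. P z $ a $ k * C z $ k $ b))
        has_laurent_expansion (\<Sum>k\<in>UNIV. fps_to_fls (?B $ a $ k) * F k b) + fls_X ^ 2 * fls_deriv (F a b)"
      using has_laurent_expansion_cong by fast
    have "(\<lambda>z. z ^ 1 * (\<Sum>k\<in>UNIV. P z $ a $ k * C z $ k $ b))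
        has_laurent_expansion fls_X ^ 1 * (\<Sum>k\<in>UNIV. F a k * fps_to_fls (?C $ k $ b))"
      by (intro has_laurent_expansion_sum has_laurent_expansion_mult Xn expC F)
    then show "(\<lambda>z. z ^ 1 * (\<Sum>k\<in>UNIV. P z $ a $ k * C z $ k $ b))
        has_laurent_expansion fls_X * (\<Sum>k\<in>UNIV. F a k * fps_to_fls (?C $ k $ b))" by simp
  qed
  have Xd: "fls_X * fls_deriv (fls_X ^ n) = (of_nat n * fls_X ^ n :: complex fls)"
    using arg_cong[OF fps_X_deriv_X_power[of n], of fps_to_fls]
    by (simp add: fls_times_fps_to_fls fps_to_fls_power fps_to_fls_of_nat flip: fls_deriv_fps_to_fls)
  have "?B ** G + fps_X\<^sup>2 *k mderiv G = fps_X *k (G ** (?C + of_nat n *k mat 1))"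
  proof -
    have "(?B ** G + fps_X\<^sup>2 *k mderiv G) $ a $ b = (fps_X *k (G ** ?C) + fps_X *k (of_nat n *k G)) $ a $ b" for a b
    proof -
      have "fps_to_fls ((?B ** G + fps_X\<^sup>2 *k mderiv G) $ a $ b) =
          (\<Sum>k\<in>UNIV. fps_to_fls (?B $ a $ k) * (fls_X ^ n * F k b)) + fls_X ^ 2 * fls_deriv (fls_X ^ n * F a b)"
        by (simp add: matrix_mult_nth fps_to_fls_sum fls_times_fps_to_fls fps_to_fls_power G flip: fls_deriv_fps_to_fls)
      also have "fls_X ^ 2 * fls_deriv (fls_X ^ n * F a b) =
          fls_X * ((fls_X * fls_deriv (fls_X ^ n)) * F a b) + fls_X ^ n * (fls_X ^ 2 * fls_deriv (F a b))"
        by (simp add: algebra_simps power2_eq_square)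
      also have "\<dots> = fls_X * of_nat n * (fls_X ^ n * F a b) + fls_X ^ n * (fls_X ^ 2 * fls_deriv (F a b))"
        unfolding Xd by (simp add: mult_ac)
      also have "(\<Sum>k\<in>UNIV. fps_to_fls (?B $ a $ k) * (fls_X ^ n * F k b)) +
          (fls_X * of_nat n * (fls_X ^ n * F a b) + fls_X ^ n * (fls_X ^ 2 * fls_deriv (F a b))) =
          fls_X ^ n * ((\<Sum>k\<in>UNIV. fps_to_fls (?B $ a $ k) * F k b) + fls_X ^ 2 * fls_deriv (F a b))
          + fls_X * of_nat n * (fls_X ^ n * F a b)"
        by (simp add: sum_distrib_left distrib_left mult.left_commute)
      also have "\<dots> = fls_X * (\<Sum>k\<in>UNIV. (fls_X ^ n * F a k) * fps_to_fls (?C $ k $ b)) +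
          fls_X * of_nat n * (fls_X ^ n * F a b)"
        unfolding flsrel by (simp add: sum_distrib_left mult_ac)
      also have "\<dots> = fps_to_fls ((fps_X *k (G ** ?C) + fps_X *k (of_nat n *k G)) $ a $ b)"
        by (simp add: matrix_mult_nth fps_to_fls_sum fls_times_fps_to_fls fps_to_fls_of_nat mult.assoc flip: G)
      finally show ?thesis by (simp only: fps_to_fls_eq_iff)
    qed
    then show ?thesis by (simp add: vec_eq_iff matrix_algebra)
  qed
  moreover have "det G \<noteq> 0"
  proof (rule expansion_nonzero[OF det_expansion[OF mexp]])
    have "\<forall>\<^sub>F z in at (0::complex). z \<noteq> 0" by (simp add: eventually_at_filter)
    with inv show "\<forall>\<^sub>F z in at 0. det (z ^ n *k P z) \<noteq> 0"
    proof eventually_elim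
      case (elim z)
      have "z ^ n *k P z = (z ^ n *k mat 1) ** P z" by (simp add: matrix_algebra)
      moreover have "det (z ^ n *k mat 1 :: complex ^ 'n ^ 'n) \<noteq> 0"
        using elim(2) by (simp add: det_scalar_mat_nonzero)
      ultimately show ?case using elim(1) by (simp add: det_mul invertible_det_nz)
    qed
  qed
  moreover have "conv_mat (?C + of_nat n *k mat 1)"
    using mat_expansion_conv[OF mat_expansion_taylor[OF C]] by (intro conv_intros)
  ultimately show ?thesis
    unfolding fuchsian_equivalent_def using mat_expansion_conv[OF mexp] by blast
qed

section \<open>Change of frame\<close>

lemma fuchsian_equivalent_gauge:
  assumes "fuchsian_equivalent B'" "conv_mat G" "det G \<noteq> 0"
    and eq: "B ** G + fps_X\<^sup>2 *k mderiv G = G ** B'"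
  shows "fuchsian_equivalent B"
proof -
  obtain P C where P: "conv_mat P" "conv_mat C" "det P \<noteq> 0"
    "B' ** P + fps_X\<^sup>2 *k mderiv P = fps_X *k (P ** C)"
    using assms(1) unfolding fuchsian_equivalent_def by blast
  have "B ** (G ** P) + fps_X\<^sup>2 *k mderiv (G ** P) =
      (B ** G + fps_X\<^sup>2 *k mderiv G) ** P + G ** (fps_X\<^sup>2 *k mderiv P)"
    by (simp add: mderiv_mult matrix_algebra matrix_mul_assoc)
  also have "\<dots> = G ** (B' ** P + fps_X\<^sup>2 *k mderiv P)"
    unfolding eq by (simp add: matrix_algebra matrix_mul_assoc)
  also have "\<dots> = fps_X *k ((G ** P) ** C)"
    unfolding P(4) by (simp add: matrix_algebra matrix_mul_assoc)
  finally show ?thesis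
    unfolding fuchsian_equivalent_def using P assms(2,3)
    by (intro exI[of _ "G ** P"] exI[of _ C]) (auto simp: det_mul intro: conv_mat_mult)
qed

text \<open>
  \<open>\<Gamma>\<close> is the matrix of \<open>\<nabla>\<close> along \<open>\<partial>\<^sub>z\<close> in a local trivialisation; \<open>\<Psi>\<close> and \<open>\<Psi>'\<close> express two frames
  in this trivialisation.  Only \<open>\<Psi>\<close>, \<open>\<Psi>'\<close> and the connection matrices are known to be holomorphic at
  \<open>z = 0\<close>, so \<open>\<Gamma>\<close> is eliminated by means of the adjugate of \<open>\<Psi>\<close> before passing to power series.
\<close>

lemma fuchsian_equivalent_frame_change:
  fixes B B' \<Psi> \<Psi>' :: "complex \<Rightarrow> complex ^ 'n ^ 'n"
  assumes an: "\<And>a b. (\<lambda>z. B z $ a $ b) analytic_on {0}" "\<And>a b. (\<lambda>z. B' z $ a $ b) analytic_on {0}"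
    "\<And>a b. (\<lambda>z. \<Psi> z $ a $ b) analytic_on {0}" "\<And>a b. (\<lambda>z. \<Psi>' z $ a $ b) analytic_on {0}"
    and inv: "invertible (\<Psi> 0)" "\<forall>\<^sub>F z in at 0. invertible (\<Psi>' z)"
    and eq: "\<forall>\<^sub>F z in at 0. \<Psi> z ** B z = z\<^sup>2 *k ((\<chi> a b. deriv (\<lambda>w. \<Psi> w $ a $ b) z) + \<Gamma> z ** \<Psi> z)"
    and eq': "\<forall>\<^sub>F z in at 0. \<Psi>' z ** B' z = z\<^sup>2 *k ((\<chi> a b. deriv (\<lambda>w. \<Psi>' w $ a $ b) z) + \<Gamma> z ** \<Psi>' z)"
    and reg: "fuchsian_equivalent (taylor_z B')"
  shows "fuchsian_equivalent (taylor_z B)"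
proof -
  note ex = an[THEN mat_expansion_taylor]
  let ?B = "taylor_z B" and ?B' = "taylor_z B'" and ?\<Psi> = "taylor_z \<Psi>" and ?\<Psi>' = "taylor_z \<Psi>'"
  note cm = ex[THEN mat_expansion_conv]
  define \<delta> where "\<delta> = det ?\<Psi>"
  have rel: "(?\<Psi> ** ?B - fps_X\<^sup>2 *k mderiv ?\<Psi>) ** adj_matrix ?\<Psi> ** ?\<Psi>' =
      \<delta> *k (?\<Psi>' ** ?B' - fps_X\<^sup>2 *k mderiv ?\<Psi>')"
  proof (rule mat_expansion_unique)
    show "mat_expansion (\<lambda>z. (\<Psi> z ** B z - z\<^sup>2 *k (\<chi> a b. deriv (\<lambda>w. \<Psi> w $ a $ b) z)) ** adj_matrix (\<Psi> z) ** \<Psi>' z)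
        ((?\<Psi> ** ?B - fps_X\<^sup>2 *k mderiv ?\<Psi>) ** adj_matrix ?\<Psi> ** ?\<Psi>')"
      by (intro mat_expansion_mult mat_expansion_diff mat_expansion_scale mat_expansion_mderiv
          mat_expansion_adj ex has_laurent_expansion_power_fps)
    show "mat_expansion (\<lambda>z. det (\<Psi> z) *k (\<Psi>' z ** B' z - z\<^sup>2 *k (\<chi> a b. deriv (\<lambda>w. \<Psi>' w $ a $ b) z)))
        (\<delta> *k (?\<Psi>' ** ?B' - fps_X\<^sup>2 *k mderiv ?\<Psi>'))"
      unfolding \<delta>_def
      by (intro mat_expansion_mult mat_expansion_diff mat_expansion_scale mat_expansion_mderiv
          ex has_laurent_expansion_power_fps det_expansion)
    show "\<forall>\<^sub>F z in at 0. (\<Psi> z ** B z - z\<^sup>2 *k (\<chi> a b. deriv (\<lambda>w. \<Psi> w $ a $ b) z)) ** adj_matrix (\<Psi> z) ** \<Psi>' z =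
        det (\<Psi> z) *k (\<Psi>' z ** B' z - z\<^sup>2 *k (\<chi> a b. deriv (\<lambda>w. \<Psi>' w $ a $ b) z))"
      using eq eq'
    proof eventually_elim
      case (elim z)
      have "(\<Psi> z ** B z - z\<^sup>2 *k (\<chi> a b. deriv (\<lambda>w. \<Psi> w $ a $ b) z)) ** adj_matrix (\<Psi> z) ** \<Psi>' z =
          z\<^sup>2 *k (\<Gamma> z ** (\<Psi> z ** adj_matrix (\<Psi> z)) ** \<Psi>' z)"
        unfolding elim(1) by (simp add: matrix_algebra matrix_mul_assoc)
      also have "\<dots> = det (\<Psi> z) *k (z\<^sup>2 *k (\<Gamma> z ** \<Psi>' z))"
        by (simp add: matrix_mult_adj_matrix matrix_algebra mult.commute)
      also have "\<dots> = det (\<Psi> z) *k (\<Psi>' z ** B' z - z\<^sup>2 *k (\<chi> a b. deriv (\<lambda>w. \<Psi>' w $ a $ b) z))"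
        unfolding elim(2) by (simp add: matrix_algebra)
      finally show ?case .
    qed
  qed
  have "fps_nth \<delta> 0 = det (\<Psi> 0)"
    unfolding \<delta>_def fps_nth_det_0 by (simp add: taylor_z_def fps_expansion_def)
  then have \<delta>0: "fps_nth \<delta> 0 \<noteq> 0" using inv(1) by (simp add: invertible_det_nz)
  then have \<delta>: "inverse \<delta> * \<delta> = 1" "\<delta> \<noteq> 0" by (auto simp: inverse_mult_eq_1)
  define \<Phi> where "\<Phi> = inverse \<delta> *k adj_matrix ?\<Psi>"
  have \<Phi>: "?\<Psi> ** \<Phi> = mat 1" "\<Phi> ** ?\<Psi> = mat 1"
    using \<delta> adj_matrix_mult[of ?\<Psi>] unfolding \<Phi>_def
    by (simp_all add: matrix_algebra matrix_mult_adj_matrix flip: \<delta>_def) (simp_all add: vec_eq_iff)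
  have c\<Phi>: "conv_mat \<Phi>"
    unfolding \<Phi>_def using cm(3) conv_fps_det[OF cm(3)] \<delta>0 by (intro conv_intros) (simp_all add: \<delta>_def)
  have d\<Phi>: "mderiv \<Phi> = - (\<Phi> ** mderiv ?\<Psi> ** \<Phi>)"
  proof -
    have "mderiv (\<Phi> ** ?\<Psi>) = 0" by (simp add: \<Phi>(2))
    then have "mderiv \<Phi> ** ?\<Psi> = - (\<Phi> ** mderiv ?\<Psi>)"
      by (simp add: mderiv_mult eq_neg_iff_add_eq_0)
    then have "mderiv \<Phi> ** (?\<Psi> ** \<Phi>) = - (\<Phi> ** mderiv ?\<Psi>) ** \<Phi>"
      by (simp add: matrix_mul_assoc)
    then show ?thesis by (simp add: \<Phi>(1) matrix_mult_uminus)
  qed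
  \<comment> \<open>The base change from the first frame to the second. Multiplying
    \<open>rel\<close> by the inverse \<open>\<Phi>\<close> and inserting \<open>d\<Phi>\<close>
    turns it into the gauge equation for \<open>?G\<close>.\<close>
  let ?G = "\<Phi> ** ?\<Psi>'"
  have "(?\<Psi> ** ?B - fps_X\<^sup>2 *k mderiv ?\<Psi>) ** \<Phi> ** ?\<Psi>' =
      inverse \<delta> *k ((?\<Psi> ** ?B - fps_X\<^sup>2 *k mderiv ?\<Psi>) ** adj_matrix ?\<Psi> ** ?\<Psi>')"
    unfolding \<Phi>_def by (simp only: matrix_mult_scalar_left matrix_mult_scalar_right)
  also have "\<dots> = ?\<Psi>' ** ?B' - fps_X\<^sup>2 *k mderiv ?\<Psi>'"
    unfolding rel by (simp only: scalar_scalar_matrix \<delta>) (simp add: vec_eq_iff)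
  finally have "\<Phi> ** ((?\<Psi> ** ?B - fps_X\<^sup>2 *k mderiv ?\<Psi>) ** \<Phi> ** ?\<Psi>') =
      \<Phi> ** (?\<Psi>' ** ?B' - fps_X\<^sup>2 *k mderiv ?\<Psi>')" by simp
  then have "(\<Phi> ** ?\<Psi>) ** ?B ** ?G - fps_X\<^sup>2 *k (\<Phi> ** mderiv ?\<Psi> ** \<Phi> ** ?\<Psi>') =
      ?G ** ?B' - fps_X\<^sup>2 *k (\<Phi> ** mderiv ?\<Psi>')"
    by (simp add: matrix_algebra matrix_mul_assoc)
  then have "?B ** ?G + fps_X\<^sup>2 *k mderiv ?G = ?G ** ?B'"
    unfolding mderiv_mult d\<Phi> by (simp add: \<Phi>(2) matrix_algebra matrix_mult_uminus scalar_matrix_uminus algebra_simps matrix_mul_assoc)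
  moreover have "det ?G \<noteq> 0"
  proof -
    have "det \<Phi> * det ?\<Psi> = 1" using arg_cong[OF \<Phi>(2), of det] by (simp add: det_mul)
    moreover have "det ?\<Psi>' \<noteq> 0"
      by (rule expansion_nonzero[OF det_expansion[OF ex(4)]])
         (use inv(2) in \<open>simp add: invertible_det_nz\<close>)
    ultimately show ?thesis by (auto simp: det_mul)
  qed
  moreover have "conv_mat ?G" using c\<Phi> cm(4) by (rule conv_mat_mult)
  ultimately show ?thesis using fuchsian_equivalent_gauge[OF reg] by blast
qed

section \<open>Connections in local trivialisations\<close>

lemma holo_z_on_subset: "holo_z_on I S f \<Longrightarrow> S' \<subseteq> S \<Longrightarrow> holo_z_on I S' f"
  unfolding holo_z_on_def by (blast intro: has_derivative_subset)

lemma holo_z_on_cong: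
  assumes "holo_z_on I S f" "\<And>p. p \<in> S \<Longrightarrow> g p = f p"
  shows "holo_z_on I S g"
  unfolding holo_z_on_def
proof
  fix p assume p: "p \<in> S"
  then obtain a b where "(f has_derivative (\<lambda>(w, h). a * w + (\<Sum>i\<in>I. b i * h $ i))) (at p within S)"
    using assms(1) unfolding holo_z_on_def by blast
  then have "(g has_derivative (\<lambda>(w, h). a * w + (\<Sum>i\<in>I. b i * h $ i))) (at p within S)"
    using has_derivative_transform[of p S g f] p assms(2) by blast
  then show "\<exists>a b. (g has_derivative (\<lambda>(w, h). a * w + (\<Sum>i\<in>I. b i * h $ i))) (at p within S)"
    by blast
qed

lemma holo_z_on_add:
  assumes "holo_z_on I S f" "holo_z_on I S g"
  shows "holo_z_on I S (\<lambda>p. f p + g p)"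
  unfolding holo_z_on_def
proof
  fix p assume "p \<in> S"
  then obtain a b a' b' where
    f: "(f has_derivative (\<lambda>(w, h). a * w + (\<Sum>i\<in>I. b i * h $ i))) (at p within S)" and
    g: "(g has_derivative (\<lambda>(w, h). a' * w + (\<Sum>i\<in>I. b' i * h $ i))) (at p within S)"
    using assms unfolding holo_z_on_def by meson
  have "((\<lambda>p. f p + g p) has_derivative
      (\<lambda>(w, h). (a + a') * w + (\<Sum>i\<in>I. (b i + b' i) * h $ i))) (at p within S)"
    by (rule has_derivative_eq_rhs[OF has_derivative_add[OF f g]])
       (auto simp: fun_eq_iff algebra_simps sum.distrib)
  then show "\<exists>a b. ((\<lambda>p. f p + g p) has_derivative
      (\<lambda>(w, h). a * w + (\<Sum>i\<in>I. b i * h $ i))) (at p within S)"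
    by (intro exI[of _ "a + a'"] exI[of _ "\<lambda>i. b i + b' i"])
qed

lemma holo_z_on_mult:
  assumes "holo_z_on I S f" "holo_z_on I S g"
  shows "holo_z_on I S (\<lambda>p. f p * g p)"
  unfolding holo_z_on_def
proof
  fix p assume "p \<in> S"
  then obtain a b a' b' where
    f: "(f has_derivative (\<lambda>(w, h). a * w + (\<Sum>i\<in>I. b i * h $ i))) (at p within S)" and
    g: "(g has_derivative (\<lambda>(w, h). a' * w + (\<Sum>i\<in>I. b' i * h $ i))) (at p within S)"
    using assms unfolding holo_z_on_def by meson
  have "((\<lambda>p. f p * g p) has_derivative
      (\<lambda>(w, h). (f p * a' + a * g p) * w + (\<Sum>i\<in>I. (f p * b' i + b i * g p) * h $ i))) (at p within S)"
    by (rule has_derivative_eq_rhs[OF has_derivative_mult[OF f g]])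
       (auto simp: fun_eq_iff algebra_simps sum.distrib sum_distrib_left)
  then show "\<exists>a b. ((\<lambda>p. f p * g p) has_derivative
      (\<lambda>(w, h). a * w + (\<Sum>i\<in>I. b i * h $ i))) (at p within S)"
    by (intro exI[of _ "f p * a' + a * g p"] exI[of _ "\<lambda>i. f p * b' i + b i * g p"])
qed

lemma holo_z_on_const: "holo_z_on I S (\<lambda>p. c)"
  unfolding holo_z_on_def
  by (intro ballI exI[of _ 0] exI[of _ "\<lambda>_. 0"]) (auto intro!: has_derivative_eq_rhs[OF has_derivative_const])

lemma holo_z_on_slice:
  assumes f: "holo_z_on I S f" and Z: "open Z" "\<And>z. z \<in> Z \<Longrightarrow> (z, x) \<in> S"
  shows "(\<lambda>z. f (z, x)) holomorphic_on Z"
  unfolding holomorphic_on_def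
proof
  fix z assume z: "z \<in> Z"
  obtain a b where f': "(f has_derivative (\<lambda>(w, h). a * w + (\<Sum>i\<in>I. b i * h $ i))) (at (z, x) within S)"
    using f Z(2)[OF z] unfolding holo_z_on_def by blast
  have "((\<lambda>z. (z, x)) has_derivative (\<lambda>w. (w, 0))) (at z within Z)"
    by (intro derivative_intros)
  moreover have "(f has_derivative (\<lambda>(w, h). a * w + (\<Sum>i\<in>I. b i * h $ i))) (at (z, x) within (\<lambda>z. (z, x)) ` Z)"
    using f' by (rule has_derivative_subset) (use Z in auto)
  ultimately have "((\<lambda>z. f (z, x)) has_derivative
      (\<lambda>w. (\<lambda>(w, h). a * w + (\<Sum>i\<in>I. b i * h $ i)) (w, 0))) (at z within Z)"
    by (rule has_derivative_in_compose)
  then have "((\<lambda>z. f (z, x)) has_derivative (\<lambda>w. a * w)) (at z within Z)"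
    by simp
  then show "(\<lambda>z. f (z, x)) field_differentiable at z within Z"
    unfolding field_differentiable_def has_field_derivative_def by blast
qed

lemma open_slice:
  fixes W :: "(complex \<times> 'm::topological_space) set"
  assumes "open W"
  shows "open {z. (z, m) \<in> W}"
proof -
  have "open ((\<lambda>z. (z, m)) -` W)"
    by (intro open_vimage assms continuous_intros)
  then show ?thesis by (simp add: vimage_def)
qed

lemma is_chart_inv: "is_chart I c \<Longrightarrow> m \<in> fst c \<Longrightarrow> chart_inv c (snd c m) = m"
  unfolding is_chart_def homeomorphism_def by blast

lemma holo_fun_subset: "holo_fun I \<A> W f \<Longrightarrow> W' \<subseteq> W \<Longrightarrow> holo_fun I \<A> W' f"
  unfolding holo_fun_def in_coords_def by (blast intro: holo_z_on_subset)

lemma holo_fun_add: "holo_fun I \<A> W f \<Longrightarrow> holo_fun I \<A> W g \<Longrightarrow> holo_fun I \<A> W (\<lambda>p. f p + g p)"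
  unfolding holo_fun_def using holo_z_on_add by (fastforce simp: case_prod_unfold)

lemma holo_fun_mult: "holo_fun I \<A> W f \<Longrightarrow> holo_fun I \<A> W g \<Longrightarrow> holo_fun I \<A> W (\<lambda>p. f p * g p)"
  unfolding holo_fun_def using holo_z_on_mult by (fastforce simp: case_prod_unfold)

lemma holo_fun_const: "holo_fun I \<A> W (\<lambda>p. c)"
  unfolding holo_fun_def by (auto simp: case_prod_unfold holo_z_on_const)

text \<open>On \<open>in_coords c W\<close> the chart inverse returns to points of \<open>W\<close>;
  this needs \<open>c\<close> to be injective, hence the assumption on charts.\<close>

lemma holo_fun_cong:
  assumes "\<forall>c\<in>\<A>. is_chart I c" "holo_fun I \<A> W f" "\<And>p. p \<in> W \<Longrightarrow> g p = f p"
  shows "holo_fun I \<A> W g"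
  unfolding holo_fun_def
proof
  fix c assume c: "c \<in> \<A>"
  show "holo_z_on I (in_coords c W) (\<lambda>(z, x). g (z, chart_inv c x))"
  proof (rule holo_z_on_cong)
    show "holo_z_on I (in_coords c W) (\<lambda>(z, x). f (z, chart_inv c x))"
      using assms(2) c by (simp add: holo_fun_def)
    fix p assume "p \<in> in_coords c W"
    then show "(case p of (z, x) \<Rightarrow> g (z, chart_inv c x)) = (case p of (z, x) \<Rightarrow> f (z, chart_inv c x))"
      using assms(1,3) c by (auto simp: in_coords_def is_chart_inv)
  qed
qed

lemma matrix_vector_lincomb:
  fixes g :: "complex ^ 'n ^ 'm"
  shows "g *v (\<Sum>j\<in>J. a j *s x j) = (\<Sum>j\<in>J. a j *s (g *v x j))"
  by (induction J rule: infinite_finite_induct)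
     (simp_all add: matrix_vector_right_distrib vector_scalar_commute)

section \<open>Fibre operations and the connection matrix of a trivialisation\<close>

context TE_structure
begin

lemma charts: "\<forall>c\<in>\<A>. is_chart I c"
  using manifold by (simp add: complex_manifold_def)

lemma triv_bij: "(W, \<psi>) \<in> trivs H \<Longrightarrow> bij_betw (\<lambda>h. (proj H h, \<psi> h)) (proj H -` W) (W \<times> UNIV)"
  and triv_open: "(W, \<psi>) \<in> trivs H \<Longrightarrow> open W"
  using vector_bundle unfolding holomorphic_bundle_def by blast+

lemma triv_exists: obtains W \<psi> where "(W, \<psi>) \<in> trivs H" "p \<in> W"
proof -
  have "p \<in> (\<Union>\<tau>\<in>trivs H. fst \<tau>)" using vector_bundle unfolding holomorphic_bundle_def by simp
  then show thesis using that by auto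
qed

lemma triv_change:
  assumes "(W, \<psi>) \<in> trivs H" "(W', \<psi>') \<in> trivs H"
  obtains g :: "complex \<times> 'm \<Rightarrow> complex ^ 'r ^ 'r" where
    "\<And>a b. holo_fun I \<A> (W \<inter> W') (\<lambda>p. g p $ a $ b)"
    "\<And>h. proj H h \<in> W \<inter> W' \<Longrightarrow> \<psi>' h = g (proj H h) *v \<psi> h"
  using vector_bundle assms unfolding holomorphic_bundle_def by (fast intro: that)

lemma fibre_eqI:
  assumes "(W, \<psi>) \<in> trivs H" "proj H h \<in> W" "proj H h = proj H k" "\<psi> h = \<psi> k"
  shows "h = k"
  using bij_betw_imp_inj_on[OF triv_bij[OF assms(1)]] assms(2-) by (auto simp: inj_on_def)

lemma fibre_point:
  assumes "(W, \<psi>) \<in> trivs H" "p \<in> W"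
  obtains h where "proj H h = p" "\<psi> h = x"
proof -
  have "(p, x) \<in> (\<lambda>h. (proj H h, \<psi> h)) ` (proj H -` W)"
    using bij_betw_imp_surj_on[OF triv_bij[OF assms(1)]] assms(2) by simp
  then show thesis using that by auto
qed

text \<open>The definite description is legitimate: one trivialisation produces a candidate, the
  linearity of the transition matrices makes it correct in all others, and injectivity on the fibre
  makes it unique.\<close>

lemma lincomb:
  assumes v: "\<And>j. j \<in> J \<Longrightarrow> proj H (v j) = p"
  shows proj_lincomb: "proj H (lincomb H p J a v) = p"
    and triv_lincomb: "(W, \<psi>) \<in> trivs H \<Longrightarrow> p \<in> W \<Longrightarrow> \<psi> (lincomb H p J a v) = (\<Sum>j\<in>J. a j *s \<psi> (v j))"
proof -
  let ?P = "\<lambda>h. proj H h = p \<and> (\<forall>(W, \<psi>)\<in>trivs H. p \<in> W \<longrightarrow> \<psi> h = (\<Sum>j\<in>J. a j *s \<psi> (v j)))"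
  obtain W0 \<psi>0 where W0: "(W0, \<psi>0) \<in> trivs H" "p \<in> W0" by (rule triv_exists)
  obtain h where h: "proj H h = p" "\<psi>0 h = (\<Sum>j\<in>J. a j *s \<psi>0 (v j))"
    using fibre_point[OF W0] by metis
  have "\<psi> h = (\<Sum>j\<in>J. a j *s \<psi> (v j))" if W: "(W, \<psi>) \<in> trivs H" "p \<in> W" for W \<psi>
  proof -
    obtain g where g: "\<And>h. proj H h \<in> W0 \<inter> W \<Longrightarrow> \<psi> h = (g (proj H h) :: complex ^ 'r ^ 'r) *v \<psi>0 h"
      using triv_change[OF W0(1) W(1)] by metis
    have "\<psi> h = g p *v (\<Sum>j\<in>J. a j *s \<psi>0 (v j))"
      using g[of h] h W0(2) W(2) by simp
    also have "\<dots> = (\<Sum>j\<in>J. a j *s \<psi> (v j))"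
      unfolding matrix_vector_lincomb
      by (intro sum.cong refl) (use g v W0(2) W(2) in simp)
    finally show ?thesis .
  qed
  then have Ph: "?P h" using h(1) by auto
  have uniq: "k = h" if k: "?P k" for k
  proof (rule fibre_eqI[OF W0(1)])
    show "\<psi>0 k = \<psi>0 h" using k h(2) W0 by fastforce
    show "proj H k \<in> W0" "proj H k = proj H h" using k h(1) W0(2) by simp_all
  qed
  have P: "?P (lincomb H p J a v)"
    unfolding lincomb_def using theI[of ?P h, OF Ph uniq] .
  show "proj H (lincomb H p J a v) = p" using P by blast
  show "(W, \<psi>) \<in> trivs H \<Longrightarrow> p \<in> W \<Longrightarrow> \<psi> (lincomb H p J a v) = (\<Sum>j\<in>J. a j *s \<psi> (v j))"
    using P by blast
qed

lemma proj_fibre_add: "proj H h = proj H k \<Longrightarrow> proj H (fibre_add H h k) = proj H h"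
  unfolding fibre_add_def by (rule proj_lincomb) auto

lemma triv_fibre_add:
  assumes "proj H h = proj H k" "(W, \<psi>) \<in> trivs H" "proj H h \<in> W"
  shows "\<psi> (fibre_add H h k) = \<psi> h + \<psi> k"
proof -
  have "\<psi> (fibre_add H h k) = (\<Sum>j\<in>UNIV. 1 *s \<psi> (if j then h else k))"
    unfolding fibre_add_def by (rule triv_lincomb) (use assms in auto)
  then show ?thesis by (simp add: UNIV_bool add.commute)
qed

lemma proj_fibre_scale: "proj H (fibre_scale H a h) = proj H h"
  unfolding fibre_scale_def by (rule proj_lincomb) auto

lemma triv_fibre_scale:
  assumes "(W, \<psi>) \<in> trivs H" "proj H h \<in> W"
  shows "\<psi> (fibre_scale H a h) = a *s \<psi> h"
  using triv_lincomb[of "{()}" "\<lambda>_. h" "proj H h" W \<psi> "\<lambda>_. a"] assms by (simp add: fibre_scale_def)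

lemma holo_section_subset:
  "holo_section I \<A> H W s \<Longrightarrow> W' \<subseteq> W \<Longrightarrow> holo_section I \<A> H W' s"
  unfolding holo_section_def by (fast intro: holo_fun_subset)

lemma holo_sectionD:
  assumes "holo_section I \<A> H W s"
  shows "p \<in> W \<Longrightarrow> proj H (s p) = p"
    and "(W', \<psi>) \<in> trivs H \<Longrightarrow> holo_fun I \<A> (W \<inter> W') (\<lambda>p. \<psi> (s p) $ a)"
  using assms unfolding holo_section_def by blast+

lemma holo_section_add:
  assumes "holo_section I \<A> H W s" "holo_section I \<A> H W s'"
  shows "holo_section I \<A> H W (\<lambda>q. fibre_add H (s q) (s' q))"
  unfolding holo_section_def
proof (intro conjI ballI, goal_cases)
  case (1 p)
  then show ?case using assms by (simp add: proj_fibre_add holo_sectionD)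
next
  case (2 \<tau>)
  show ?case
  proof (cases \<tau>)
    case (Pair W' \<psi>)
    have "holo_fun I \<A> (W \<inter> W') (\<lambda>p. \<psi> (fibre_add H (s p) (s' p)) $ a)" for a
    proof (rule holo_fun_cong[OF charts])
      show "holo_fun I \<A> (W \<inter> W') (\<lambda>p. \<psi> (s p) $ a + \<psi> (s' p) $ a)"
        using 2 Pair assms by (intro holo_fun_add holo_sectionD(2)) auto
      fix p assume "p \<in> W \<inter> W'"
      then show "\<psi> (fibre_add H (s p) (s' p)) $ a = \<psi> (s p) $ a + \<psi> (s' p) $ a"
        using assms 2 Pair triv_fibre_add[of "s p" "s' p" W' \<psi>] by (simp add: holo_sectionD(1))
    qed
    then show ?thesis by (simp add: Pair)
  qed
qed

lemma holo_section_scale: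
  assumes "holo_fun I \<A> W f" "holo_section I \<A> H W s"
  shows "holo_section I \<A> H W (\<lambda>q. fibre_scale H (f q) (s q))"
  unfolding holo_section_def
proof (intro conjI ballI, goal_cases)
  case (1 p)
  then show ?case using assms by (simp add: proj_fibre_scale holo_sectionD)
next
  case (2 \<tau>)
  show ?case
  proof (cases \<tau>)
    case (Pair W' \<psi>)
    have "holo_fun I \<A> (W \<inter> W') (\<lambda>p. \<psi> (fibre_scale H (f p) (s p)) $ a)" for a
    proof (rule holo_fun_cong[OF charts])
      show "holo_fun I \<A> (W \<inter> W') (\<lambda>p. f p * \<psi> (s p) $ a)"
        using 2 Pair assms by (intro holo_fun_mult holo_sectionD(2) holo_fun_subset[OF assms(1)]) auto
      fix p assume "p \<in> W \<inter> W'"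
      then show "\<psi> (fibre_scale H (f p) (s p)) $ a = f p * \<psi> (s p) $ a"
        using assms 2 Pair triv_fibre_scale[of W' \<psi> "s p" "f p"] by (simp add: holo_sectionD(1))
    qed
    then show ?thesis by (simp add: Pair)
  qed
qed

text \<open>The unit vectors of a trivialisation form a holomorphic frame, since any other
  trivialisation sees them as columns of a holomorphic transition matrix.\<close>

lemma triv_frame:
  assumes "(W, \<psi>) \<in> trivs H"
  obtains e where "\<And>a. holo_section I \<A> H W (e a)" "\<And>a p. p \<in> W \<Longrightarrow> \<psi> (e a p) = axis a 1"
proof -
  have "\<forall>a p. \<exists>h. p \<in> W \<longrightarrow> proj H h = p \<and> \<psi> h = axis a 1"
    using fibre_point[OF assms] by metis
  then obtain e where e: "\<And>a p. p \<in> W \<Longrightarrow> proj H (e a p) = p" "\<And>a p. p \<in> W \<Longrightarrow> \<psi> (e a p) = axis a 1"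
    by metis
  have "holo_section I \<A> H W (e a)" for a
    unfolding holo_section_def
  proof (intro conjI ballI, goal_cases)
    case (1 p)
    then show ?case by (rule e)
  next
    case (2 \<tau>)
    show ?case
    proof (cases \<tau>)
      case (Pair W' \<psi>')
      with 2 have "(W', \<psi>') \<in> trivs H" by simp
      then obtain g where g: "\<And>a b. holo_fun I \<A> (W \<inter> W') (\<lambda>p. g p $ a $ b)"
          "\<And>h. proj H h \<in> W \<inter> W' \<Longrightarrow> \<psi>' h = (g (proj H h) :: complex ^ 'r ^ 'r) *v \<psi> h"
        using triv_change[OF assms] by metis
      have "holo_fun I \<A> (W \<inter> W') (\<lambda>p. \<psi>' (e a p) $ b)" for b
      proof (rule holo_fun_cong[OF charts g(1)[of b a]])
        fix p assume p: "p \<in> W \<inter> W'"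
        then have "\<psi>' (e a p) = g p *v axis a 1" using g(2)[of "e a p"] e by simp
        then show "\<psi>' (e a p) $ b = g p $ b $ a"
          by (simp add: matrix_vector_mult_def axis_def if_distrib cong: if_cong)
      qed
      then show ?thesis by (simp add: Pair)
    qed
  qed
  then show thesis using that e(2) by blast
qed

text \<open>Additivity and the Leibniz rule speak of two summands and one scalar, so the section is
  assembled by induction on \<open>F\<close>. It is only asserted to exist and is described through
  \<open>\<psi>\<close>.\<close>

lemma D_lincomb:
  assumes c: "local_coordinates I \<A> c" and Q: "open Q" "Q \<subseteq> (- {0}) \<times> fst c" "Q \<subseteq> W"
    and triv: "(W, \<psi>) \<in> trivs H"
    and e: "\<And>a. holo_section I \<A> H Q (e a)" and f: "\<And>a. holo_fun I \<A> Q (f a)" and F: "finite F"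
  shows "\<exists>s. holo_section I \<A> H Q s \<and> (\<forall>q\<in>Q. \<psi> (s q) = (\<Sum>a\<in>F. f a q *s \<psi> (e a q)) \<and>
    \<psi> (D c None s q) = (\<Sum>a\<in>F. partial c None (f a) q *s \<psi> (e a q) + f a q *s \<psi> (D c None (e a) q)))"
proof -
  have dir: "None \<in> directions I" by (simp add: directions_def)
  have De: "holo_section I \<A> H Q (D c None (e a))" for a
    by (rule holomorphic[OF c dir Q(1,2) e])
  have scale: "\<psi> (D c None (\<lambda>q. fibre_scale H (f q) (e a q)) q) =
      partial c None f q *s \<psi> (e a q) + f q *s \<psi> (D c None (e a) q)"
    if f: "holo_fun I \<A> Q f" and q: "q \<in> Q" for f a q
  proof -
    have p: "proj H (e a q) = q" "proj H (D c None (e a) q) = q"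
      using holo_sectionD(1)[OF e q] holo_sectionD(1)[OF De q] by auto
    have "q \<in> W" using q Q(3) by blast
    then show ?thesis
      unfolding leibniz[OF c dir Q(1,2) e f q]
      by (simp add: p triv_fibre_add[OF _ triv] triv_fibre_scale[OF triv] proj_fibre_scale)
  qed
  show ?thesis
    using F
  proof (induction F rule: finite_induct)
    case empty
    \<comment> \<open>The zero section is obtained as 0 times an arbitrary frame vector. Its
      derivative vanishes by the Leibniz rule, as the coefficient is the constant 0.\<close>
    let ?s = "\<lambda>q. fibre_scale H 0 (e undefined q)"
    have "\<psi> (?s q) = 0" if "q \<in> Q" for q
      using triv_fibre_scale[OF triv, of "e undefined q" 0] holo_sectionD(1)[OF e that] that Q(3) by auto
    moreover have "\<psi> (D c None ?s q) = 0" if "q \<in> Q" for q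
      using scale[OF holo_fun_const that, of 0 undefined] by (cases q) (simp add: partial_def)
    ultimately show ?case
      by (intro exI[of _ ?s]) (simp add: holo_section_scale holo_fun_const e)
  next
    case (insert b F)
    then obtain s where s: "holo_section I \<A> H Q s"
      "\<And>q. q \<in> Q \<Longrightarrow> \<psi> (s q) = (\<Sum>a\<in>F. f a q *s \<psi> (e a q))"
      "\<And>q. q \<in> Q \<Longrightarrow> \<psi> (D c None s q) =
        (\<Sum>a\<in>F. partial c None (f a) q *s \<psi> (e a q) + f a q *s \<psi> (D c None (e a) q))"
      by blast
    let ?t = "\<lambda>q. fibre_scale H (f b q) (e b q)"
    let ?s = "\<lambda>q. fibre_add H (?t q) (s q)"
    have t: "holo_section I \<A> H Q ?t" by (intro holo_section_scale f e)
    have Ds: "holo_section I \<A> H Q (D c None s)" "holo_section I \<A> H Q (D c None ?t)"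
      using holomorphic[OF c dir Q(1,2)] s(1) t by blast+
    have "\<psi> (?s q) = (\<Sum>a\<in>insert b F. f a q *s \<psi> (e a q))" if q: "q \<in> Q" for q
      using q Q(3) insert.hyps s(2)[OF q] holo_sectionD(1)[OF e q] holo_sectionD(1)[OF s(1) q]
      by (subst triv_fibre_add[OF _ triv]) (auto simp: proj_fibre_scale triv_fibre_scale[OF triv])
    moreover have "\<psi> (D c None ?s q) =
        (\<Sum>a\<in>insert b F. partial c None (f a) q *s \<psi> (e a q) + f a q *s \<psi> (D c None (e a) q))"
      if q: "q \<in> Q" for q
      unfolding additive[OF c dir Q(1,2) t s(1) q]
      using q Q(3) insert.hyps s(3)[OF q] holo_sectionD(1)[OF Ds(1) q] holo_sectionD(1)[OF Ds(2) q]
      by (subst triv_fibre_add[OF _ triv]) (auto simp: scale[OF f q])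
    ultimately show ?case
      using holo_section_add[OF t s(1)] by (intro exI[of _ ?s]) blast
  qed
qed

text \<open>In a trivialisation the connection is \<open>\<partial>\<^sub>z\<close> plus a matrix
  whose columns are the derivatives of the unit frame. The section equals its expansion in that
  frame on \<open>Q\<close>, and \<open>locality\<close> transfers the derivative.\<close>

lemma D_in_triv:
  assumes c: "local_coordinates I \<A> c" and Q: "open Q" "Q \<subseteq> (- {0}) \<times> fst c" "Q \<subseteq> W"
    and triv: "(W, \<psi>) \<in> trivs H"
    and e: "\<And>a. holo_section I \<A> H W (e a)" "\<And>a p. p \<in> W \<Longrightarrow> \<psi> (e a p) = axis a 1"
    and s: "holo_section I \<A> H Q s" and p: "p \<in> Q"
  shows "\<psi> (D c None s p) $ a = partial c None (\<lambda>q. \<psi> (s q) $ a) p +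
    (\<Sum>b\<in>UNIV. \<psi> (D c None (e b) p) $ a * \<psi> (s p) $ b)"
proof -
  have dir: "None \<in> directions I" by (simp add: directions_def)
  have QW: "Q \<inter> W = Q" using Q(3) by blast
  have f: "holo_fun I \<A> Q (\<lambda>q. \<psi> (s q) $ a)" for a
    using holo_sectionD(2)[OF s triv] by (simp add: QW)
  obtain s' where s': "holo_section I \<A> H Q s'"
      "\<And>q. q \<in> Q \<Longrightarrow> \<psi> (s' q) = (\<Sum>a\<in>UNIV. \<psi> (s q) $ a *s \<psi> (e a q))"
      "\<And>q. q \<in> Q \<Longrightarrow> \<psi> (D c None s' q) =
        (\<Sum>a\<in>UNIV. partial c None (\<lambda>q. \<psi> (s q) $ a) q *s \<psi> (e a q) + \<psi> (s q) $ a *s \<psi> (D c None (e a) q))"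
    using D_lincomb[of c Q W \<psi> e "\<lambda>a q. \<psi> (s q) $ a" UNIV, OF c Q triv holo_section_subset[OF e(1) Q(3)] f finite[of UNIV]]
    by blast
  have "s q = s' q" if q: "q \<in> Q" for q
  proof (rule fibre_eqI[OF triv])
    show "proj H (s q) \<in> W" "proj H (s q) = proj H (s' q)"
      using holo_sectionD(1)[OF s q] holo_sectionD(1)[OF s'(1) q] q Q(3) by auto
    show "\<psi> (s q) = \<psi> (s' q)"
      using s'(2)[OF q] e(2)[OF subsetD[OF Q(3) q]] by (simp add: basis_expansion)
  qed
  then have "D c None s p = D c None s' p"
    using locality[OF c dir Q(1,2) s s'(1) _ p] by blast
  then show ?thesis
    using s'(3)[OF p] e(2)[OF subsetD[OF Q(3) p]]
    by (simp add: sum.distrib axis_def mult.commute if_distrib cong: if_cong)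
qed

end

section \<open>Independence of regularity from the basis\<close>

lemma holo_fun_slice_analytic:
  assumes ch: "\<forall>c\<in>\<A>. is_chart I c" "(\<Union>c\<in>\<A>. fst c) = UNIV"
    and f: "holo_fun I \<A> W f" and W: "open W" "(0, m) \<in> W"
  shows "(\<lambda>z. f (z, m)) analytic_on {0}"
proof -
  obtain c where c: "c \<in> \<A>" "m \<in> fst c" using ch(2) by blast
  have "(\<lambda>z. (\<lambda>(z, x). f (z, chart_inv c x)) (z, snd c m)) holomorphic_on {z. (z, m) \<in> W}"
  proof (rule holo_z_on_slice)
    show "holo_z_on I (in_coords c W) (\<lambda>(z, x). f (z, chart_inv c x))"
      using f c(1) by (simp add: holo_fun_def)
    show "(z, snd c m) \<in> in_coords c W" if "z \<in> {z. (z, m) \<in> W}" for z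
      using that c(2) by (force simp: in_coords_def)
  qed (rule open_slice[OF W(1)])
  then have "(\<lambda>z. f (z, m)) holomorphic_on {z. (z, m) \<in> W}"
    using is_chart_inv[OF ch(1)[rule_format, OF c(1)] c(2)] by simp
  then show ?thesis
    using open_slice[OF W(1), of m] W(2) by (auto simp: analytic_at)
qed

lemma TE_basis_slice_analytic:
  assumes "TE_basis I \<A> H D t\<^sub>0 c W v A B"
  shows "(\<lambda>z. B (z, snd c t\<^sub>0) $ a $ b) analytic_on {0}"
proof -
  have W: "open W" "(0, t\<^sub>0) \<in> W" "W \<subseteq> UNIV \<times> fst c"
    and B: "holo_z_on I (in_coords c W) (\<lambda>p. B p $ a $ b)"
    using assms unfolding TE_basis_def local_frame_def by auto
  have "(\<lambda>z. B (z, snd c t\<^sub>0) $ a $ b) holomorphic_on {z. (z, t\<^sub>0) \<in> W}"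
    by (rule holo_z_on_slice[OF B open_slice[OF W(1)]]) (use W in \<open>force simp: in_coords_def\<close>)
  then show ?thesis
    using open_slice[OF W(1), of t\<^sub>0] W(2) by (auto simp: analytic_at)
qed

text \<open>The frame witnessing regularity and the given one are compared in a common
  trivialisation near \<open>(0, t\<^sub>0)\<close>. Both satisfy an equation with the same matrix
  \<open>\<Gamma>\<close>, because the derivative along \<open>z\<close> does not depend on the
  coordinates on the manifold.\<close>

proposition (in TE_structure) regular_singular_basis_independent:
  assumes basis: "TE_basis I \<A> H D t\<^sub>0 c W v A B" and reg: "regular_singular_at I \<A> H D t\<^sub>0"
  shows "fuchsian_equivalent (taylor_z (\<lambda>z. B (z, snd c t\<^sub>0)))"
proof -
  obtain c' W' v' A' B' where basis': "TE_basis I \<A> H D t\<^sub>0 c' W' v' A' B'"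
    and reg': "regular_singular_system (\<lambda>z. B' (z, snd c' t\<^sub>0))"
    using reg unfolding regular_singular_at_def by blast
  obtain U \<psi> where U: "(U, \<psi>) \<in> trivs H" "(0, t\<^sub>0) \<in> U" by (rule triv_exists)
  obtain e where e: "\<And>a. holo_section I \<A> H U (e a)" "\<And>a p. p \<in> U \<Longrightarrow> \<psi> (e a p) = axis a 1"
    using triv_frame[OF U(1)] by blast
  define \<Gamma> where "\<Gamma> z = (\<chi> a b. \<psi> (D c None (e b) (z, t\<^sub>0)) $ a)" for z
  have man: "\<forall>c\<in>\<A>. is_chart I c" "(\<Union>c\<in>\<A>. fst c) = UNIV"
    using manifold by (simp_all add: complex_manifold_def)
  note c = basis[unfolded TE_basis_def, THEN conjunct1] and c' = basis'[unfolded TE_basis_def, THEN conjunct1]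
  have chart_open: "open (fst c)" if "local_coordinates I \<A> c" for c
    using that by (simp add: local_coordinates_def is_chart_def)
  have W: "open W" "(0, t\<^sub>0) \<in> W" "W \<subseteq> UNIV \<times> fst c" and W': "open W'" "(0, t\<^sub>0) \<in> W'" "W' \<subseteq> UNIV \<times> fst c'"
    using basis basis' unfolding TE_basis_def local_frame_def by auto
  \<comment> \<open>The axioms for \<open>D\<close> hold only off \<open>z = 0\<close> and inside a
    chart domain; \<open>Q\<close> meets these conditions for both charts, frames and the
    trivialisation at once.\<close>
  define Q where "Q = W \<inter> W' \<inter> U \<inter> ((- {0}) \<times> (fst c \<inter> fst c'))"
  have Q: "open Q" "Q \<subseteq> (- {0}) \<times> fst c" "Q \<subseteq> U" "Q \<subseteq> (- {0}) \<times> (fst c \<inter> fst c')"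
    unfolding Q_def using W(1) W'(1) triv_open[OF U(1)] chart_open[OF c] chart_open[OF c']
    by (auto intro!: open_Int open_Times)
  have ev: "\<forall>\<^sub>F z in at 0. (z, t\<^sub>0) \<in> Q"
  proof -
    have "open {z. (z, t\<^sub>0) \<in> W \<inter> W' \<inter> U}"
      using W(1) W'(1) triv_open[OF U(1)] by (intro open_slice open_Int)
    then have "\<forall>\<^sub>F z in at 0. z \<in> {z. (z, t\<^sub>0) \<in> W \<inter> W' \<inter> U} - {0}"
      using W(2) W'(2) U(2) by (intro eventually_at_in_open) auto
    then show ?thesis
      by eventually_elim (use W W' in \<open>auto simp: Q_def\<close>)
  qed
  have frame: "(\<forall>a b. (\<lambda>z. (\<chi> a j. \<psi> (v j (z, t\<^sub>0)) $ a) $ a $ b) analytic_on {0}) \<and>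
      (\<forall>z. (z, t\<^sub>0) \<in> W \<inter> U \<longrightarrow> invertible (\<chi> a j. \<psi> (v j (z, t\<^sub>0)) $ a))"
    if "TE_basis I \<A> H D t\<^sub>0 c W v A B" for c W v A B
  proof (intro conjI allI impI)
    have W: "open W" "(0, t\<^sub>0) \<in> W" and v: "local_frame I \<A> H W v"
      using that unfolding TE_basis_def local_frame_def by auto
    fix z show "invertible (\<chi> a j. \<psi> (v j (z, t\<^sub>0)) $ a)" if "(z, t\<^sub>0) \<in> W \<inter> U"
      using v U(1) that unfolding local_frame_def by blast
    fix a b
    have "holo_fun I \<A> (W \<inter> U) (\<lambda>p. \<psi> (v b p) $ a)"
      using v U(1) holo_sectionD(2) unfolding local_frame_def by blast
    then have "(\<lambda>z. \<psi> (v b (z, t\<^sub>0)) $ a) analytic_on {0}"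
      by (rule holo_fun_slice_analytic[OF man]) (use W U triv_open in auto)
    then show "(\<lambda>z. (\<chi> a j. \<psi> (v j (z, t\<^sub>0)) $ a) $ a $ b) analytic_on {0}" by simp
  qed
  \<comment> \<open>\<open>\<Gamma>\<close> is fixed through the chart \<open>c\<close>, while
    \<open>c1\<close> is arbitrary; the last hypothesis bridges the two. It is trivial for
    \<open>c\<close> and is \<open>change_z\<close> for \<open>c'\<close>.\<close>
  have conn: "(\<chi> a j. \<psi> (v j (z, t\<^sub>0)) $ a) ** B (z, snd c1 t\<^sub>0) =
      z\<^sup>2 *k ((\<chi> a b. deriv (\<lambda>w. (\<chi> a j. \<psi> (v j (w, t\<^sub>0)) $ a) $ a $ b) z) + \<Gamma> z ** (\<chi> a j. \<psi> (v j (z, t\<^sub>0)) $ a))"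
    if basis: "TE_basis I \<A> H D t\<^sub>0 c1 W1 v A B" and QW: "Q \<subseteq> W1" and q: "(z, t\<^sub>0) \<in> Q"
      and eq: "\<And>j. D c1 None (v j) (z, t\<^sub>0) = D c None (v j) (z, t\<^sub>0)" for c1 W1 v A B z
  proof -
    have v: "holo_section I \<A> H W1 (v j)" for j
      using basis unfolding TE_basis_def local_frame_def by blast
    have z: "z \<noteq> 0" "(z, t\<^sub>0) \<in> W1" "(z, t\<^sub>0) \<in> U" using q Q(2,3) QW by auto
    have "((\<chi> a j. \<psi> (v j (z, t\<^sub>0)) $ a) ** B (z, snd c1 t\<^sub>0)) $ a $ j =
        z\<^sup>2 * (deriv (\<lambda>w. \<psi> (v j (w, t\<^sub>0)) $ a) z + (\<Gamma> z ** (\<chi> a j. \<psi> (v j (z, t\<^sub>0)) $ a)) $ a $ j)" for a j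
    proof -
      have "D c1 None (v j) (z, t\<^sub>0) = lincomb H (z, t\<^sub>0) UNIV (\<lambda>k. B (z, snd c1 t\<^sub>0) $ k $ j / z\<^sup>2) (\<lambda>k. v k (z, t\<^sub>0))"
        using basis z unfolding TE_basis_def by blast
      then have "\<psi> (D c None (v j) (z, t\<^sub>0)) = (\<Sum>k\<in>UNIV. (B (z, snd c1 t\<^sub>0) $ k $ j / z\<^sup>2) *s \<psi> (v k (z, t\<^sub>0)))"
        using triv_lincomb[of UNIV "\<lambda>k. v k (z, t\<^sub>0)", OF holo_sectionD(1)[OF v z(2)] U(1) z(3)] by (simp add: eq)
      then have "\<psi> (D c None (v j) (z, t\<^sub>0)) $ a = (\<Sum>k\<in>UNIV. B (z, snd c1 t\<^sub>0) $ k $ j / z\<^sup>2 * \<psi> (v k (z, t\<^sub>0)) $ a)"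
        by simp
      then have "z\<^sup>2 * \<psi> (D c None (v j) (z, t\<^sub>0)) $ a = (\<Sum>k\<in>UNIV. \<psi> (v k (z, t\<^sub>0)) $ a * B (z, snd c1 t\<^sub>0) $ k $ j)"
        using z(1) by (simp add: sum_distrib_left mult.commute)
      moreover have "\<psi> (D c None (v j) (z, t\<^sub>0)) $ a = deriv (\<lambda>w. \<psi> (v j (w, t\<^sub>0)) $ a) z +
          (\<Sum>b\<in>UNIV. \<psi> (D c None (e b) (z, t\<^sub>0)) $ a * \<psi> (v j (z, t\<^sub>0)) $ b)"
        using D_in_triv[OF c Q(1-3) U(1) e holo_section_subset[OF v QW] q] by (simp add: partial_def)
      ultimately show ?thesis by (simp add: matrix_mult_nth \<Gamma>_def)
    qed
    then show ?thesis by (simp add: vec_eq_iff)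
  qed
  show ?thesis
  proof (rule fuchsian_equivalent_frame_change)
    show "\<And>a b. (\<lambda>z. B (z, snd c t\<^sub>0) $ a $ b) analytic_on {0}" "\<And>a b. (\<lambda>z. B' (z, snd c' t\<^sub>0) $ a $ b) analytic_on {0}"
      using TE_basis_slice_analytic[OF basis] TE_basis_slice_analytic[OF basis'] by blast+
    show "\<And>a b. (\<lambda>z. (\<chi> a j. \<psi> (v j (z, t\<^sub>0)) $ a) $ a $ b) analytic_on {0}"
      "\<And>a b. (\<lambda>z. (\<chi> a j. \<psi> (v' j (z, t\<^sub>0)) $ a) $ a $ b) analytic_on {0}"
      using frame[OF basis] frame[OF basis'] by blast+
    show "invertible (\<chi> a j. \<psi> (v j (0, t\<^sub>0)) $ a)"
      using frame[OF basis] W(2) U(2) by blast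
    show "\<forall>\<^sub>F z in at 0. invertible (\<chi> a j. \<psi> (v' j (z, t\<^sub>0)) $ a)"
      using ev by eventually_elim (use frame[OF basis'] in \<open>auto simp: Q_def\<close>)
    show "\<forall>\<^sub>F z in at 0. (\<chi> a j. \<psi> (v j (z, t\<^sub>0)) $ a) ** B (z, snd c t\<^sub>0) =
        z\<^sup>2 *k ((\<chi> a b. deriv (\<lambda>w. (\<chi> a j. \<psi> (v j (w, t\<^sub>0)) $ a) $ a $ b) z) + \<Gamma> z ** (\<chi> a j. \<psi> (v j (z, t\<^sub>0)) $ a))"
      using ev by eventually_elim (rule conn[OF basis], auto simp: Q_def)
    show "\<forall>\<^sub>F z in at 0. (\<chi> a j. \<psi> (v' j (z, t\<^sub>0)) $ a) ** B' (z, snd c' t\<^sub>0) =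
        z\<^sup>2 *k ((\<chi> a b. deriv (\<lambda>w. (\<chi> a j. \<psi> (v' j (w, t\<^sub>0)) $ a) $ a $ b) z) + \<Gamma> z ** (\<chi> a j. \<psi> (v' j (z, t\<^sub>0)) $ a))"
      using ev
    proof eventually_elim
      case (elim z)
      have QW: "Q \<subseteq> W'" by (auto simp: Q_def)
      have "holo_section I \<A> H W' (v' j)" for j
        using basis' unfolding TE_basis_def local_frame_def by blast
      then have "D c' None (v' j) (z, t\<^sub>0) = D c None (v' j) (z, t\<^sub>0)" for j
        using change_z[OF c c' Q(1,4) holo_section_subset[OF _ QW] elim] by blast
      then show ?case by (rule conn[OF basis' QW elim])
    qed
    show "fuchsian_equivalent (taylor_z (\<lambda>z. B' (z, snd c' t\<^sub>0)))"
      by (rule regular_singular_system_imp_fuchsian_equivalent[OF TE_basis_slice_analytic[OF basis'] reg'])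
  qed
qed

section \<open>Propagation along complex lines\<close>

text \<open>With the ansatz \<open>\<alpha> ^ n * b ^ k\<close>, both geometric sums are at most 2
  since the ratios \<open>a / \<alpha>\<close> and \<open>d / b\<close> are at most one half. The
  shift to \<open>Suc k\<close> costs one factor \<open>b\<close>, so a step costs
  \<open>4 * K * b\<close>, which \<open>\<alpha>\<close> dominates. The factor \<open>Suc n\<close>
  is estimated from below by 1.\<close>

lemma double_majorant:
  fixes u :: "nat \<Rightarrow> nat \<Rightarrow> real"
  assumes u0: "\<And>n k. u n k \<ge> 0" and base: "\<And>k. u 0 k \<le> C * b ^ k"
    and pos: "C \<ge> 0" "K \<ge> 0" "a > 0" "d > 0"
    and b: "b \<ge> 2 * d" and \<alpha>: "\<alpha> \<ge> 2 * a" "\<alpha> \<ge> 4 * K * b"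
    and rec: "\<And>n k. real (Suc n) * u (Suc n) k \<le>
      (\<Sum>j\<le>n. \<Sum>l\<le>Suc k. K * a ^ j * d ^ l * u (n - j) (Suc k - l))"
  shows "u n k \<le> C * \<alpha> ^ n * b ^ k"
proof (induction n arbitrary: k rule: less_induct)
  case (less n)
  have b0: "b > 0" and \<alpha>0: "\<alpha> > 0" using b \<alpha>(1) pos by auto
  show ?case
  proof (cases n)
    case 0
    then show ?thesis using base by simp
  next
    case (Suc m)
    have "u n k \<le> real (Suc m) * u (Suc m) k"
      using mult_right_mono[of 1 "real (Suc m)" "u n k"] u0[of n k] by (simp add: Suc)
    also have "\<dots> \<le> (\<Sum>j\<le>m. \<Sum>l\<le>Suc k. K * a ^ j * d ^ l * u (m - j) (Suc k - l))"
      by (rule rec)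
    also have "\<dots> \<le> (\<Sum>j\<le>m. \<Sum>l\<le>Suc k. K * a ^ j * d ^ l * (C * \<alpha> ^ (m - j) * b ^ (Suc k - l)))"
      using pos less.IH by (intro sum_mono mult_left_mono) (auto simp: Suc)
    also have "\<dots> = (\<Sum>j\<le>m. \<Sum>l\<le>Suc k. (K * C * \<alpha> ^ m * b ^ Suc k) * ((a / \<alpha>) ^ j * (d / b) ^ l))"
    proof (intro sum.cong refl)
      fix j l assume "j \<in> {..m}" "l \<in> {..Suc k}"
      then have "\<alpha> ^ m = \<alpha> ^ j * \<alpha> ^ (m - j)" "b ^ Suc k = b ^ l * b ^ (Suc k - l)"
        by (simp_all only: atMost_iff flip: power_add) simp_all
      then show "K * a ^ j * d ^ l * (C * \<alpha> ^ (m - j) * b ^ (Suc k - l)) =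
          (K * C * \<alpha> ^ m * b ^ Suc k) * ((a / \<alpha>) ^ j * (d / b) ^ l)"
        using b0 \<alpha>0 by (simp add: power_divide field_simps del: power_Suc)
    qed
    also have "\<dots> = (K * C * \<alpha> ^ m * b ^ Suc k) * ((\<Sum>j\<le>m. (a / \<alpha>) ^ j) * (\<Sum>l\<le>Suc k. (d / b) ^ l))"
      by (subst sum_product) (simp only: sum_distrib_left)
    also have "\<dots> \<le> (K * C * \<alpha> ^ m * b ^ Suc k) * (2 * 2)"
    proof (intro mult_left_mono mult_mono geometric_sum_le)
      show "0 \<le> (\<Sum>l\<le>Suc k. (d / b) ^ l)" using b0 pos by (intro sum_nonneg) simp
    qed (use pos b0 \<alpha>0 b \<alpha> in \<open>simp_all add: field_simps\<close>)
    also have "\<dots> = (4 * K * b) * (C * \<alpha> ^ m * b ^ k)" by simp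
    also have "\<dots> \<le> \<alpha> * (C * \<alpha> ^ m * b ^ k)"
      using \<alpha>(2) pos b0 \<alpha>0 by (intro mult_right_mono) auto
    finally show ?thesis by (simp add: Suc mult_ac)
  qed
qed

text \<open>Cauchy's inequality on the circle of radius \<open>r / 2\<close>: the function is
  controlled only on an open ball, and half the radius gives a closed disc inside it.\<close>

lemma fps_expansion_bound:
  assumes f: "f holomorphic_on ball 0 r" and r: "r > 0" and B: "\<And>z. z \<in> ball 0 r \<Longrightarrow> norm (f z) \<le> B"
  shows "norm (fps_nth (fps_expansion f 0) n) \<le> B * (2 / r) ^ n"
proof -
  have "norm ((deriv ^^ n) f 0) \<le> fact n * B / (r / 2) ^ n"
  proof (rule Cauchy_inequality)
    show "f holomorphic_on ball 0 (r / 2)" using f by (rule holomorphic_on_subset) (use r in auto)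
    show "continuous_on (cball 0 (r / 2)) f"
      using holomorphic_on_imp_continuous_on[OF f] by (rule continuous_on_subset) (use r in auto)
    show "norm (f x) \<le> B" if "norm (0 - x) = r / 2" for x
      using B[of x] that r by auto
  qed (use r in auto)
  then have "norm ((deriv ^^ n) f 0) / fact n \<le> B / (r / 2) ^ n"
    by (simp add: divide_le_eq mult.commute)
  moreover have "norm (fps_nth (fps_expansion f 0) n) = norm ((deriv ^^ n) f 0) / fact n"
    by (simp add: fps_expansion_def norm_divide)
  ultimately show ?thesis by (simp add: power_divide)
qed

lemma fps_expansion_sums:
  assumes f: "f holomorphic_on ball 0 r" and z: "z \<in> ball 0 r"
  shows "(\<lambda>n. fps_nth (fps_expansion f 0) n * z ^ n) sums f z"
  using holomorphic_power_series[OF f z] by (simp add: fps_expansion_def)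

text \<open>
  The Taylor coefficients in \<open>s\<close> of \<open>f\<close> satisfy a recursion in which the division by \<open>z\<close> only shifts the
  index \<open>k\<close>, so a bound on \<open>f\<close> at \<open>s = 0\<close> propagates to a bound on a disc whose radius does not depend on \<open>k\<close>.
\<close>

lemma singular_ode_bound:
  fixes f :: "'i::finite \<Rightarrow> nat \<Rightarrow> complex \<Rightarrow> complex" and M :: "'i \<Rightarrow> 'i \<Rightarrow> nat \<Rightarrow> complex \<Rightarrow> complex"
  assumes r: "r > 0" and f: "\<And>i k. f i k holomorphic_on ball 0 r"
    and M: "\<And>i j l. M i j l holomorphic_on ball 0 r"
    and ode: "\<And>i k s. s \<in> ball 0 r \<Longrightarrow>
      deriv (f i k) s = (\<Sum>j\<in>UNIV. \<Sum>l\<le>Suc k. M i j l s * f j (Suc k - l) s)"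
    and Mb: "\<And>i j l s. s \<in> ball 0 r \<Longrightarrow> norm (M i j l s) \<le> K * d ^ l"
    and pos: "K \<ge> 0" "d > 0" "C \<ge> 0"
    and base: "\<And>k. (\<Sum>i\<in>UNIV. norm (f i k 0)) \<le> C * b ^ k" and b: "b \<ge> 2 * d"
    and \<alpha>: "\<alpha> \<ge> 4 / r" "\<alpha> \<ge> 4 * (real CARD('i) * K) * b"
    and s: "norm s \<le> 1 / (2 * \<alpha>)"
  shows "norm (f i k s) \<le> 2 * C * b ^ k"
proof -
  define F where "F i k = fps_expansion (f i k) 0" for i k
  define u where "u n k = (\<Sum>i\<in>UNIV. norm (fps_nth (F i k) n))" for n k
  have ana: "g analytic_on {0}" if "g holomorphic_on ball 0 r" for g :: "complex \<Rightarrow> complex"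
    using that r by (auto simp: analytic_at intro!: exI[of _ "ball 0 r"])
  have F: "f i k has_fps_expansion F i k" for i k
    unfolding F_def by (intro analytic_at_imp_has_fps_expansion_0 ana f)
  have Mx: "M i j l has_fps_expansion fps_expansion (M i j l) 0" for i j l
    by (intro analytic_at_imp_has_fps_expansion_0 ana M)
  have Feq: "fps_deriv (F i k) = (\<Sum>j\<in>UNIV. \<Sum>l\<le>Suc k. fps_expansion (M i j l) 0 * F j (Suc k - l))" for i k
  proof (rule fps_expansion_unique_complex)
    show "deriv (f i k) has_fps_expansion fps_deriv (F i k)"
      by (intro has_fps_expansion_deriv F)
    have "(\<lambda>s. \<Sum>j\<in>UNIV. \<Sum>l\<le>Suc k. M i j l s * f j (Suc k - l) s) has_fps_expansion
        (\<Sum>j\<in>UNIV. \<Sum>l\<le>Suc k. fps_expansion (M i j l) 0 * F j (Suc k - l))"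
      by (intro has_fps_expansion_sum has_fps_expansion_mult F Mx)
    moreover have "\<forall>\<^sub>F s in nhds 0. (\<Sum>j\<in>UNIV. \<Sum>l\<le>Suc k. M i j l s * f j (Suc k - l) s) = deriv (f i k) s"
      using eventually_nhds_in_open[of "ball 0 r" 0] r by (auto elim!: eventually_mono simp: ode)
    ultimately show "deriv (f i k) has_fps_expansion
        (\<Sum>j\<in>UNIV. \<Sum>l\<le>Suc k. fps_expansion (M i j l) 0 * F j (Suc k - l))"
      by (simp only: has_fps_expansion_cong[OF _ refl])
  qed
  have le: "real (Suc n) * norm (fps_nth (F i k) (Suc n)) \<le>
      (\<Sum>j\<le>n. \<Sum>l\<le>Suc k. K * (2 / r) ^ j * d ^ l * u (n - j) (Suc k - l))" for i n k
  proof -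
    have "of_nat (Suc n) * fps_nth (F i k) (Suc n) = fps_nth (fps_deriv (F i k)) n" by simp
    also have "\<dots> = (\<Sum>q\<in>UNIV. \<Sum>l\<le>Suc k. \<Sum>j\<le>n. fps_nth (fps_expansion (M i q l) 0) j * fps_nth (F q (Suc k - l)) (n - j))"
      by (simp only: Feq fps_sum_nth fps_mult_nth atLeast0AtMost)
    finally have "real (Suc n) * norm (fps_nth (F i k) (Suc n)) =
        norm (\<Sum>q\<in>UNIV. \<Sum>l\<le>Suc k. \<Sum>j\<le>n. fps_nth (fps_expansion (M i q l) 0) j * fps_nth (F q (Suc k - l)) (n - j))"
      by (metis norm_mult norm_of_nat)
    also have "\<dots> \<le> (\<Sum>q\<in>UNIV. \<Sum>l\<le>Suc k. \<Sum>j\<le>n. (K * d ^ l * (2 / r) ^ j) * norm (fps_nth (F q (Suc k - l)) (n - j)))"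
      by (intro sum_norm_le)
         (auto simp: norm_mult intro!: mult_right_mono fps_expansion_bound[OF M r] Mb simp del: sum.atMost_Suc)
    also have "\<dots> = (\<Sum>l\<le>Suc k. \<Sum>q\<in>UNIV. \<Sum>j\<le>n. (K * d ^ l * (2 / r) ^ j) * norm (fps_nth (F q (Suc k - l)) (n - j)))"
      by (rule sum.swap)
    also have "\<dots> = (\<Sum>l\<le>Suc k. \<Sum>j\<le>n. \<Sum>q\<in>UNIV. (K * d ^ l * (2 / r) ^ j) * norm (fps_nth (F q (Suc k - l)) (n - j)))"
      by (intro sum.cong refl sum.swap)
    also have "\<dots> = (\<Sum>j\<le>n. \<Sum>l\<le>Suc k. \<Sum>q\<in>UNIV. (K * d ^ l * (2 / r) ^ j) * norm (fps_nth (F q (Suc k - l)) (n - j)))"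
      by (rule sum.swap)
    also have "\<dots> = (\<Sum>j\<le>n. \<Sum>l\<le>Suc k. K * (2 / r) ^ j * d ^ l * u (n - j) (Suc k - l))"
      unfolding u_def sum_distrib_left by (simp only: mult_ac)
    finally show ?thesis .
  qed
  have "u n k \<le> C * \<alpha> ^ n * b ^ k" for n k
  \<comment> \<open>The rate \<open>2 / r\<close> in \<open>n\<close> is Cauchy's bound for the
    Taylor coefficients of \<open>M\<close>; summing over the components contributes
    \<open>CARD('i)\<close>.\<close>
  proof (rule double_majorant)
    show "u n k \<ge> 0" for n k unfolding u_def by (intro sum_nonneg) auto
    show "u 0 k \<le> C * b ^ k" for k
      using base[of k] by (simp add: u_def F_def fps_expansion_def)
    show "0 \<le> real CARD('i) * K" using pos by simp
    show "2 / r > 0" using r by simp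
    show "2 * (2 / r) \<le> \<alpha>" using \<alpha> by simp
    fix n k
    have "real (Suc n) * u (Suc n) k = (\<Sum>i\<in>UNIV. real (Suc n) * norm (fps_nth (F i k) (Suc n)))"
      by (simp only: u_def sum_distrib_left)
    also have "\<dots> \<le> (\<Sum>i\<in>(UNIV :: 'i set). \<Sum>j\<le>n. \<Sum>l\<le>Suc k. K * (2 / r) ^ j * d ^ l * u (n - j) (Suc k - l))"
      by (intro sum_mono le)
    also have "\<dots> = (\<Sum>j\<le>n. \<Sum>l\<le>Suc k. real CARD('i) * K * (2 / r) ^ j * d ^ l * u (n - j) (Suc k - l))"
      by (simp only: sum_constant sum_distrib_left mult.assoc)
    finally show "real (Suc n) * u (Suc n) k \<le> \<dots>" .
  qed (use pos b \<alpha> in auto)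
  moreover have "norm (fps_nth (F i k) n) \<le> u n k" for n
    unfolding u_def by (rule member_le_sum) auto
  ultimately have Fb: "norm (fps_nth (F i k) n) \<le> C * \<alpha> ^ n * b ^ k" for n
    using order_trans by blast
  have "4 / r > 0" using r by simp
  then have \<alpha>0: "\<alpha> > 0" using \<alpha>(1) by linarith
  have "1 / (2 * \<alpha>) < r"
  proof -
    have "\<alpha> * r \<ge> 4" using \<alpha>(1) r by (simp add: field_simps)
    then show ?thesis using \<alpha>0 by (simp add: field_simps)
  qed
  then have "s \<in> ball 0 r" using s by simp
  then have sums: "(\<lambda>n. fps_nth (F i k) n * s ^ n) sums f i k s"
    unfolding F_def by (rule fps_expansion_sums[OF f])
  \<comment> \<open>The radius \<open>1 / (2 * \<alpha>)\<close> turns the growth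
    \<open>\<alpha> ^ n\<close> into powers of one half, whose sum accounts for the factor 2 in the
    conclusion.\<close>
  have summand: "norm (fps_nth (F i k) n * s ^ n) \<le> C * b ^ k * (1 / 2) ^ n" for n
  proof -
    have "norm (fps_nth (F i k) n * s ^ n) \<le> (C * \<alpha> ^ n * b ^ k) * (1 / (2 * \<alpha>)) ^ n"
      unfolding norm_mult norm_power
      using order_trans[OF norm_ge_zero Fb[of n]] power_mono[OF s norm_ge_zero]
      by (intro mult_mono[OF Fb]) simp_all
    also have "\<dots> = C * b ^ k * (1 / 2) ^ n"
      using \<alpha>0 by (simp add: power_divide power_mult_distrib)
    finally show ?thesis .
  qed
  have geo: "(\<lambda>n. C * b ^ k * (1 / 2) ^ n :: real) sums (C * b ^ k * 2)"
    using sums_mult[OF geometric_sums[of "1 / 2 :: real"]] by simp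
  have "norm (suminf (\<lambda>n. fps_nth (F i k) n * s ^ n)) \<le> suminf (\<lambda>n. C * b ^ k * (1 / 2) ^ n :: real)"
    by (rule norm_suminf_le[OF summand sums_summable[OF geo]])
  then show ?thesis
    using sums_unique[OF sums] sums_unique[OF geo] by (simp add: mult_ac)
qed

text \<open>Subtracting the lower coefficients, holomorphic by induction, and dividing by
  \<open>z ^ k\<close> at points \<open>z m\<close> tending to 0 recovers the \<open>k\<close>-th
  coefficient. The common bound \<open>K\<close> makes the limit uniform in \<open>s\<close>, so
  holomorphy survives.\<close>

lemma fps_expansion_nth_holomorphic:
  assumes r: "r > 0" and Gz: "\<And>s. s \<in> S \<Longrightarrow> (\<lambda>z. G z s) holomorphic_on ball 0 r"
    and S: "open S" and Gs: "\<And>z. z \<in> ball 0 r \<Longrightarrow> (\<lambda>s. G z s) holomorphic_on S"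
    and K: "\<And>z s. z \<in> ball 0 r \<Longrightarrow> s \<in> S \<Longrightarrow> norm (G z s) \<le> K"
  shows "(\<lambda>s. fps_nth (fps_expansion (\<lambda>z. G z s) 0) k) holomorphic_on S"
proof (induction k rule: less_induct)
  case (less k)
  define A where "A j s = fps_nth (fps_expansion (\<lambda>z. G z s) 0) j" for j s
  \<comment> \<open>The 4 is chosen against the rate \<open>2 / r\<close> of the coefficients: the
    ratio of the majorising terms becomes \<open>1 / (2 * real (Suc m))\<close>, which is at most
    one half and tends to 0.\<close>
  define z where "z m = (of_real (r / (4 * real (Suc m))) :: complex)" for m
  define g where "g m s = (G (z m) s - (\<Sum>j<k. A j s * z m ^ j)) / z m ^ k" for m s
  have z: "z m \<in> ball 0 r" "z m \<noteq> 0" "norm (z m) * (2 / r) = 1 / (2 * real (Suc m))" for m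
  proof -
    have "r / (4 * real (Suc m)) < r"
      using r by (simp add: divide_less_eq mult_less_cancel_left1)
    moreover have nz: "norm (z m) = r / (4 * real (Suc m))"
      unfolding z_def norm_of_real using r by simp
    ultimately show "z m \<in> ball 0 r" by simp
    have "norm (z m) > 0" unfolding nz using r by simp
    then show "z m \<noteq> 0" by simp
    show "norm (z m) * (2 / r) = 1 / (2 * real (Suc m))"
      unfolding nz using r by (simp add: field_simps)
  qed
  have Ab: "norm (A j s) \<le> K * (2 / r) ^ j" if "s \<in> S" for j s
    unfolding A_def by (rule fps_expansion_bound[OF Gz[OF that] r]) (use K that in auto)
  \<comment> \<open>The error is the tail from index \<open>k + 1\<close> on. It carries a leading
    factor \<open>q\<close>, and the geometric sum costs at most 2.\<close>
  have err: "norm (g m s - A k s) \<le> K * (2 / r) ^ k / real (Suc m)" if s: "s \<in> S" for m s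
  proof -
    define q where "q = 1 / (2 * real (Suc m))"
    have q: "0 < q" "q \<le> 1 / 2" by (simp_all add: q_def field_simps)
    have K0: "0 \<le> K" using K[OF z(1) s] norm_ge_zero order_trans by blast
    have "(\<lambda>n. A n s * z m ^ n) sums G (z m) s"
      unfolding A_def by (rule fps_expansion_sums[OF Gz[OF s] z(1)])
    then have "(\<lambda>n. A (n + k) s * z m ^ (n + k)) sums (G (z m) s - (\<Sum>j<k. A j s * z m ^ j))"
      by (rule sums_split_initial_segment)
    then have "(\<lambda>n. A (n + k) s * z m ^ (n + k) / z m ^ k) sums g m s"
      unfolding g_def by (rule sums_divide)
    then have "(\<lambda>n. A (n + k) s * z m ^ n) sums g m s"
      using z(2) by (simp add: power_add)
    then have "(\<lambda>n. A (n + 1 + k) s * z m ^ (n + 1)) sums (g m s - (\<Sum>n<1. A (n + k) s * z m ^ n))"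
      by (rule sums_split_initial_segment)
    then have sums: "(\<lambda>n. A (n + 1 + k) s * z m ^ (n + 1)) sums (g m s - A k s)" by simp
    have summand: "norm (A (n + 1 + k) s * z m ^ (n + 1)) \<le> K * (2 / r) ^ k * q * q ^ n" for n
    proof -
      have "norm (A (n + 1 + k) s * z m ^ (n + 1)) \<le> K * (2 / r) ^ (n + 1 + k) * norm (z m) ^ (n + 1)"
        unfolding norm_mult norm_power by (intro mult_right_mono Ab s) auto
      also have "\<dots> = K * (2 / r) ^ k * (norm (z m) * (2 / r)) ^ (n + 1)"
        by (simp only: power_add power_mult_distrib mult_ac)
      also have "\<dots> = K * (2 / r) ^ k * q * q ^ n"
        unfolding z(3) q_def by simp
      finally show ?thesis .
    qed
    have geo: "(\<lambda>n. K * (2 / r) ^ k * q * q ^ n) sums (K * (2 / r) ^ k * q * (1 / (1 - q)))"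
      using q by (intro sums_mult geometric_sums) auto
    have "norm (g m s - A k s) \<le> K * (2 / r) ^ k * q * (1 / (1 - q))"
      using norm_suminf_le[OF summand sums_summable[OF geo]] sums_unique[OF sums] sums_unique[OF geo] by simp
    also have "\<dots> \<le> K * (2 / r) ^ k * q * 2"
      using q K0 r by (intro mult_left_mono) (auto simp: field_simps)
    also have "\<dots> = K * (2 / r) ^ k * (q * 2)" by (simp only: mult.assoc)
    also have "q * 2 = 1 / real (Suc m)" by (simp add: q_def del: of_nat_Suc)
    finally show ?thesis by (simp del: of_nat_Suc)
  qed
  have "A k holomorphic_on S"
  proof (rule holomorphic_uniform_sequence[OF S])
    show "g m holomorphic_on S" for m
      unfolding g_def A_def using z(1,2) by (intro holomorphic_intros Gs less.IH) auto
    fix x assume "x \<in> S"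
    then obtain e where e: "e > 0" "cball x e \<subseteq> S" using S open_contains_cball by blast
    have "uniform_limit (cball x e) g (A k) sequentially"
    proof (rule uniform_limitI)
      fix \<epsilon> :: real assume "\<epsilon> > 0"
      have "(\<lambda>m. K * (2 / r) ^ k * inverse (real (Suc m))) \<longlonglongrightarrow> K * (2 / r) ^ k * 0"
        by (intro tendsto_mult tendsto_const LIMSEQ_inverse_real_of_nat)
      then have "\<forall>\<^sub>F m in sequentially. K * (2 / r) ^ k * inverse (real (Suc m)) < \<epsilon>"
        using \<open>\<epsilon> > 0\<close> by (intro order_tendstoD(2)) auto
      then show "\<forall>\<^sub>F m in sequentially. \<forall>s\<in>cball x e. dist (g m s) (A k s) < \<epsilon>"
      proof eventually_elim
        case (elim m)
        then show ?case
          using err[of _ m] e(2) by (auto simp: dist_norm field_simps dest!: subsetD intro: le_less_trans)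
      qed
    qed
    with e show "\<exists>d>0. cball x d \<subseteq> S \<and> uniform_limit (cball x d) g (A k) sequentially" by blast
  qed
  then show ?case unfolding A_def[abs_def] .
qed

section \<open>Holomorphic functions on coordinate space\<close>

lemma norm_vector_scalar_mult: "norm (s *s v) = norm s * norm v" for v :: "complex ^ 'n"
  by (simp add: norm_vec_def norm_mult L2_set_right_distrib)

lemma coord_space_line: "x \<in> coord_space I \<Longrightarrow> v \<in> coord_space I \<Longrightarrow> x + s *s v \<in> coord_space I"
  by (simp add: coord_space_def)

lemma axis_in_coord_space: "i \<in> I \<Longrightarrow> axis i w \<in> coord_space I"
  by (auto simp: coord_space_def axis_def)

lemma convex_coord_space: "convex (coord_space I)"
  by (auto simp: convex_def coord_space_def)

lemma closed_coord_space: "closed (coord_space (I :: 'n::finite set))"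
proof -
  have "closed (\<Inter>i\<in>-I. {x :: complex ^ 'n. x $ i = 0})"
    by (auto intro!: closed_INT closed_Collect_eq continuous_on_component continuous_on_id continuous_on_const)
  moreover have "coord_space I = (\<Inter>i\<in>-I. {x :: complex ^ 'n. x $ i = 0})"
    by (auto simp: coord_space_def)
  ultimately show ?thesis by simp
qed

lemma has_derivative_line:
  "((\<lambda>s. x + s *s v) has_derivative (\<lambda>s. s *s v)) (at s within Z)" for v :: "complex ^ 'n"
proof -
  have "bounded_linear (\<lambda>s. s *s v)"
    by (rule bounded_linear_intro[where K = "norm v"])
       (auto simp: vec_eq_iff norm_vector_scalar_mult algebra_simps)
  then have "((\<lambda>s. s *s v) has_derivative (\<lambda>s. s *s v)) (at s within Z)"
    by (rule bounded_linear_imp_has_derivative)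
  then show ?thesis by (auto intro!: derivative_eq_intros)
qed

lemma has_field_derivative_line:
  fixes f :: "complex ^ 'n \<Rightarrow> complex"
  assumes f: "(f has_derivative (\<lambda>h. \<Sum>i\<in>I. b i * h $ i)) (at (x + s *s v) within S)"
    and Z: "open Z" "s \<in> Z" "\<And>s. s \<in> Z \<Longrightarrow> x + s *s v \<in> S"
  shows "((\<lambda>s. f (x + s *s v)) has_field_derivative (\<Sum>i\<in>I. b i * v $ i)) (at s)"
proof -
  have "(f has_derivative (\<lambda>h. \<Sum>i\<in>I. b i * h $ i)) (at (x + s *s v) within (\<lambda>s. x + s *s v) ` Z)"
    using f by (rule has_derivative_subset) (use Z in auto)
  from has_derivative_in_compose[OF has_derivative_line this]
  have "((\<lambda>s. f (x + s *s v)) has_derivative (\<lambda>w. \<Sum>i\<in>I. b i * (w * v $ i))) (at s within Z)"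
    by simp
  also have "(\<lambda>w. \<Sum>i\<in>I. b i * (w * v $ i)) = (*) (\<Sum>i\<in>I. b i * v $ i)"
    by (simp add: fun_eq_iff sum_distrib_left sum_distrib_right mult_ac)
  finally show ?thesis
    unfolding has_field_derivative_def at_within_open[OF Z(2,1)] .
qed

lemma holo_z_on_line:
  assumes f: "holo_z_on I S f" and Z: "open Z" "\<And>s. s \<in> Z \<Longrightarrow> (z, x + s *s v) \<in> S"
  shows "(\<lambda>s. f (z, x + s *s v)) holomorphic_on Z"
  unfolding holomorphic_on_def
proof
  fix s assume s: "s \<in> Z"
  obtain a b where f': "(f has_derivative (\<lambda>(w, h). a * w + (\<Sum>i\<in>I. b i * h $ i))) (at (z, x + s *s v) within S)"
    using f Z(2)[OF s] unfolding holo_z_on_def by blast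
  have "((\<lambda>s. (z, x + s *s v)) has_derivative (\<lambda>s. (0, s *s v))) (at s within Z)"
    by (intro has_derivative_Pair has_derivative_const has_derivative_line)
  moreover have "(f has_derivative (\<lambda>(w, h). a * w + (\<Sum>i\<in>I. b i * h $ i)))
      (at (z, x + s *s v) within (\<lambda>s. (z, x + s *s v)) ` Z)"
    using f' by (rule has_derivative_subset) (use Z in auto)
  ultimately have "((\<lambda>s. f (z, x + s *s v)) has_derivative
      (\<lambda>s. (\<lambda>(w, h). a * w + (\<Sum>i\<in>I. b i * h $ i)) (0, s *s v))) (at s within Z)"
    by (rule has_derivative_in_compose)
  also have "(\<lambda>s. (\<lambda>(w, h). a * w + (\<Sum>i\<in>I. b i * h $ i)) (0, s *s v)) = (*) (\<Sum>i\<in>I. b i * v $ i)"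
    by (simp add: fun_eq_iff sum_distrib_left sum_distrib_right mult_ac)
  finally show "(\<lambda>s. f (z, x + s *s v)) field_differentiable at s within Z"
    unfolding field_differentiable_def has_field_derivative_def by blast
qed

lemma norm_axis: "norm (axis i w) = norm w" for w :: complex
  by (simp add: norm_vec_def L2_set_def axis_def if_distrib[of norm] if_distrib[of "\<lambda>x. x\<^sup>2"] cong: if_cong)

lemma axis_eq_scalar: "axis i w = w *s axis i 1" for w :: complex
  by (simp add: vec_eq_iff axis_def)

lemma coord_deriv_eq: "coord_deriv i f x = deriv (\<lambda>w. f (x + w *s axis i 1)) 0"
  unfolding coord_deriv_def by (subst axis_eq_scalar) (rule refl)

lemma dist_line: "dist x (x + s *s v) = norm s * norm v" for v :: "complex ^ 'n"
  by (subst dist_commute) (simp add: dist_norm norm_vector_scalar_mult)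

text \<open>A relatively open set contains a small complex disc through \<open>x\<close> in each
  direction of \<open>I\<close>, so any derivative valid within \<open>S\<close> has the partial
  derivatives as its coefficients.\<close>

lemma coord_deriv_unique:
  fixes f :: "complex ^ 'n \<Rightarrow> complex"
  assumes S: "openin (top_of_set (coord_space I)) S" "x \<in> S" and i: "i \<in> I"
    and f: "(f has_derivative (\<lambda>h. \<Sum>i\<in>I. b i * h $ i)) (at x within S)"
  shows "coord_deriv i f x = b i"
proof -
  obtain e where e: "e > 0" "ball x e \<inter> coord_space I \<subseteq> S"
    using S by (auto simp: openin_contains_ball)
  have x: "x \<in> coord_space I" using S openin_imp_subset by blast
  have line: "x + w *s axis i 1 \<in> S" if "w \<in> ball 0 e" for w
  proof -
    have "x + w *s axis i 1 \<in> ball x e"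
      using that by (simp add: dist_line norm_axis)
    then show ?thesis
      using e(2) coord_space_line[OF x axis_in_coord_space[OF i]] by blast
  qed
  have "((\<lambda>w. f (x + w *s axis i 1)) has_field_derivative (\<Sum>j\<in>I. b j * axis i 1 $ j)) (at 0)"
    by (rule has_field_derivative_line[where Z = "ball 0 e" and S = S])
      (use f e(1) line in simp_all)
  from DERIV_imp_deriv[OF this] have "coord_deriv i f x = (\<Sum>j\<in>I. b j * axis i 1 $ j)"
    unfolding coord_deriv_eq .
  also have "\<dots> = (\<Sum>j\<in>I. if j = i then b j else 0)"
    by (intro sum.cong refl) (simp add: axis_def)
  finally show ?thesis using i by simp
qed

lemma holo_on_has_derivative:
  fixes f :: "complex ^ 'n \<Rightarrow> complex"
  assumes "holo_on I S f" "openin (top_of_set (coord_space I)) S" "x \<in> S"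
  shows "(f has_derivative (\<lambda>h. \<Sum>i\<in>I. coord_deriv i f x * h $ i)) (at x within S)"
proof -
  obtain b where b: "(f has_derivative (\<lambda>h. \<Sum>i\<in>I. b i * h $ i)) (at x within S)"
    using assms(1,3) unfolding holo_on_def by blast
  have "(\<lambda>h :: complex ^ 'n. \<Sum>i\<in>I. b i * h $ i) = (\<lambda>h. \<Sum>i\<in>I. coord_deriv i f x * h $ i)"
    by (intro ext sum.cong refl) (simp add: coord_deriv_unique[OF assms(2,3) _ b])
  with b show ?thesis by simp
qed

lemma holo_on_line:
  fixes f :: "complex ^ 'n \<Rightarrow> complex"
  assumes "holo_on I S f" "openin (top_of_set (coord_space I)) S"
    and "open Z" "\<And>s. s \<in> Z \<Longrightarrow> x + s *s v \<in> S" "s \<in> Z"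
  shows "((\<lambda>s. f (x + s *s v)) has_field_derivative (\<Sum>i\<in>I. coord_deriv i f (x + s *s v) * v $ i)) (at s)"
  by (rule has_field_derivative_line[OF holo_on_has_derivative[OF assms(1,2)]]) (use assms in auto)

lemma holo_on_subset: "holo_on I S f \<Longrightarrow> S' \<subseteq> S \<Longrightarrow> holo_on I S' f"
  unfolding holo_on_def by (blast intro: has_derivative_subset)

lemma openin_ball_coord_space: "openin (top_of_set (coord_space I)) (ball x r \<inter> coord_space I)"
  by (metis inf_commute open_ball openin_open)

text \<open>Around a point of the half ball, the coordinate disc of radius \<open>r / 2\<close>
  stays in the full ball. Cauchy's bound at that radius is \<open>2 / (r / 2)\<close>, that is
  \<open>4 / r\<close>.\<close>

lemma coord_deriv_bound:
  fixes f :: "complex ^ 'n \<Rightarrow> complex"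
  assumes f: "holo_on I (ball x\<^sub>0 r \<inter> coord_space I) f" and r: "r > 0"
    and B: "\<And>x. x \<in> ball x\<^sub>0 r \<inter> coord_space I \<Longrightarrow> norm (f x) \<le> B"
    and x: "x \<in> ball x\<^sub>0 (r / 2) \<inter> coord_space I" and i: "i \<in> I"
  shows "norm (coord_deriv i f x) \<le> B * (4 / r)"
proof -
  have line: "x + w *s axis i 1 \<in> ball x\<^sub>0 r \<inter> coord_space I" if "w \<in> ball 0 (r / 2)" for w
  proof
    have "dist x\<^sub>0 (x + w *s axis i 1) \<le> dist x\<^sub>0 x + dist x (x + w *s axis i 1)"
      by (rule dist_triangle)
    then show "x + w *s axis i 1 \<in> ball x\<^sub>0 r"
      using x that by (simp add: dist_line norm_axis)
    show "x + w *s axis i 1 \<in> coord_space I"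
      using x i by (intro coord_space_line axis_in_coord_space) auto
  qed
  have "(\<lambda>w. f (x + w *s axis i 1)) holomorphic_on ball 0 (r / 2)"
  proof (rule holomorphic_onI, rule field_differentiable_at_within)
    fix w :: complex assume w: "w \<in> ball 0 (r / 2)"
    show "(\<lambda>w. f (x + w *s axis i 1)) field_differentiable at w"
      unfolding field_differentiable_def
      using holo_on_line[OF f openin_ball_coord_space open_ball line w] by (rule exI)
  qed
  from fps_expansion_bound[OF this half_gt_zero[OF r] B[OF line], of 1]
  have "norm (fps_nth (fps_expansion (\<lambda>w. f (x + w *s axis i 1)) 0) 1) \<le> B * (2 / (r / 2)) ^ 1" .
  then show ?thesis
    by (simp add: fps_expansion_def coord_deriv_eq)
qed

text \<open>Joint holomorphy by termwise differentiation. Halving both radii makes the derivatives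
  of the terms summable uniformly: in \<open>z\<close> through the factor
  \<open>(1 / 2) ^ (k - 1)\<close>, in \<open>x\<close> through Cauchy's estimate. The domain is
  convex, as differentiation of series requires.\<close>

lemma holo_power_series:
  fixes T :: "nat \<Rightarrow> complex ^ 'n \<Rightarrow> complex"
  assumes r: "r > 0" and b: "b > 0" and x\<^sub>0: "x\<^sub>0 \<in> coord_space I"
    and T: "\<And>k. holo_on I (ball x\<^sub>0 r \<inter> coord_space I) (T k)"
    and C: "\<And>k x. x \<in> ball x\<^sub>0 r \<inter> coord_space I \<Longrightarrow> norm (T k x) \<le> C * b ^ k"
  shows "\<exists>F. holo_z_on I (ball 0 (1 / (2 * b)) \<times> (ball x\<^sub>0 (r / 2) \<inter> coord_space I)) F \<and>
    (\<forall>z\<in>ball 0 (1 / (2 * b)). \<forall>x\<in>ball x\<^sub>0 (r / 2) \<inter> coord_space I. (\<lambda>k. T k x * z ^ k) sums F (z, x))"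
proof -
  let ?S = "ball x\<^sub>0 r \<inter> coord_space I" and ?S' = "ball x\<^sub>0 (r / 2) \<inter> coord_space I"
  define P where "P = ball (0 :: complex) (1 / (2 * b)) \<times> ?S'"
  have PS: "snd p \<in> ?S'" "snd p \<in> ?S" "norm (fst p) \<le> 1 / (2 * b)" if "p \<in> P" for p
    using that r by (auto simp: P_def)
  have C0: "C \<ge> 0"
    using C[of x\<^sub>0 0] x\<^sub>0 r order_trans[OF norm_ge_zero] by fastforce
  \<comment> \<open>\<open>\<alpha>\<close> and \<open>\<beta> i\<close> are the partial derivatives
    of the \<open>k\<close>-th term along \<open>z\<close> and the \<open>i\<close>-th coordinate;
    \<open>f'\<close> and \<open>g'\<close> are the total derivatives of term and sum.\<close>
  define \<alpha> where "\<alpha> k p = T k (snd p) * (of_nat k * fst p ^ (k - 1))" for k p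
  define \<beta> where "\<beta> i k p = fst p ^ k * coord_deriv i (T k) (snd p)" for i k p
  define f' where "f' k p = (\<lambda>(w, h :: complex ^ 'n). \<alpha> k p * w + (\<Sum>i\<in>I. \<beta> i k p * h $ i))" for k p
  define g' where "g' p = (\<lambda>(w, h :: complex ^ 'n). (\<Sum>k. \<alpha> k p) * w + (\<Sum>i\<in>I. (\<Sum>k. \<beta> i k p) * h $ i))" for p
  have \<alpha>b: "norm (\<alpha> k p) \<le> C * b * (real k * (1 / 2) ^ (k - 1))" if "p \<in> P" for k p
  \<comment> \<open>For \<open>k = 0\<close> the truncated exponent \<open>k - 1\<close> is
    harmless, since the factor \<open>of_nat k\<close> vanishes.\<close>
  proof (cases k)
    case (Suc j)
    then have kj: "k - 1 = j" by simp
    have "norm (\<alpha> k p) \<le> (C * b ^ k) * (real k * (1 / (2 * b)) ^ j)"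
      unfolding \<alpha>_def norm_mult norm_power norm_of_nat kj
      using C[OF PS(2)[OF that], of k] PS(3)[OF that] C0 b
      by (intro mult_mono mult_left_mono power_mono) auto
    also have "\<dots> = C * b * (real k * (1 / 2) ^ j)"
      using b by (simp add: Suc power_divide power_mult_distrib)
    finally show ?thesis by (simp add: Suc)
  qed (simp add: \<alpha>_def)
  have \<beta>b: "norm (\<beta> i k p) \<le> C * (4 / r) * (1 / 2) ^ k" if "p \<in> P" "i \<in> I" for i k p
  proof -
    have "norm (\<beta> i k p) \<le> (1 / (2 * b)) ^ k * (C * b ^ k * (4 / r))"
      unfolding \<beta>_def norm_mult norm_power
      using PS[OF that(1)] b by (intro mult_mono power_mono coord_deriv_bound[OF T r C _ that(2)]) auto
    also have "\<dots> = C * (4 / r) * (1 / 2) ^ k"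
      using b by (simp add: power_divide power_mult_distrib)
    finally show ?thesis .
  qed
  have "summable (\<lambda>k. real (Suc k) * (1 / 2 :: real) ^ k)"
    using geometric_deriv_sums[of "1 / 2 :: real"] by (intro sums_summable) auto
  then have "summable (\<lambda>k. real k * (1 / 2 :: real) ^ (k - 1))"
    by (subst summable_Suc_iff[symmetric]) simp
  then have "summable (\<lambda>k. C * b * (real k * (1 / 2 :: real) ^ (k - 1)))"
    by (rule summable_mult)
  with \<alpha>b have \<alpha>lim: "uniform_limit P (\<lambda>n p. \<Sum>k<n. \<alpha> k p) (\<lambda>p. \<Sum>k. \<alpha> k p) sequentially"
    by (rule Weierstrass_m_test)
  have "summable (\<lambda>k. C * (4 / r) * (1 / 2 :: real) ^ k)"
    by (intro summable_mult summable_geometric) simp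
  with \<beta>b have \<beta>lim: "uniform_limit P (\<lambda>n p. \<Sum>k<n. \<beta> i k p) (\<lambda>p. \<Sum>k. \<beta> i k p) sequentially" if "i \<in> I" for i
    using that by (intro Weierstrass_m_test) auto
  have "\<exists>F. \<forall>p\<in>P. (\<lambda>k. T k (snd p) * fst p ^ k) sums F p \<and> (F has_derivative g' p) (at p within P)"
  proof (rule has_derivative_series)
    show "convex P" unfolding P_def by (intro convex_Times convex_Int convex_ball convex_coord_space)
    show "((\<lambda>p. T k (snd p) * fst p ^ k) has_derivative f' k p) (at p within P)" if p: "p \<in> P" for k p
    proof -
      have "(T k has_derivative (\<lambda>h. \<Sum>i\<in>I. coord_deriv i (T k) (snd p) * h $ i)) (at (snd p) within ?S)"
        by (rule holo_on_has_derivative[OF T openin_ball_coord_space PS(2)[OF p]])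
      then have "(T k has_derivative (\<lambda>h. \<Sum>i\<in>I. coord_deriv i (T k) (snd p) * h $ i)) (at (snd p) within snd ` P)"
        by (rule has_derivative_subset) (use PS(2) in auto)
      then have "((\<lambda>p. T k (snd p)) has_derivative (\<lambda>q. \<Sum>i\<in>I. coord_deriv i (T k) (snd p) * snd q $ i)) (at p within P)"
        by (rule has_derivative_in_compose[OF has_derivative_snd[OF has_derivative_ident]])
      from has_derivative_mult[OF this has_derivative_power[OF has_derivative_fst[OF has_derivative_ident]], of k]
      show ?thesis
        by (rule has_derivative_eq_rhs)
           (auto simp: f'_def \<alpha>_def \<beta>_def fun_eq_iff sum_distrib_left mult_ac)
    qed
    show "(0, x\<^sub>0) \<in> P" using r b x\<^sub>0 by (simp add: P_def)
    show "(\<lambda>k. T k (snd (0, x\<^sub>0)) * fst (0, x\<^sub>0) ^ k) sums (T 0 x\<^sub>0)"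
      using powser_sums_zero[of "\<lambda>k. T k x\<^sub>0"] by simp
    fix e :: real assume e: "e > 0"
    \<comment> \<open>The tolerance is shared among the \<open>card I\<close> coordinate directions
      and the direction \<open>z\<close>.\<close>
    define e' where "e' = e / (real (card I) + 1)"
    have e': "e' > 0" "e' * (real (card I) + 1) = e" using e by (auto simp: e'_def)
    have "\<forall>\<^sub>F n in sequentially. \<forall>p\<in>P. dist (\<Sum>k<n. \<alpha> k p) (\<Sum>k. \<alpha> k p) < e'"
      using uniform_limitD[OF \<alpha>lim e'(1)] .
    moreover have "\<forall>\<^sub>F n in sequentially. \<forall>i\<in>I. \<forall>p\<in>P. dist (\<Sum>k<n. \<beta> i k p) (\<Sum>k. \<beta> i k p) < e'"
      using uniform_limitD[OF \<beta>lim e'(1)] by (intro eventually_ball_finite) auto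
    ultimately show "\<forall>\<^sub>F n in sequentially. \<forall>p\<in>P. \<forall>q. norm ((\<Sum>k<n. f' k p q) - g' p q) \<le> e * norm q"
    proof eventually_elim
      case (elim n)
      show ?case
      proof (intro ballI allI)
        fix p and q :: "complex \<times> (complex ^ 'n)" assume p: "p \<in> P"
        obtain w h where q: "q = (w, h)" by (cases q)
        have wq: "norm w \<le> norm q" and hq: "norm (h $ i) \<le> norm q" for i
          using norm_fst_le[of w h] order_trans[OF Finite_Cartesian_Product.norm_nth_le norm_snd_le[of h w]] by (simp_all add: q)
        have "(\<Sum>k<n. f' k p q) = (\<Sum>k<n. \<alpha> k p) * w + (\<Sum>i\<in>I. (\<Sum>k<n. \<beta> i k p) * h $ i)"
          by (simp add: f'_def q sum.distrib sum_distrib_right sum.swap[of _ I])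
        then have "norm ((\<Sum>k<n. f' k p q) - g' p q) =
            norm (((\<Sum>k<n. \<alpha> k p) - (\<Sum>k. \<alpha> k p)) * w + (\<Sum>i\<in>I. ((\<Sum>k<n. \<beta> i k p) - (\<Sum>k. \<beta> i k p)) * h $ i))"
          by (simp add: g'_def q left_diff_distrib sum_subtractf algebra_simps)
        also have "\<dots> \<le> norm ((\<Sum>k<n. \<alpha> k p) - (\<Sum>k. \<alpha> k p)) * norm w +
            (\<Sum>i\<in>I. norm ((\<Sum>k<n. \<beta> i k p) - (\<Sum>k. \<beta> i k p)) * norm (h $ i))"
          by (intro order_trans[OF norm_triangle_ineq] add_mono sum_norm_le) (simp_all add: norm_mult)
        also have "\<dots> \<le> e' * norm q + (\<Sum>i\<in>I. e' * norm q)"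
          using elim p e'(1) wq hq
          by (intro add_mono sum_mono mult_mono) (auto simp: dist_norm intro: less_imp_le)
        also have "\<dots> = (e' * (real (card I) + 1)) * norm q" by (simp add: algebra_simps)
        finally show "norm ((\<Sum>k<n. f' k p q) - g' p q) \<le> e * norm q" unfolding e'(2) .
      qed
    qed
  qed
  then obtain F where F: "\<And>p. p \<in> P \<Longrightarrow> (\<lambda>k. T k (snd p) * fst p ^ k) sums F p"
      "\<And>p. p \<in> P \<Longrightarrow> (F has_derivative g' p) (at p within P)"
    by blast
  have "holo_z_on I P F"
    unfolding holo_z_on_def
  proof
    fix p assume "p \<in> P"
    from F(2)[OF this] show "\<exists>a b. (F has_derivative (\<lambda>(w, h). a * w + (\<Sum>i\<in>I. b i * h $ i))) (at p within P)"
      unfolding g'_def by (intro exI)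
  qed
  moreover have "\<forall>z\<in>ball 0 (1 / (2 * b)). \<forall>x\<in>?S'. (\<lambda>k. T k x * z ^ k) sums F (z, x)"
    using F(1) by (force simp: P_def)
  ultimately show ?thesis unfolding P_def by blast
qed

lemma holo_z_on_continuous: "holo_z_on I S f \<Longrightarrow> continuous_on S f"
  unfolding holo_z_on_def continuous_on_eq_continuous_within
  using has_derivative_continuous by blast

lemma finite_family_bounded:
  fixes g :: "'j \<Rightarrow> 'a::topological_space \<Rightarrow> complex"
  assumes "finite J" "compact Q" "\<And>j. j \<in> J \<Longrightarrow> continuous_on Q (g j)"
  obtains K where "K \<ge> 0" "\<And>j q. j \<in> J \<Longrightarrow> q \<in> Q \<Longrightarrow> norm (g j q) \<le> K"
proof -
  have "\<forall>j\<in>J. \<exists>K. \<forall>q\<in>Q. norm (g j q) \<le> K"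
    using compact_imp_bounded[OF compact_continuous_image[OF assms(3) assms(2)]]
    by (auto simp: bounded_iff)
  then obtain K where K: "\<And>j q. j \<in> J \<Longrightarrow> q \<in> Q \<Longrightarrow> norm (g j q) \<le> K j" by metis
  show thesis
  proof
    show "(\<Sum>j\<in>J. \<bar>K j\<bar>) \<ge> 0" by (intro sum_nonneg) auto
    fix j q assume j: "j \<in> J" "q \<in> Q"
    have "norm (g j q) \<le> \<bar>K j\<bar>" using K[OF j] by linarith
    also have "\<dots> \<le> (\<Sum>j\<in>J. \<bar>K j\<bar>)" using j(1) assms(1) by (intro member_le_sum) auto
    finally show "norm (g j q) \<le> (\<Sum>j\<in>J. \<bar>K j\<bar>)" .
  qed
qed

section \<open>Convergence of formal isomorphisms\<close>

text \<open>This compares coefficients of \<open>z\<^sup>k\<^sup>+\<^sup>1\<close>: the factor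
  \<open>fps_X\<close> in front of the derivative is the pole of order one, and makes the derivative
  of \<open>T k\<close> involve \<open>T\<close> up to index \<open>Suc k\<close>.\<close>

lemma formal_t_equation_coeff:
  fixes A :: "complex \<Rightarrow> complex ^ 'r ^ 'r" and A' :: "complex \<Rightarrow> complex ^ 's ^ 's"
    and T :: "nat \<Rightarrow> complex ^ 's ^ 'r"
  assumes "0 = (\<chi> a b. fps_X * Abs_fps (\<lambda>k. t k a b)) + taylor_z A ** fps_matrix T - fps_matrix T ** taylor_z A'"
  shows "t k a b =
    (\<Sum>l\<le>Suc k. (\<Sum>d\<in>UNIV. fps_nth (fps_expansion (\<lambda>z. A' z $ d $ b) 0) l * T (Suc k - l) $ a $ d) -
      (\<Sum>c\<in>UNIV. fps_nth (fps_expansion (\<lambda>z. A z $ a $ c) 0) l * T (Suc k - l) $ c $ b))"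
proof -
  have "fps_X * Abs_fps (\<lambda>k. t k a b) =
      (\<Sum>d\<in>UNIV. fps_expansion (\<lambda>z. A' z $ d $ b) 0 * Abs_fps (\<lambda>k. T k $ a $ d)) -
      (\<Sum>c\<in>UNIV. fps_expansion (\<lambda>z. A z $ a $ c) 0 * Abs_fps (\<lambda>k. T k $ c $ b))"
    using arg_cong[OF assms, of "\<lambda>M. M $ a $ b"]
    by (simp add: matrix_mult_nth fps_matrix_def taylor_z_def algebra_simps)
  moreover have "fps_nth (fps_X * Abs_fps (\<lambda>k. t k a b)) (Suc k) = t k a b" by simp
  ultimately show ?thesis
    by (simp add: fps_sum_nth fps_mult_nth atLeast0AtMost sum_subtractf sum.swap[of _ "{..Suc k}"] del: sum.atMost_Suc)
qed

text \<open>Along each complex line through \<open>x\<^sub>0\<close> the equations in the \<open>t\<close> directions become one linear system in \<open>s\<close>.\<close>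

lemma formal_isomorphism_locally_bounded:
  fixes A :: "'n::finite \<Rightarrow> complex \<times> (complex ^ 'n) \<Rightarrow> complex ^ 'r ^ 'r::finite"
    and A' :: "'n \<Rightarrow> complex \<times> (complex ^ 'n) \<Rightarrow> complex ^ 's ^ 's::finite"
    and T :: "nat \<Rightarrow> complex ^ 'n \<Rightarrow> complex ^ 's ^ 'r"
  assumes S: "openin (top_of_set (coord_space I)) S" and x\<^sub>0: "x\<^sub>0 \<in> S"
    and r\<^sub>0: "r\<^sub>0 > 0"
    and A: "\<And>i a b. i \<in> I \<Longrightarrow> holo_z_on I (ball 0 r\<^sub>0 \<times> (ball x\<^sub>0 r\<^sub>0 \<inter> coord_space I)) (\<lambda>p. A i p $ a $ b)"
    and A': "\<And>i a b. i \<in> I \<Longrightarrow> holo_z_on I (ball 0 r\<^sub>0 \<times> (ball x\<^sub>0 r\<^sub>0 \<inter> coord_space I)) (\<lambda>p. A' i p $ a $ b)"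
    and T: "\<And>k a b. holo_on I S (\<lambda>x. T k x $ a $ b)"
    and eq: "\<And>x i. x \<in> S \<Longrightarrow> i \<in> I \<Longrightarrow>
      0 = (\<chi> a b. fps_X * Abs_fps (\<lambda>k. coord_deriv i (\<lambda>y. T k y $ a $ b) x))
        + taylor_z (\<lambda>z. A i (z, x)) ** fps_matrix (\<lambda>k. T k x)
        - fps_matrix (\<lambda>k. T k x) ** taylor_z (\<lambda>z. A' i (z, x))"
    and conv: "conv_mat (fps_matrix (\<lambda>k. T k x\<^sub>0))"
  obtains r C b where "r > 0" "b > 0" "ball x\<^sub>0 r \<inter> coord_space I \<subseteq> S"
    "\<And>k a c x. x \<in> ball x\<^sub>0 r \<inter> coord_space I \<Longrightarrow> norm (T k x $ a $ c) \<le> C * b ^ k"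
proof -
  have x\<^sub>0I: "x\<^sub>0 \<in> coord_space I" using S x\<^sub>0 openin_imp_subset by blast
  obtain e where e: "e > 0" "ball x\<^sub>0 e \<inter> coord_space I \<subseteq> S"
    using S x\<^sub>0 by (auto simp: openin_contains_ball)
  \<comment> \<open>Half the radius places the closed ball inside the domains of the connection
    matrices and of \<open>T\<close>; compactness then bounds the matrices.\<close>
  define r where "r = min r\<^sub>0 e / 2"
  have r: "r > 0" "r < r\<^sub>0" "r < e" using r\<^sub>0 e(1) by (auto simp: r_def)
  let ?Q = "cball (0 :: complex) r \<times> (cball x\<^sub>0 r \<inter> coord_space I)"
  have cQ: "compact ?Q"
    by (intro compact_Times compact_Int_closed compact_cball closed_coord_space)
  have Q: "?Q \<subseteq> ball 0 r\<^sub>0 \<times> (ball x\<^sub>0 r\<^sub>0 \<inter> coord_space I)" using r by auto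
  obtain K1 where K1: "K1 \<ge> 0"
    "\<And>j q. j \<in> I \<times> UNIV \<Longrightarrow> q \<in> ?Q \<Longrightarrow> norm ((\<lambda>(i, a, b) p. A i p $ a $ b) j q) \<le> K1"
    by (rule finite_family_bounded[of "I \<times> UNIV" ?Q "\<lambda>(i, a, b) p. A i p $ a $ b"])
       (auto intro!: cQ continuous_on_subset[OF holo_z_on_continuous[OF A] Q])
  obtain K2 where K2: "K2 \<ge> 0"
    "\<And>j q. j \<in> I \<times> UNIV \<Longrightarrow> q \<in> ?Q \<Longrightarrow> norm ((\<lambda>(i, a, b) p. A' i p $ a $ b) j q) \<le> K2"
    by (rule finite_family_bounded[of "I \<times> UNIV" ?Q "\<lambda>(i, a, b) p. A' i p $ a $ b"])
       (auto intro!: cQ continuous_on_subset[OF holo_z_on_continuous[OF A'] Q])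
  obtain C0 b0 where C0: "C0 > 0" "b0 > 0"
    "\<And>p k. p \<in> UNIV \<Longrightarrow> norm (fps_nth (fps_matrix (\<lambda>k. T k x\<^sub>0) $ fst p $ snd p) k) \<le> C0 * b0 ^ k"
    using conv_fps_uniform_bound[of "UNIV :: ('r \<times> 's) set" "\<lambda>p. fps_matrix (\<lambda>k. T k x\<^sub>0) $ fst p $ snd p"]
      conv by (auto simp: conv_mat_def)
  define d where "d = 2 / r"
  \<comment> \<open>\<open>K\<close> sums over the directions, as the components of the line
    direction will have norm at most 1. \<open>b\<close> dominates both the growth \<open>b0\<close>
    at the centre and \<open>2 * d\<close>, \<open>C\<close> sums over all matrix entries, and
    \<open>\<alpha>\<close> is a sum in order to meet both lower bounds required of it.\<close>
  define K where "K = real (card I) * (K2 + K1)"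
  define b where "b = max b0 (2 * d)"
  define C where "C = real CARD('r \<times> 's) * C0"
  define \<alpha> where "\<alpha> = 4 / r + 4 * (real CARD('r \<times> 's) * K) * b"
  have pos: "d > 0" "K \<ge> 0" "b > 0" "C \<ge> 0" "b \<ge> 2 * d"
    using r K1(1) K2(1) C0 by (auto simp: d_def K_def b_def C_def)
  have \<alpha>: "\<alpha> \<ge> 4 / r" "\<alpha> \<ge> 4 * (real CARD('r \<times> 's) * K) * b"
    using pos r by (auto simp: \<alpha>_def)
  have \<alpha>0: "\<alpha> > 0" using \<alpha>(1) r(1) by (meson divide_pos_pos less_le_trans zero_less_numeral)
  define r' where "r' = min r (1 / (2 * \<alpha>))"
  have r': "r' > 0" "r' \<le> r" "r' \<le> 1 / (2 * \<alpha>)" using \<alpha>0 r by (auto simp: r'_def)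
  have bound: "norm (T k x $ a $ c) \<le> 2 * C * b ^ k" if x: "x \<in> ball x\<^sub>0 r' \<inter> coord_space I" for k a c x
  proof -
    \<comment> \<open>The direction is normalised so that \<open>x\<close> sits at parameter
      \<open>r'\<close> and \<open>norm h \<le> 1\<close>. All constants were fixed before
      \<open>x\<close>, hence the bound is uniform over directions.\<close>
    define h where "h = (of_real (1 / r') :: complex) *s (x - x\<^sub>0)"
    have nh: "norm h \<le> 1"
      using x r'(1) unfolding h_def norm_vector_scalar_mult by (simp add: dist_norm norm_minus_commute norm_divide)
    have hI: "h \<in> coord_space I" using x x\<^sub>0I by (simp add: h_def coord_space_def)
    have xh: "x\<^sub>0 + of_real r' *s h = x" using r'(1) by (simp add: h_def vec_eq_iff)
    have nhi: "norm (h $ i) \<le> 1" for i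
      using order_trans[OF Finite_Cartesian_Product.norm_nth_le nh] .
    have line: "x\<^sub>0 + s *s h \<in> cball x\<^sub>0 r \<inter> coord_space I" if "s \<in> ball 0 r" for s
    proof
      show "x\<^sub>0 + s *s h \<in> cball x\<^sub>0 r"
        using that nh r(1) mult_mono[of "norm s" r "norm h" 1] by (simp add: dist_line)
      show "x\<^sub>0 + s *s h \<in> coord_space I" by (rule coord_space_line[OF x\<^sub>0I hI])
    qed
    have lineS: "x\<^sub>0 + s *s h \<in> S" if "s \<in> ball 0 r" for s
      using line[OF that] e(2) r(3) by auto
    define f where "f p k s = T k (x\<^sub>0 + s *s h) $ fst p $ snd p" for p :: "'r \<times> 's" and k s
    define X where "X i l s a c = fps_nth (fps_expansion (\<lambda>z. A i (z, x\<^sub>0 + s *s h) $ a $ c) 0) l" for i l s a c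
    define Y where "Y i l s a c = fps_nth (fps_expansion (\<lambda>z. A' i (z, x\<^sub>0 + s *s h) $ a $ c) 0) l" for i l s a c
    \<comment> \<open>The chain rule combines the equations with weights \<open>h $ i\<close>; the
      case distinctions are the pair-indexed form of \<open>commutator_sum\<close>.\<close>
    define M where "M p q l s = (\<Sum>i\<in>I. h $ i * ((if fst q = fst p then Y i l s (snd q) (snd p) else 0) -
        (if snd q = snd p then X i l s (fst p) (fst q) else 0)))" for p q :: "'r \<times> 's" and l s
    have dom: "(z, x\<^sub>0 + s *s h) \<in> ball 0 r\<^sub>0 \<times> (ball x\<^sub>0 r\<^sub>0 \<inter> coord_space I)" "(z, x\<^sub>0 + s *s h) \<in> ?Q"
      if "z \<in> ball 0 r" "s \<in> ball 0 r" for z s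
      using that line[OF that(2)] r(2) by auto
    have hz: "(\<lambda>z. A i (z, x\<^sub>0 + s *s h) $ a $ c) holomorphic_on ball 0 r" if "i \<in> I" "s \<in> ball 0 r" for i s a c
      by (rule holo_z_on_slice[OF A[OF that(1)] open_ball]) (use dom(1) that(2) in blast)
    have hz': "(\<lambda>z. A' i (z, x\<^sub>0 + s *s h) $ a $ c) holomorphic_on ball 0 r" if "i \<in> I" "s \<in> ball 0 r" for i s a c
      by (rule holo_z_on_slice[OF A'[OF that(1)] open_ball]) (use dom(1) that(2) in blast)
    have hs: "(\<lambda>s. A i (z, x\<^sub>0 + s *s h) $ a $ c) holomorphic_on ball 0 r" if "i \<in> I" "z \<in> ball 0 r" for i z a c
      by (rule holo_z_on_line[OF A[OF that(1)] open_ball]) (use dom(1) that(2) in blast)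
    have hs': "(\<lambda>s. A' i (z, x\<^sub>0 + s *s h) $ a $ c) holomorphic_on ball 0 r" if "i \<in> I" "z \<in> ball 0 r" for i z a c
      by (rule holo_z_on_line[OF A'[OF that(1)] open_ball]) (use dom(1) that(2) in blast)
    have Kz: "norm (A i (z, x\<^sub>0 + s *s h) $ a $ c) \<le> K1" if "i \<in> I" "z \<in> ball 0 r" "s \<in> ball 0 r" for i z s a c
      using K1(2)[of "(i, a, c)", OF _ dom(2)[OF that(2,3)]] that(1) by simp
    have Kz': "norm (A' i (z, x\<^sub>0 + s *s h) $ a $ c) \<le> K2" if "i \<in> I" "z \<in> ball 0 r" "s \<in> ball 0 r" for i z s a c
      using K2(2)[of "(i, a, c)", OF _ dom(2)[OF that(2,3)]] that(1) by simp
    have X: "(\<lambda>s. X i l s a c) holomorphic_on ball 0 r" if "i \<in> I" for i l a c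
      unfolding X_def
      by (rule fps_expansion_nth_holomorphic[OF r(1) hz[OF that] open_ball hs[OF that] Kz[OF that]])
    have Y: "(\<lambda>s. Y i l s a c) holomorphic_on ball 0 r" if "i \<in> I" for i l a c
      unfolding Y_def
      by (rule fps_expansion_nth_holomorphic[OF r(1) hz'[OF that] open_ball hs'[OF that] Kz'[OF that]])
    have Xb: "norm (X i l s a c) \<le> K1 * d ^ l" if "i \<in> I" "s \<in> ball 0 r" for i l s a c
      unfolding X_def d_def by (rule fps_expansion_bound[OF hz[OF that] r(1) Kz[OF that(1) _ that(2)]])
    have Yb: "norm (Y i l s a c) \<le> K2 * d ^ l" if "i \<in> I" "s \<in> ball 0 r" for i l s a c
      unfolding Y_def d_def by (rule fps_expansion_bound[OF hz'[OF that] r(1) Kz'[OF that(1) _ that(2)]])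
    have der: "(f p k has_field_derivative (\<Sum>i\<in>I. coord_deriv i (\<lambda>y. T k y $ fst p $ snd p) (x\<^sub>0 + s *s h) * h $ i)) (at s)"
      if "s \<in> ball 0 r" for p k s
      unfolding f_def[abs_def] by (rule holo_on_line[OF T S open_ball lineS that])
    have "norm (f (a, c) k (of_real r')) \<le> 2 * C * b ^ k"
    proof (rule singular_ode_bound[where f = f and i = "(a, c)" and k = k and M = M and K = K and d = d and \<alpha> = \<alpha> and r = r])
      show "f p k holomorphic_on ball 0 r" for p k
        using der unfolding holomorphic_on_open[OF open_ball] by blast
      show "M p q l holomorphic_on ball 0 r" for p q l
        unfolding M_def[abs_def]
        by (intro holomorphic_intros; cases "fst q = fst p"; cases "snd q = snd p") (auto intro: X Y)
      show "norm (M p q l s) \<le> K * d ^ l" if s: "s \<in> ball 0 r" for p q l s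
      proof -
        have "norm (M p q l s) \<le> (\<Sum>i\<in>I. 1 * (K2 * d ^ l + K1 * d ^ l))"
          unfolding M_def
        proof (rule sum_norm_le)
          fix i assume i: "i \<in> I"
          have "norm ((if fst q = fst p then Y i l s (snd q) (snd p) else 0) -
              (if snd q = snd p then X i l s (fst p) (fst q) else 0)) \<le> K2 * d ^ l + K1 * d ^ l"
            using Xb[OF i s] Yb[OF i s] K1(1) K2(1) pos(1)
            by (intro order_trans[OF norm_triangle_ineq4] add_mono) auto
          then show "norm (h $ i * ((if fst q = fst p then Y i l s (snd q) (snd p) else 0) -
              (if snd q = snd p then X i l s (fst p) (fst q) else 0))) \<le> 1 * (K2 * d ^ l + K1 * d ^ l)"
            unfolding norm_mult by (intro mult_mono nhi) auto
        qed
        then show ?thesis by (simp add: K_def algebra_simps)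
      qed
      show "deriv (f p k) s = (\<Sum>q\<in>UNIV. \<Sum>l\<le>Suc k. M p q l s * f q (Suc k - l) s)" if s: "s \<in> ball 0 r" for p k s
      proof -
        have "deriv (f p k) s = (\<Sum>i\<in>I. h $ i * coord_deriv i (\<lambda>y. T k y $ fst p $ snd p) (x\<^sub>0 + s *s h))"
          using DERIV_imp_deriv[OF der[OF s]] by (simp add: mult.commute)
        also have "\<dots> = (\<Sum>i\<in>I. h $ i * (\<Sum>l\<le>Suc k.
            (\<Sum>d\<in>UNIV. Y i l s d (snd p) * T (Suc k - l) (x\<^sub>0 + s *s h) $ fst p $ d) -
            (\<Sum>c\<in>UNIV. X i l s (fst p) c * T (Suc k - l) (x\<^sub>0 + s *s h) $ c $ snd p)))"
          unfolding X_def Y_def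
          by (intro sum.cong refl arg_cong2[where f = "(*)"] formal_t_equation_coeff[OF eq[OF lineS[OF s]]])
        also have "\<dots> = (\<Sum>i\<in>I. h $ i * (\<Sum>l\<le>Suc k. \<Sum>q\<in>UNIV.
            ((if fst q = fst p then Y i l s (snd q) (snd p) else 0) -
             (if snd q = snd p then X i l s (fst p) (fst q) else 0)) * f q (Suc k - l) s))"
          unfolding f_def
          by (simp only: commutator_sum[of "fst p" _ "snd p" _ "\<lambda>c d. T _ (x\<^sub>0 + s *s h) $ c $ d"])
        also have "\<dots> = (\<Sum>i\<in>I. \<Sum>l\<le>Suc k. \<Sum>q\<in>UNIV. h $ i *
            ((if fst q = fst p then Y i l s (snd q) (snd p) else 0) -
             (if snd q = snd p then X i l s (fst p) (fst q) else 0)) * f q (Suc k - l) s)"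
          by (simp only: sum_distrib_left mult.assoc)
        also have "\<dots> = (\<Sum>i\<in>I. \<Sum>q\<in>UNIV. \<Sum>l\<le>Suc k. h $ i *
            ((if fst q = fst p then Y i l s (snd q) (snd p) else 0) -
             (if snd q = snd p then X i l s (fst p) (fst q) else 0)) * f q (Suc k - l) s)"
          by (intro sum.cong refl sum.swap)
        also have "\<dots> = (\<Sum>q\<in>UNIV. \<Sum>i\<in>I. \<Sum>l\<le>Suc k. h $ i *
            ((if fst q = fst p then Y i l s (snd q) (snd p) else 0) -
             (if snd q = snd p then X i l s (fst p) (fst q) else 0)) * f q (Suc k - l) s)"
          by (rule sum.swap)
        also have "\<dots> = (\<Sum>q\<in>UNIV. \<Sum>l\<le>Suc k. \<Sum>i\<in>I. h $ i *
            ((if fst q = fst p then Y i l s (snd q) (snd p) else 0) -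
             (if snd q = snd p then X i l s (fst p) (fst q) else 0)) * f q (Suc k - l) s)"
          by (intro sum.cong refl sum.swap)
        finally show ?thesis by (simp only: M_def sum_distrib_right)
      qed
      show "(\<Sum>p\<in>UNIV. norm (f p k 0)) \<le> C * b ^ k" for k
      proof -
        have "(\<Sum>p\<in>UNIV. norm (f p k 0)) \<le> (\<Sum>p\<in>(UNIV :: ('r \<times> 's) set). C0 * b ^ k)"
        proof (rule sum_mono)
          fix p :: "'r \<times> 's"
          have "norm (f p k 0) \<le> C0 * b0 ^ k"
            using C0(3)[of p k] by (simp add: f_def fps_matrix_def)
          also have "\<dots> \<le> C0 * b ^ k"
            using C0 by (intro mult_left_mono power_mono) (auto simp: b_def)
          finally show "norm (f p k 0) \<le> C0 * b ^ k" .
        qed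
        then show ?thesis by (simp add: C_def)
      qed
      show "norm (of_real r' :: complex) \<le> 1 / (2 * \<alpha>)" using r' by simp
    qed (use r(1) pos \<alpha> in auto)
    then show ?thesis by (simp add: f_def xh)
  qed
  show thesis
  proof (rule that[OF r'(1) pos(3) _ bound])
    show "ball x\<^sub>0 r' \<inter> coord_space I \<subseteq> S" using e(2) r(3) r'(2) by auto
  qed
qed

section \<open>Charts, product neighbourhoods and the final convergence statement\<close>

lemma open_image_chart:
  assumes "is_chart I c" "open N" "N \<subseteq> fst c"
  shows "openin (top_of_set (coord_space I)) (snd c ` N)"
proof -
  have "openin (top_of_set (fst c)) N"
    using assms(2,3) by (simp add: open_subset)
  then have "openin (top_of_set (snd c ` fst c)) (snd c ` N)"
    using homeomorphism_imp_open_map[of "fst c" _ "snd c" "chart_inv c"] assms(1)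
    unfolding is_chart_def by blast
  moreover have "openin (top_of_set (coord_space I)) (snd c ` fst c)"
    using assms(1) unfolding is_chart_def by simp
  ultimately show ?thesis by (rule openin_trans)
qed

text \<open>A product domain is needed because functions on it are sliced in \<open>z\<close> and
  restricted to lines in \<open>t\<close> independently.\<close>

lemma in_coords_contains_product:
  fixes c :: "('m::topological_space, 'n::finite) chart"
  assumes c: "is_chart I c" and W: "open W" "(0, t) \<in> W" "t \<in> fst c"
  obtains r where "r > 0" "ball 0 r \<times> (ball (snd c t) r \<inter> coord_space I) \<subseteq> in_coords c W"
proof -
  obtain Z N where ZN: "open Z" "open N" "0 \<in> Z" "t \<in> N" "Z \<times> N \<subseteq> W"
    using W(1,2) by (rule open_prod_elim) auto
  have "openin (top_of_set (coord_space I)) (snd c ` (N \<inter> fst c))"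
    using c ZN(2) by (intro open_image_chart) (auto simp: is_chart_def)
  then obtain e where e: "e > 0" "ball (snd c t) e \<inter> coord_space I \<subseteq> snd c ` (N \<inter> fst c)"
    using ZN(4) W(3) unfolding openin_contains_ball by blast
  obtain \<delta> where \<delta>: "\<delta> > 0" "ball 0 \<delta> \<subseteq> Z"
    using ZN(1,3) open_contains_ball by blast
  show thesis
  proof
    show "min e \<delta> > 0" using e(1) \<delta>(1) by simp
    show "ball 0 (min e \<delta>) \<times> (ball (snd c t) (min e \<delta>) \<inter> coord_space I) \<subseteq> in_coords c W"
    proof
      fix p :: "complex \<times> (complex ^ 'n)" assume p: "p \<in> ball 0 (min e \<delta>) \<times> (ball (snd c t) (min e \<delta>) \<inter> coord_space I)"
      then have "fst p \<in> Z" "snd p \<in> snd c ` (N \<inter> fst c)" using e(2) \<delta>(2) by auto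
      then show "p \<in> in_coords c W"
        using ZN(5) by (cases p) (force simp: in_coords_def)
    qed
  qed
qed

lemma converges_holomorphicallyI:
  fixes T :: "nat \<Rightarrow> complex ^ 'n::finite \<Rightarrow> complex ^ 's ^ 'r"
  assumes c: "is_chart I c" "t\<^sub>0 \<in> fst c" and r: "r > 0" and b: "b > 0"
    and T: "\<And>k a e. holo_on I (ball (snd c t\<^sub>0) r \<inter> coord_space I) (\<lambda>x. T k x $ a $ e)"
    and C: "\<And>k a e x. x \<in> ball (snd c t\<^sub>0) r \<inter> coord_space I \<Longrightarrow> norm (T k x $ a $ e) \<le> C * b ^ k"
  shows "converges_holomorphically I c t\<^sub>0 T"
proof -
  let ?B = "ball (snd c t\<^sub>0) (r / 2) \<inter> coord_space I"
  have sub: "snd c ` fst c \<subseteq> coord_space I"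
    using c(1) openin_imp_subset[of euclidean "coord_space I" "snd c ` fst c"] by (simp add: is_chart_def)
  define P where "P a e F \<longleftrightarrow> holo_z_on I (ball 0 (1 / (2 * b)) \<times> ?B) F \<and>
      (\<forall>z\<in>ball 0 (1 / (2 * b)). \<forall>x\<in>?B. (\<lambda>k. T k x $ a $ e * z ^ k) sums F (z, x))" for a e F
  have "\<exists>F. P a e F" for a e
  proof -
    have "snd c t\<^sub>0 \<in> coord_space I" using sub c(2) by blast
    then show ?thesis
      unfolding P_def by (rule holo_power_series[OF r b _ T C])
  qed
  then obtain F where F: "\<And>a e. P a e (F a e)" by metis
  define V where "V = fst c \<inter> snd c -` ball (snd c t\<^sub>0) (r / 2)"
  have "continuous_on (fst c) (snd c)" "open (fst c)"
    using c(1) by (simp_all add: is_chart_def homeomorphism_def)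
  then have "open V" unfolding V_def by (intro continuous_open_preimage) auto
  moreover have "t\<^sub>0 \<in> V" "V \<subseteq> fst c" using c(2) r by (auto simp: V_def)
  moreover have V: "snd c ` V \<subseteq> ?B" using sub unfolding V_def by blast
  moreover have "\<forall>a e. holo_z_on I (ball 0 (1 / (2 * b)) \<times> snd c ` V) (\<lambda>p. (\<chi> a e. F a e p) $ a $ e)"
  proof (intro allI)
    fix a e
    have "holo_z_on I (ball 0 (1 / (2 * b)) \<times> snd c ` V) (F a e)"
      by (rule holo_z_on_subset[OF F[unfolded P_def, THEN conjunct1]]) (use V in blast)
    then show "holo_z_on I (ball 0 (1 / (2 * b)) \<times> snd c ` V) (\<lambda>p. (\<chi> a e. F a e p) $ a $ e)" by simp
  qed
  moreover have "\<forall>z\<in>ball 0 (1 / (2 * b)). \<forall>x\<in>snd c ` V. \<forall>a e.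
      (\<lambda>k. T k x $ a $ e * z ^ k) sums ((\<chi> a e. F a e (z, x)) $ a $ e)"
  proof (intro ballI allI)
    fix z x a e assume "z \<in> ball (0 :: complex) (1 / (2 * b))" "x \<in> snd c ` V"
    with V have "z \<in> ball 0 (1 / (2 * b))" "x \<in> ?B" by blast+
    then show "(\<lambda>k. T k x $ a $ e * z ^ k) sums ((\<chi> a e. F a e (z, x)) $ a $ e)"
      using F[unfolded P_def, THEN conjunct2, rule_format, of z x a e] by simp
  qed
  ultimately show ?thesis
    unfolding converges_holomorphically_def
    by (intro exI[of _ "1 / (2 * b)"] exI[of _ V] exI[of _ "\<lambda>p. \<chi> a e. F a e p"] conjI) (use b in simp)
qed

theorem corollary5p7:
  fixes I :: "'n::finite set"
    and \<A> :: "('m::{second_countable_topology, t2_space}, 'n) chart set"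
    and H :: "('m, 'h, 'r::finite) vbundle" and D :: "('m, 'n, 'h) covariant"
    and H' :: "('m, 'k, 's::finite) vbundle" and D' :: "('m, 'n, 'k) covariant"
    and t\<^sub>0 :: 'm and c :: "('m, 'n) chart"
    and T :: "nat \<Rightarrow> complex ^ 'n \<Rightarrow> complex ^ 's ^ 'r"
  assumes "TE_structure I \<A> H D" and "TE_structure I \<A> H' D'"
    and "regular_singular_at I \<A> H D t\<^sub>0 \<or> regular_singular_at I \<A> H' D' t\<^sub>0"
    and "TE_basis I \<A> H D t\<^sub>0 c W v A B" and "TE_basis I \<A> H' D' t\<^sub>0 c W' v' A' B'"
    and "open N" and "t\<^sub>0 \<in> N" and "{0} \<times> N \<subseteq> W \<inter> W'"
    and "formal_isomorphism I (snd c ` N) A B A' B' T"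
  shows "converges_holomorphically I c t\<^sub>0 T"
proof -
  interpret H: TE_structure I \<A> H D by fact
  interpret H': TE_structure I \<A> H' D' by fact
  let ?x = "snd c t\<^sub>0" and ?S = "snd c ` N"
  have c: "is_chart I c"
    using assms(4) by (simp add: TE_basis_def local_coordinates_def)
  have W: "open W" "(0, t\<^sub>0) \<in> W" "W \<subseteq> UNIV \<times> fst c" and W': "open W'" "(0, t\<^sub>0) \<in> W'"
    using assms(4,5) unfolding TE_basis_def local_frame_def by auto
  have A: "holo_z_on I (in_coords c W) (\<lambda>p. A i p $ a $ b)"
    and A': "holo_z_on I (in_coords c W') (\<lambda>p. A' i p $ d $ e)" if "i \<in> I" for i a b d e
    using assms(4,5) that unfolding TE_basis_def by auto
  have N: "N \<subseteq> fst c" using assms(8) W(3) by auto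
  have t0: "t\<^sub>0 \<in> fst c" "?x \<in> ?S" using assms(7) N by auto
  have S: "openin (top_of_set (coord_space I)) ?S"
    by (rule open_image_chart[OF c assms(6) N])
  note iso = assms(9)[unfolded formal_isomorphism_def]
  have T: "holo_on I ?S (\<lambda>x. T k x $ a $ b)" for k a b
    using iso by blast
  \<comment> \<open>At the single point \<open>t\<^sub>0\<close> only the equation in
    \<open>z\<close> enters; this is where regularity is used.\<close>
  have conv: "conv_mat (fps_matrix (\<lambda>k. T k ?x))"
  proof (rule formal_isomorphism_conv)
    let ?B = "taylor_z (\<lambda>z. B (z, ?x))" and ?B' = "taylor_z (\<lambda>z. B' (z, ?x))"
    show "fuchsian_equivalent ?B \<or> fuchsian_equivalent ?B'"
      using assms(3) H.regular_singular_basis_independent[OF assms(4)]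
        H'.regular_singular_basis_independent[OF assms(5)] by blast
    show "conv_mat ?B" "conv_mat ?B'"
      using TE_basis_slice_analytic[OF assms(4)] TE_basis_slice_analytic[OF assms(5)]
      by (blast intro: mat_expansion_conv mat_expansion_taylor)+
    have "(\<chi> a b. fps_nth (fps_matrix (\<lambda>k. T k ?x) $ a $ b) 0) = T 0 ?x"
      by (simp add: fps_matrix_def vec_eq_iff)
    then show "invertible (\<chi> a b. fps_nth (fps_matrix (\<lambda>k. T k ?x) $ a $ b) 0)"
      using iso t0(2) by auto
    have "0 = (\<chi> a b. fps_X\<^sup>2 * fps_deriv (fps_matrix (\<lambda>k. T k ?x) $ a $ b))
        + ?B ** fps_matrix (\<lambda>k. T k ?x) - fps_matrix (\<lambda>k. T k ?x) ** ?B'"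
      using iso t0(2) by blast
    moreover have "(\<chi> a b. fps_X\<^sup>2 * fps_deriv (fps_matrix (\<lambda>k. T k ?x) $ a $ b)) =
        fps_X\<^sup>2 *k mderiv (fps_matrix (\<lambda>k. T k ?x))"
      by (simp add: vec_eq_iff)
    ultimately show "?B ** fps_matrix (\<lambda>k. T k ?x) + fps_X\<^sup>2 *k mderiv (fps_matrix (\<lambda>k. T k ?x)) =
        fps_matrix (\<lambda>k. T k ?x) ** ?B'"
      by (simp add: algebra_simps)
  qed
  obtain r1 where r1: "r1 > 0" "ball 0 r1 \<times> (ball ?x r1 \<inter> coord_space I) \<subseteq> in_coords c W"
    by (rule in_coords_contains_product[OF c W(1,2) t0(1)])
  obtain r2 where r2: "r2 > 0" "ball 0 r2 \<times> (ball ?x r2 \<inter> coord_space I) \<subseteq> in_coords c W'"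
    by (rule in_coords_contains_product[OF c W' t0(1)])
  \<comment> \<open>A common polydisc on which the connection matrices of both structures are
    holomorphic.\<close>
  define r\<^sub>0 where "r\<^sub>0 = min r1 r2"
  have r\<^sub>0: "r\<^sub>0 > 0" using r1(1) r2(1) by (simp add: r\<^sub>0_def)
  have sub: "ball 0 r\<^sub>0 \<times> (ball ?x r\<^sub>0 \<inter> coord_space I) \<subseteq> in_coords c W"
    "ball 0 r\<^sub>0 \<times> (ball ?x r\<^sub>0 \<inter> coord_space I) \<subseteq> in_coords c W'"
    using r1(2) r2(2) by (auto simp: r\<^sub>0_def subset_iff)
  have eq: "0 = (\<chi> a b. fps_X * Abs_fps (\<lambda>k. coord_deriv i (\<lambda>y. T k y $ a $ b) x))
      + taylor_z (\<lambda>z. A i (z, x)) ** fps_matrix (\<lambda>k. T k x)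
      - fps_matrix (\<lambda>k. T k x) ** taylor_z (\<lambda>z. A' i (z, x))" if "x \<in> ?S" "i \<in> I" for x i
    using iso that by blast
  \<comment> \<open>The bound at the centre spreads to a ball by the equations in \<open>t\<close>;
    it is uniform in \<open>x\<close>, which is what joint holomorphy of the sum requires.\<close>
  obtain r C b where "r > 0" "b > 0" and rS: "ball ?x r \<inter> coord_space I \<subseteq> ?S"
    and "\<And>k a d x. x \<in> ball ?x r \<inter> coord_space I \<Longrightarrow> norm (T k x $ a $ d) \<le> C * b ^ k"
    using formal_isomorphism_locally_bounded[OF S t0(2) r\<^sub>0 holo_z_on_subset[OF A sub(1)]
        holo_z_on_subset[OF A' sub(2)] T eq conv] by metis
  then show ?thesis
    by (intro converges_holomorphicallyI[OF c t0(1) _ _ holo_on_subset[OF T rS]])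
qed

end
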